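(* For every $\alpha<1$ and $\vartheta\in\mathbb{R}$, we have $\mathcal P(\mathcal V_{\alpha,\vartheta})=\Sigma_{\alpha,\vartheta}$ and $\mathcal V^c_{\alpha,\vartheta}=t_{\alpha,\vartheta}\,\lambda$. If $(\alpha,\vartheta)\in Q_0$, then $\Sigma_{\alpha,\vartheta}=\varnothing$. If $(\alpha,\vartheta)\in Q_{\geq1}$ and $E\in\Sigma_{\alpha,\vartheta}$, then $$\mathcal V_{\alpha,\vartheta}(\{E\})=\frac{|E|}{2\,\mathrm{Sinc}(\pi^2\alpha)\left(\mathrm{Cos}^2(\pi^2\alpha/4)-\sin^2\vartheta\right)}.$$
   Context: $\lambda$ is the Lebesgue measure on $\mathbb{R}$. The entire functions $\mathrm{Cos}$ and $\mathrm{Sinc}$ are $\mathrm{Cos}\,\zeta=\sum_{k\ge0}\frac{(-\zeta)^k}{(2k)!}$, $\mathrm{Sinc}\,\zeta=\sum_{k\ge0}\frac{(-\zeta)^k}{(2k+1)!}$; $\mathrm{Cos}^2,\mathrm{Sinc}^2$ denote their squares. Let $\mathbb{C}_{3\pi/2}$ be $\mathbb{C}$ with the ray $\{-it:t\ge0\}$ removed, $\ln$ the branch of the logarithm on it with $\ln1=0$, $z^\rho=e^{\rho\ln z}$, and $\vartheta_\kappa=\pi\kappa/2$. Let $R$ be the unique holomorphic function on $\mathbb{C}\times\mathbb{C}\times\mathbb{C}_{3\pi/2}$ with $R(\kappa^2,\vartheta,z)=\frac1\kappa\left(z^{-\kappa/2}e^{i\pi\kappa/2}\cos(\vartheta-\vartheta_\kappa)-z^{\kappa/2}e^{-i\pi\kappa/2}\cos(\vartheta+\vartheta_\kappa)\right)$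 for $\kappa\in\mathbb{C}\setminus\{0\}$. For $\alpha<1$, $\vartheta\in\mathbb{R}$, the function $z\mapsto R(\alpha,\vartheta,z)$ does not vanish on $\mathbb{C}_+\cup(0,\infty)$, where $\mathbb{C}_+=\{\mathrm{Im}\,z>0\}$; put $\mathscr M_{\alpha,\vartheta}(z)=-\frac{R(\alpha,\vartheta+\pi/2,z)}{2\pi^2\,\mathrm{Sinc}^2(\pi^2\alpha)\,R(\alpha,\vartheta,z)}$ for $z\in\mathbb{C}_+$. One has $\mathrm{Im}\,\mathscr M_{\alpha,\vartheta}>0$ on $\mathbb{C}_+$, so $\pi\mathscr M_{\alpha,\vartheta}$ has a unique representation $a+bz+\int_{\mathbb{R}}\left(\frac1{t-z}-\frac t{t^2+1}\right)d\nu(t)$ on $\mathbb{C}_+$ with $a\in\mathbb{R}$, $b\ge0$ and $\nu$ a positive Radon measure on $\mathbb{R}$ with $\int\frac{d\nu(t)}{t^2+1}<\infty$; $\mathcal V_{\alpha,\vartheta}$ is this $\nu$. For a positive Radon measure $\nu$ on $\mathbb{R}$, $\mathcal P(\nu)=\{E\in\mathbb{R}:\nu(\{E\})>0\}$ and $\nu^c=(1-\chi_{\mathcal P(\nu)})\nu$ is the continuous part of $\nu$ ($\chi_A$ is the characteristic function of $A$). Further, $\Sigma_{\alpha,\vartheta}=\{E<0:R(\alpha,\vartheta,E)=0\}$; $t_{\alpha,\vartheta}(E)=\frac1{2|R(\alpha,\vartheta,E)|^2}$ for $E>0$ and $t_{\alpha,\vartheta}(E)=0$ for $E\le0$. Let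 $\omega$ be the $\pi$-periodic function on $\mathbb{R}$ with $\omega(\vartheta)=(1-2|\vartheta|/\pi)^2$ for $|\vartheta|\le\pi/2$; $Q_0=\{(\alpha,\vartheta)\in\mathbb{R}^2:\omega(\vartheta)\le\alpha<1\}$ and $Q_{\ge1}=\{(\alpha,\vartheta)\in\mathbb{R}^2:\alpha<\omega(\vartheta)\}$. *)

theory Defs
  imports "HOL-Analysis.Analysis"
begin

section \<open>The functions Cos and Sinc\<close>

text \<open>\<open>Cos (x\<^sup>2) = cos x\<close> and \<open>Sinc (x\<^sup>2) = sin x / x\<close>; both are used over the reals and over
  the complex numbers.\<close>

definition Cos :: "'a::{real_normed_field,banach} \<Rightarrow> 'a" where
  "Cos \<zeta> = (\<Sum>k. (- \<zeta>) ^ k / fact (2 * k))"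

definition Sinc :: "'a::{real_normed_field,banach} \<Rightarrow> 'a" where
  "Sinc \<zeta> = (\<Sum>k. (- \<zeta>) ^ k / fact (2 * k + 1))"

lemma summable_exp_type:
  fixes \<zeta> :: "'a::{real_normed_field,banach}"
  assumes "\<And>k. k \<le> m k"
  shows "summable (\<lambda>k. (- \<zeta>) ^ k / fact (m k))"
proof (rule summable_comparison_test'[where N = 0])
  show "summable (\<lambda>k. inverse (fact k) * norm \<zeta> ^ k)"
    by (rule summable_exp)
  show "norm ((- \<zeta>) ^ k / fact (m k)) \<le> inverse (fact k) * norm \<zeta> ^ k" for k
  proof -
    have "(fact k :: real) \<le> fact (m k)"
      by (rule fact_mono) (rule assms)
    then have "inverse (fact (m k) :: real) \<le> inverse (fact k)"
      by (rule le_imp_inverse_le) (rule fact_gt_zero)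
    then have "inverse (fact (m k)) * norm \<zeta> ^ k \<le> inverse (fact k) * norm \<zeta> ^ k"
      by (rule mult_right_mono) simp
    then show ?thesis
      by (simp add: norm_mult norm_inverse norm_power norm_fact divide_inverse mult.commute)
  qed
qed

lemma Cos_sums: "(\<lambda>k. (- \<zeta>) ^ k / fact (2 * k)) sums Cos \<zeta>"
  for \<zeta> :: "'a::{real_normed_field,banach}"
  unfolding Cos_def by (rule summable_sums, rule summable_exp_type) simp

lemma Sinc_sums: "(\<lambda>k. (- \<zeta>) ^ k / fact (2 * k + 1)) sums Sinc \<zeta>"
  for \<zeta> :: "'a::{real_normed_field,banach}"
  unfolding Sinc_def by (rule summable_sums, rule summable_exp_type) simp

lemma Cos_square: "Cos (x\<^sup>2) = cos x" for x :: "'a::{real_normed_field,banach}"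
proof -
  have "(\<lambda>k. \<Sum>n\<in>{k*2..<k*2+2}. cos_coeff n *\<^sub>R x ^ n) sums cos x"
    by (intro sums_group cos_converges) auto
  moreover have "(\<Sum>n\<in>{k*2..<k*2+2}. cos_coeff n *\<^sub>R x ^ n) = (- x\<^sup>2) ^ k / fact (2 * k)" for k
  proof -
    have "{k*2..<k*2+2} = {2*k, Suc (2*k)}" by auto
    then show ?thesis
      by (simp add: cos_coeff_def scaleR_conv_of_real power_minus[of "x\<^sup>2"] power_mult del: mult_Suc_right)
  qed
  ultimately have "(\<lambda>k. (- x\<^sup>2) ^ k / fact (2 * k)) sums cos x" by simp
  then show ?thesis using Cos_sums sums_unique2 by blast
qed

lemma Sinc_square: "x * Sinc (x\<^sup>2) = sin x" for x :: "'a::{real_normed_field,banach}"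
proof -
  have "(\<lambda>k. \<Sum>n\<in>{k*2..<k*2+2}. sin_coeff n *\<^sub>R x ^ n) sums sin x"
    by (intro sums_group sin_converges) auto
  moreover have "(\<Sum>n\<in>{k*2..<k*2+2}. sin_coeff n *\<^sub>R x ^ n)
      = x * ((- x\<^sup>2) ^ k / fact (2 * k + 1))" for k
  proof -
    have "{k*2..<k*2+2} = {2*k, Suc (2*k)}" by auto
    then show ?thesis
      by (simp add: sin_coeff_def scaleR_conv_of_real power_minus[of "x\<^sup>2"] power_mult
          del: mult_Suc_right fact_Suc)
  qed
  ultimately have "(\<lambda>k. x * ((- x\<^sup>2) ^ k / fact (2 * k + 1))) sums sin x" by simp
  then show ?thesis using sums_mult[OF Sinc_sums] sums_unique2 by blast
qed

lemma Cos_holomorphic: "Cos holomorphic_on UNIV"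
  and Sinc_holomorphic: "Sinc holomorphic_on UNIV"
proof -
  have "\<exists>D. (Cos has_field_derivative D) (at \<zeta>)" for \<zeta> :: complex
  proof -
    define c :: "nat \<Rightarrow> complex" where "c k = (-1) ^ k / fact (2 * k)" for k
    have eq: "(- y) ^ k / fact (2 * k) = c k * y ^ k" for y k
      unfolding c_def by (subst power_minus) simp
    have "Cos = (\<lambda>y. \<Sum>k. c k * y ^ k)"
      unfolding Cos_def[abs_def] eq ..
    moreover have "summable (\<lambda>k. c k * y ^ k)" for y
      using sums_summable[OF Cos_sums[of y]] unfolding eq .
    ultimately show ?thesis
      using termdiffs_strong_converges_everywhere[of c \<zeta>] by auto
  qed
  then show "Cos holomorphic_on UNIV"
    by (auto simp: holomorphic_on_def field_differentiable_def)
  have "\<exists>D. (Sinc has_field_derivative D) (at \<zeta>)" for \<zeta> :: complex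
  proof -
    define c :: "nat \<Rightarrow> complex" where "c k = (-1) ^ k / fact (2 * k + 1)" for k
    have eq: "(- y) ^ k / fact (2 * k + 1) = c k * y ^ k" for y k
      unfolding c_def by (subst power_minus) simp
    have "Sinc = (\<lambda>y. \<Sum>k. c k * y ^ k)"
      unfolding Sinc_def[abs_def] eq ..
    moreover have "summable (\<lambda>k. c k * y ^ k)" for y
      using sums_summable[OF Sinc_sums[of y]] unfolding eq .
    ultimately show ?thesis
      using termdiffs_strong_converges_everywhere[of c \<zeta>] by auto
  qed
  then show "Sinc holomorphic_on UNIV"
    by (auto simp: holomorphic_on_def field_differentiable_def)
qed


section \<open>The logarithm on the plane cut along the negative imaginary axis\<close>

definition slit_plane :: "complex set" where
  "slit_plane = UNIV - {- \<i> * complex_of_real t | t. t \<ge> 0}"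

text \<open>\<open>Ln\<close> is cut along the nonpositive real axis, so \<open>z \<mapsto> Ln (- \<i> z)\<close> is cut along the nonpositive
  imaginary axis. \<open>slit_ln_holomorphic\<close>, \<open>exp_slit_ln\<close> and \<open>slit_ln_1\<close> below characterize
  the branch.\<close>

definition slit_ln :: "complex \<Rightarrow> complex" where
  "slit_ln z = Ln (- \<i> * z) + \<i> * complex_of_real (pi / 2)"

definition slit_powr :: "complex \<Rightarrow> complex \<Rightarrow> complex" where
  "slit_powr z \<rho> = exp (\<rho> * slit_ln z)"

lemma slit_plane_iff: "z \<in> slit_plane \<longleftrightarrow> - \<i> * z \<notin> \<real>\<^sub>\<le>\<^sub>0"
proof -
  have "z \<notin> slit_plane \<longleftrightarrow> Re z = 0 \<and> Im z \<le> 0"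
  proof
    assume "Re z = 0 \<and> Im z \<le> 0"
    then have "z = - \<i> * complex_of_real (- Im z)" "- Im z \<ge> 0"
      by (auto simp: complex_eq_iff)
    then show "z \<notin> slit_plane" unfolding slit_plane_def by blast
  qed (auto simp: slit_plane_def)
  then show ?thesis by (auto simp: complex_nonpos_Reals_iff)
qed

lemma open_slit_plane: "open slit_plane"
proof -
  have "open ((\<lambda>z. - \<i> * z) -` (- \<real>\<^sub>\<le>\<^sub>0))"
    by (rule open_vimage) (simp_all add: open_Compl closed_nonpos_Reals_complex continuous_intros)
  moreover have "(\<lambda>z. - \<i> * z) -` (- \<real>\<^sub>\<le>\<^sub>0) = slit_plane"
    by (simp add: set_eq_iff slit_plane_iff)
  ultimately show ?thesis by simp
qed

lemma slit_ln_holomorphic: "slit_ln holomorphic_on slit_plane"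
  unfolding slit_ln_def[abs_def]
  by (intro holomorphic_intros) (auto simp: slit_plane_iff)

lemma exp_slit_ln: "z \<in> slit_plane \<Longrightarrow> exp (slit_ln z) = z"
proof -
  assume "z \<in> slit_plane"
  then have "z \<noteq> 0" by (auto simp: slit_plane_iff)
  moreover have "exp (\<i> * complex_of_real (pi / 2)) = \<i>"
    by (simp add: exp_eq_polar complex_eq_iff)
  ultimately show ?thesis unfolding slit_ln_def exp_add by (simp add: mult.commute flip: mult.assoc)
qed

lemma slit_ln_1: "slit_ln 1 = 0"
  by (simp add: slit_ln_def complex_eq_iff)


section \<open>The function R\<close>

text \<open>Complex differentiability of a function of three complex variables: the (real) Frechet
  derivative at every point is complex-linear.\<close>

definition holomorphic3_on ::
  "(complex \<times> complex \<times> complex \<Rightarrow> complex) \<Rightarrow> (complex \<times> complex \<times> complex) set \<Rightarrow> bool" where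
  "holomorphic3_on F S \<longleftrightarrow> open S \<and>
     (\<forall>p\<in>S. \<exists>a b c. (F has_derivative (\<lambda>(u, v, w). a * u + b * v + c * w)) (at p))"

text \<open>The value 0 outside the domain only serves to make a total function unique.\<close>

definition is_R :: "(complex \<times> complex \<times> complex \<Rightarrow> complex) \<Rightarrow> bool" where
  "is_R F \<longleftrightarrow>
     holomorphic3_on F (UNIV \<times> UNIV \<times> slit_plane) \<and>
     (\<forall>\<kappa> \<theta> z. \<kappa> \<noteq> 0 \<and> z \<in> slit_plane \<longrightarrow>
        F (\<kappa>\<^sup>2, \<theta>, z) = 1 / \<kappa> *
          (slit_powr z (- \<kappa> / 2) * exp (\<i> * complex_of_real pi * \<kappa> / 2)
              * cos (\<theta> - complex_of_real pi * \<kappa> / 2)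
           - slit_powr z (\<kappa> / 2) * exp (- \<i> * complex_of_real pi * \<kappa> / 2)
              * cos (\<theta> + complex_of_real pi * \<kappa> / 2))) \<and>
     (\<forall>\<zeta> \<theta> z. z \<notin> slit_plane \<longrightarrow> F (\<zeta>, \<theta>, z) = 0)"

definition R :: "complex \<Rightarrow> complex \<Rightarrow> complex \<Rightarrow> complex" where
  "R \<zeta> \<theta> z = (THE F. is_R F) (\<zeta>, \<theta>, z)"

lemma is_R_unique:
  assumes F: "is_R F" and G: "is_R G"
  shows "F = G"
proof
  fix p :: "complex \<times> complex \<times> complex"
  obtain \<zeta> \<theta> z where p: "p = (\<zeta>, \<theta>, z)" by (cases p) auto
  have off: "F (\<zeta>, \<theta>, z) = G (\<zeta>, \<theta>, z)" if "\<zeta> \<noteq> 0" for \<zeta>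
  proof (cases "z \<in> slit_plane")
    case True
    have "\<zeta> = (csqrt \<zeta>)\<^sup>2" "csqrt \<zeta> \<noteq> 0" using that by auto
    then show ?thesis using F G True unfolding is_R_def by metis
  next
    case False
    then show ?thesis using F G unfolding is_R_def by auto
  qed
  have "F (0, \<theta>, z) = G (0, \<theta>, z)"
  proof (cases "z \<in> slit_plane")
    case True
    have lim: "((\<lambda>\<zeta>. H (\<zeta>, \<theta>, z)) \<longlongrightarrow> H (0, \<theta>, z)) (at 0)" if "is_R H" for H
    proof -
      have "isCont H (0, \<theta>, z)"
        using that True has_derivative_continuous unfolding is_R_def holomorphic3_on_def by blast
      moreover have "((\<lambda>\<zeta>. (\<zeta>, \<theta>, z)) \<longlongrightarrow> (0, \<theta>, z)) (at 0)"
        by (intro tendsto_intros)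
      ultimately show ?thesis using isCont_tendsto_compose by blast
    qed
    have "((\<lambda>\<zeta>. F (\<zeta>, \<theta>, z)) \<longlongrightarrow> G (0, \<theta>, z)) (at 0)"
      using lim[OF G] by (rule Lim_transform_eventually) (auto simp: eventually_at_filter off)
    then show ?thesis using lim[OF F] tendsto_unique by (metis at_neq_bot)
  next
    case False
    then show ?thesis using F G unfolding is_R_def by auto
  qed
  then show "F p = G p" using off p by (cases "\<zeta> = 0") auto
qed

definition cdiff3 :: "(complex \<times> complex \<times> complex \<Rightarrow> complex) \<Rightarrow> complex \<times> complex \<times> complex \<Rightarrow> bool" where
  "cdiff3 F p \<longleftrightarrow> (\<exists>a b c. (F has_derivative (\<lambda>(u, v, w). a * u + b * v + c * w)) (at p))"

lemma cdiff3_const: "cdiff3 (\<lambda>_. k) p"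
  unfolding cdiff3_def
  by (rule exI[of _ 0])+ (auto simp: case_prod_unfold intro!: derivative_eq_intros)

lemma cdiff3_proj:
  "cdiff3 (\<lambda>q. fst q) p" "cdiff3 (\<lambda>q. fst (snd q)) p" "cdiff3 (\<lambda>q. snd (snd q)) p"
  unfolding cdiff3_def
  subgoal by (rule exI[of _ 1], rule exI[of _ 0], rule exI[of _ 0])
      (auto simp: case_prod_unfold intro!: derivative_eq_intros)
  subgoal by (rule exI[of _ 0], rule exI[of _ 1], rule exI[of _ 0])
      (auto simp: case_prod_unfold intro!: derivative_eq_intros)
  subgoal by (rule exI[of _ 0], rule exI[of _ 0], rule exI[of _ 1])
      (auto simp: case_prod_unfold intro!: derivative_eq_intros)
  done

lemma cdiff3_add: "cdiff3 F p \<Longrightarrow> cdiff3 G p \<Longrightarrow> cdiff3 (\<lambda>q. F q + G q) p"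
proof -
  assume "cdiff3 F p" "cdiff3 G p"
  then obtain a b c a' b' c' where
    "(F has_derivative (\<lambda>(u, v, w). a * u + b * v + c * w)) (at p)"
    "(G has_derivative (\<lambda>(u, v, w). a' * u + b' * v + c' * w)) (at p)"
    unfolding cdiff3_def by blast
  from has_derivative_add[OF this] show ?thesis
    unfolding cdiff3_def
    by (intro exI[of _ "a + a'"] exI[of _ "b + b'"] exI[of _ "c + c'"])
      (simp add: case_prod_unfold algebra_simps)
qed

lemma cdiff3_mult: "cdiff3 F p \<Longrightarrow> cdiff3 G p \<Longrightarrow> cdiff3 (\<lambda>q. F q * G q) p"
proof -
  assume "cdiff3 F p" "cdiff3 G p"
  then obtain a b c a' b' c' where
    "(F has_derivative (\<lambda>(u, v, w). a * u + b * v + c * w)) (at p)"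
    "(G has_derivative (\<lambda>(u, v, w). a' * u + b' * v + c' * w)) (at p)"
    unfolding cdiff3_def by blast
  from has_derivative_mult[OF this] show ?thesis
    unfolding cdiff3_def
    by (intro exI[of _ "F p * a' + a * G p"] exI[of _ "F p * b' + b * G p"]
        exI[of _ "F p * c' + c * G p"])
      (simp add: case_prod_unfold algebra_simps)
qed

lemma cdiff3_compose:
  assumes "f field_differentiable at (F p)" "cdiff3 F p"
  shows "cdiff3 (\<lambda>q. f (F q)) p"
proof -
  obtain D where "(f has_derivative (*) D) (at (F p))"
    using assms(1) unfolding field_differentiable_def has_field_derivative_def by blast
  moreover obtain a b c where "(F has_derivative (\<lambda>(u, v, w). a * u + b * v + c * w)) (at p)"
    using assms(2) unfolding cdiff3_def by blast
  ultimately have "((\<lambda>q. f (F q)) has_derivative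
      (\<lambda>x. D * (case x of (u, v, w) \<Rightarrow> a * u + b * v + c * w))) (at p)"
    using has_derivative_compose by blast
  then show ?thesis
    unfolding cdiff3_def
    by (intro exI[of _ "D * a"] exI[of _ "D * b"] exI[of _ "D * c"])
      (simp add: case_prod_unfold algebra_simps)
qed

lemma is_R_exists: "\<exists>F. is_R F"
proof -
  define \<pi> where "\<pi> = complex_of_real pi"
  define W where "W z = (\<i> * \<pi> + (-1) * slit_ln z) * (1/2)" for z
  define G where "G p = 2 * (W (snd (snd p)) * Sinc ((-1) * (fst p * (W (snd (snd p)) * W (snd (snd p)))))
        * cos (fst (snd p)) * Cos (\<pi> * \<pi> / 4 * fst p)
      + \<pi> / 2 * Cos ((-1) * (fst p * (W (snd (snd p)) * W (snd (snd p)))))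
        * sin (fst (snd p)) * Sinc (\<pi> * \<pi> / 4 * fst p))" for p
  define F where "F p = (if snd (snd p) \<in> slit_plane then G p else 0)" for p
  have opn: "open (UNIV \<times> UNIV \<times> slit_plane)"
    by (intro open_Times open_slit_plane open_UNIV)
  have ent: "f holomorphic_on UNIV \<Longrightarrow> f field_differentiable at w" for f and w :: complex
    by (simp add: holomorphic_on_def)
  have sc: "sin field_differentiable at w" "cos field_differentiable at w" for w :: complex
    by (simp_all add: field_differentiable_at_sin field_differentiable_at_cos)
  have "cdiff3 F p" if p: "p \<in> UNIV \<times> UNIV \<times> slit_plane" for p
  proof -
    have "slit_ln field_differentiable at (snd (snd p))"
      using slit_ln_holomorphic open_slit_plane p
      by (auto simp: holomorphic_on_open field_differentiable_def)
    then have W: "cdiff3 (\<lambda>q. W (snd (snd q))) p"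
      unfolding W_def
      by (intro cdiff3_mult cdiff3_add cdiff3_const cdiff3_compose[where f = slit_ln] cdiff3_proj)
    have "cdiff3 G p"
      unfolding G_def[abs_def]
      by (intro cdiff3_mult cdiff3_add cdiff3_const cdiff3_proj W cdiff3_compose[where f = Cos]
          cdiff3_compose[where f = Sinc] cdiff3_compose[where f = sin]
          cdiff3_compose[where f = cos] ent Cos_holomorphic Sinc_holomorphic sc)
    moreover have "\<And>q. q \<in> UNIV \<times> UNIV \<times> slit_plane \<Longrightarrow> G q = F q"
      by (auto simp: F_def)
    ultimately show ?thesis
      unfolding cdiff3_def using has_derivative_transform_within_open[OF _ opn p] by metis
  qed
  then have hol: "holomorphic3_on F (UNIV \<times> UNIV \<times> slit_plane)"
    using opn unfolding holomorphic3_on_def cdiff3_def by blast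
  have val: "F (\<kappa>\<^sup>2, \<theta>, z) = 1 / \<kappa> *
          (slit_powr z (- \<kappa> / 2) * exp (\<i> * complex_of_real pi * \<kappa> / 2)
              * cos (\<theta> - complex_of_real pi * \<kappa> / 2)
           - slit_powr z (\<kappa> / 2) * exp (- \<i> * complex_of_real pi * \<kappa> / 2)
              * cos (\<theta> + complex_of_real pi * \<kappa> / 2))"
    if k: "\<kappa> \<noteq> 0" and z: "z \<in> slit_plane" for \<kappa> \<theta> z
  proof -
    define x where "x = \<kappa> * W z"
    define y where "y = \<pi> * \<kappa> / 2"
    have a1: "(-1) * (\<kappa>\<^sup>2 * (W z * W z)) = (\<i> * x)\<^sup>2"
      by (simp add: x_def power_mult_distrib power2_eq_square[of "W z"])
    have a2: "\<pi> * \<pi> / 4 * \<kappa>\<^sup>2 = y\<^sup>2"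
      by (simp add: y_def power2_eq_square)
    have "\<kappa> * F (\<kappa>\<^sup>2, \<theta>, z) =
        2 * ((x * Sinc ((\<i> * x)\<^sup>2)) * cos \<theta> * Cos (y\<^sup>2) + Cos ((\<i> * x)\<^sup>2) * sin \<theta> * (y * Sinc (y\<^sup>2)))"
      using z unfolding F_def G_def snd_conv fst_conv a1 a2 by (simp add: x_def y_def algebra_simps)
    also have "x * Sinc ((\<i> * x)\<^sup>2) = - \<i> * sin (\<i> * x)"
      by (subst Sinc_square[symmetric]) (simp flip: mult.assoc)
    finally have "\<kappa> * F (\<kappa>\<^sup>2, \<theta>, z) =
        2 * (- \<i> * sin (\<i> * x) * cos \<theta> * cos y + cos (\<i> * x) * sin \<theta> * sin y)"
      by (simp add: Cos_square Sinc_square)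
    also have "\<dots> = exp x * cos (\<theta> - y) - exp (- x) * cos (\<theta> + y)"
      by (simp add: sin_exp_eq cos_exp_eq[of "\<i> * x"] cos_add cos_diff field_simps)
    also have "exp x = slit_powr z (- \<kappa> / 2) * exp (\<i> * complex_of_real pi * \<kappa> / 2)"
      unfolding slit_powr_def exp_add[symmetric]
      by (rule arg_cong[where f = exp]) (simp add: x_def W_def \<pi>_def field_simps)
    also have "exp (- x) = slit_powr z (\<kappa> / 2) * exp (- \<i> * complex_of_real pi * \<kappa> / 2)"
      unfolding slit_powr_def exp_add[symmetric]
      by (rule arg_cong[where f = exp]) (simp add: x_def W_def \<pi>_def field_simps)
    finally show ?thesis using k by (simp add: y_def \<pi>_def field_simps)
  qed
  have "is_R F"
    unfolding is_R_def
  proof (intro conjI allI impI)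
    show "F (\<zeta>, \<theta>, z) = 0" if "z \<notin> slit_plane" for \<zeta> \<theta> z
      using that by (simp add: F_def)
  qed (rule hol, rule val, simp_all)
  then show ?thesis by (rule exI[of is_R])
qed

lemma ex1_is_R: "\<exists>!F. is_R F"
  using is_R_exists is_R_unique by blast


section \<open>The measures\<close>

definition M :: "real \<Rightarrow> real \<Rightarrow> complex \<Rightarrow> complex" where
  "M \<alpha> \<theta> z =
     - R (of_real \<alpha>) (of_real (\<theta> + pi / 2)) z
       / (2 * of_real pi ^ 2 * (Sinc (of_real (pi\<^sup>2 * \<alpha>)))\<^sup>2 * R (of_real \<alpha>) (of_real \<theta>) z)"

text \<open>On the real line, the positive Radon measures are the Borel measures that are finite on
  compact sets.\<close>

definition radon_measure :: "real measure \<Rightarrow> bool" where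
  "radon_measure \<nu> \<longleftrightarrow> sets \<nu> = sets borel \<and> (\<forall>K. compact K \<longrightarrow> emeasure \<nu> K < \<infinity>)"

definition herglotz_measure :: "(complex \<Rightarrow> complex) \<Rightarrow> real measure \<Rightarrow> bool" where
  "herglotz_measure f \<nu> \<longleftrightarrow>
     radon_measure \<nu> \<and> integrable \<nu> (\<lambda>t. 1 / (t\<^sup>2 + 1)) \<and>
     (\<exists>(a::real) (b::real). b \<ge> 0 \<and>
        (\<forall>z. Im z > 0 \<longrightarrow>
           f z = of_real a + of_real b * z
             + (\<integral>t. 1 / (of_real t - z) - of_real (t / (t\<^sup>2 + 1)) \<partial>\<nu>)))"

definition V :: "real \<Rightarrow> real \<Rightarrow> real measure" where
  "V \<alpha> \<theta> = (THE \<nu>. herglotz_measure (\<lambda>z. of_real pi * M \<alpha> \<theta> z) \<nu>)"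

definition atoms :: "real measure \<Rightarrow> real set" where
  "atoms \<nu> = {E. emeasure \<nu> {E} > 0}"

definition continuous_part :: "real measure \<Rightarrow> real measure" where
  "continuous_part \<nu> = density \<nu> (\<lambda>E. 1 - indicator (atoms \<nu>) E)"

definition \<Sigma> :: "real \<Rightarrow> real \<Rightarrow> real set" where
  "\<Sigma> \<alpha> \<theta> = {E. E < 0 \<and> R (of_real \<alpha>) (of_real \<theta>) (of_real E) = 0}"

definition t_density :: "real \<Rightarrow> real \<Rightarrow> real \<Rightarrow> real" where
  "t_density \<alpha> \<theta> E =
     (if E > 0 then 1 / (2 * (norm (R (of_real \<alpha>) (of_real \<theta>) (of_real E)))\<^sup>2) else 0)"


section \<open>The parameter regions\<close>

definition is_omega :: "(real \<Rightarrow> real) \<Rightarrow> bool" where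
  "is_omega w \<longleftrightarrow> (\<forall>\<theta>. w (\<theta> + pi) = w \<theta>) \<and>
     (\<forall>\<theta>. \<bar>\<theta>\<bar> \<le> pi / 2 \<longrightarrow> w \<theta> = (1 - 2 * \<bar>\<theta>\<bar> / pi)\<^sup>2)"

definition \<omega> :: "real \<Rightarrow> real" where
  "\<omega> = (THE w. is_omega w)"

lemma ex1_is_omega: "\<exists>!w. is_omega w"
proof -
  define N where "N x = of_int \<lfloor>x / pi + 1 / 2\<rfloor> * pi" for x :: real
  define w where "w x = (1 - 2 * \<bar>x - N x\<bar> / pi)\<^sup>2" for x
  have per: "v (x + of_int n * pi) = v x" if "is_omega v" for v x n
  proof (induction n rule: int_induct[where k = 0])
    case (step1 i)
    then show ?case using that unfolding is_omega_def by (simp add: algebra_simps) (metis add.commute add.left_commute)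
  next
    case (step2 i)
    have "v (x + of_int (i - 1) * pi + pi) = v (x + of_int (i - 1) * pi)"
      using that unfolding is_omega_def by blast
    with step2 show ?case by (simp add: algebra_simps)
  qed simp
  have bd: "\<bar>x - N x\<bar> \<le> pi / 2" for x
  proof -
    define n where "n = real_of_int \<lfloor>x / pi + 1 / 2\<rfloor>"
    have "n \<le> x / pi + 1 / 2" "x / pi + 1 / 2 < n + 1"
      unfolding n_def by linarith+
    then have "n * pi \<le> x + pi / 2" "x + pi / 2 < n * pi + pi"
      by (simp_all add: field_simps)
    then have "N x \<le> x + pi / 2" "x + pi / 2 < N x + pi"
      by (simp_all add: N_def n_def)
    then show ?thesis by linarith
  qed
  have "v = w" if "is_omega v" for v
  proof
    fix x
    have "v x = v (x - N x)"
      using per[OF that, of "x - N x" "\<lfloor>x / pi + 1 / 2\<rfloor>"] by (simp add: N_def)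
    also have "\<dots> = w x"
      using that bd unfolding is_omega_def w_def by blast
    finally show "v x = w x" .
  qed
  moreover have "is_omega w"
    unfolding is_omega_def
  proof (intro conjI allI impI)
    fix x
    have "N (x + pi) = N x + pi"
    proof -
      have "(x + pi) / pi + 1 / 2 = (x / pi + 1 / 2) + of_int 1"
        by (simp add: add_divide_distrib)
      then show ?thesis
        unfolding N_def by (simp only: floor_add_int[symmetric]) (simp add: algebra_simps)
    qed
    then show "w (x + pi) = w x" by (simp add: w_def)
  next
    fix x :: real
    assume x: "\<bar>x\<bar> \<le> pi / 2"
    show "w x = (1 - 2 * \<bar>x\<bar> / pi)\<^sup>2"
    proof (cases "x = pi / 2")
      case True
      show ?thesis unfolding w_def N_def True by simp
    next
      case False
      then have "\<lfloor>x / pi + 1 / 2\<rfloor> = 0"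
        using x by (auto simp: floor_eq_iff field_simps abs_le_iff)
      then show ?thesis by (simp add: w_def N_def)
    qed
  qed
  ultimately show ?thesis by blast
qed

definition Q0 :: "(real \<times> real) set" where
  "Q0 = {(\<alpha>, \<theta>). \<omega> \<theta> \<le> \<alpha> \<and> \<alpha> < 1}"

definition Q_ge1 :: "(real \<times> real) set" where
  "Q_ge1 = {(\<alpha>, \<theta>). \<alpha> < \<omega> \<theta>}"

end

theory Submission
  imports Defs "HOL-Complex_Analysis.Complex_Analysis"
begin

text \<open>
  Write \<open>Ch a w = cosh (\<surd>a w)\<close> and \<open>Sh a w = sinh (\<surd>a w) / \<surd>a\<close>, and substitute \<open>z = - exp (- 2 w)\<close>. The upper
  half-plane becomes the strip \<open>0 < Im w < pi / 2\<close>, \<open>R\<close> becomes \<open>2 D w\<close> for a solution \<open>D\<close> of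
  \<open>D'' = \<alpha> D\<close>, the Weyl function becomes \<open>m = - N / (8 c\<^sup>2 s\<^sup>2 D)\<close> for a second solution \<open>N\<close>, and
  the Wronskian \<open>N D' - D N' = s c\<close> together with \<open>D'\<^sup>2 - \<alpha> D\<^sup>2 = q = c\<^sup>2 - sin\<^sup>2 \<theta>\<close> makes
  everything explicit: \<open>Im m\<close> on the upper edge, the absence of nonreal zeros of \<open>D\<close> in the closed
  strip, the condition \<open>q > 0\<close> for the existence of real zeros, and the residues there.

  The measure is identified by integrating \<open>m\<close> against \<open>1 / (z - z\<^sub>0) - 1 / (z - z\<^sub>1)\<close> around the
  rectangles \<open>[Y, X] \<times> [- pi / 2, pi / 2]\<close>: the horizontal edges give the absolutely continuous part and
  the residues give the atoms. With \<open>z\<^sub>0 = \<i>\<close> and \<open>z\<^sub>1 = - \<i>\<close> the kernel is \<open>2 \<i> / (t\<^sup>2 + 1)\<close>, so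
  integrability of \<open>1 / (t\<^sup>2 + 1)\<close> comes for free by Fatou's lemma. Uniqueness is Stieltjes inversion.
\<close>


section \<open>The functions Ch and Sh\<close>

text \<open>The obstacle is the pair of vertical edges. For \<alpha> < 0 the function
  \<open>D\<close> oscillates on the real axis, so its zeros run to both ends, the atoms accumulate
  at 0 and at minus infinity, and an arbitrarily chosen edge may pass through a pole of
  \<open>m\<close>. Under z = - exp (- 2 w) the difference of two Cauchy kernels, times dz/dw, has
  size exp (- 2 |x|) at both ends. It is therefore enough to find arbitrarily distant abscissae with
  |D x| \<ge> exp (- \<kappa> |x|) for some \<kappa> < 1 with \<alpha> < \<kappa>^2: there N / D is
  of order exp (2 \<kappa> |x|) at most, and the edges disappear in the limit. Such a \<kappa>
  exists exactly because \<alpha> < 1. A single Cauchy kernel would not decay at infinity after the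
  factor dz/dw; the additive constant that is lost by taking differences is recovered from the
  symmetry of \<open>m\<close> under conjugation. The explicit measure is thus shown to represent
  \<open>M\<close>, and it is \<open>V\<close> by uniqueness.\<close>

lemma Cos_of_real: "Cos (of_real x) = (of_real (Cos x) :: 'a::{real_normed_field,banach})"
proof -
  have "(\<lambda>k. of_real ((- x) ^ k / fact (2 * k)) :: 'a) sums of_real (Cos x)"
    by (rule sums_of_real[OF Cos_sums])
  then have "(\<lambda>k. (- of_real x) ^ k / fact (2 * k) :: 'a) sums of_real (Cos x)"
    by simp
  then show ?thesis
    using Cos_sums sums_unique2 by blast
qed

lemma Sinc_of_real: "Sinc (of_real x) = (of_real (Sinc x) :: 'a::{real_normed_field,banach})"
proof -
  have "(\<lambda>k. of_real ((- x) ^ k / fact (2 * k + 1)) :: 'a) sums of_real (Sinc x)"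
    by (rule sums_of_real[OF Sinc_sums])
  then have "(\<lambda>k. (- of_real x) ^ k / fact (2 * k + 1) :: 'a) sums of_real (Sinc x)"
    by (simp del: fact_Suc)
  then show ?thesis
    using Sinc_sums sums_unique2 by blast
qed

lemma Cos_0 [simp]: "Cos 0 = (1::'a::{real_normed_field,banach})"
  using Cos_square[of "0::'a"] by simp

lemma Sinc_0 [simp]: "Sinc 0 = (1::'a::{real_normed_field,banach})"
proof -
  have "(\<lambda>k. (if k = 0 then 1 else 0) :: 'a) sums 1"
    using sums_single[of 0 "\<lambda>_. 1::'a"] by simp
  moreover have "(\<lambda>k. (- 0) ^ k / fact (2 * k + 1) :: 'a) = (\<lambda>k. if k = 0 then 1 else 0)"
    by auto
  ultimately show ?thesis
    using Sinc_sums[of "0::'a"] sums_unique2 by metis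
qed

lemma Cos_nonpos_pos: "x \<le> 0 \<Longrightarrow> Cos x > (0::real)"
  unfolding Cos_def
  by (rule suminf_pos2[where i = 0]) (auto intro: summable_exp_type)

lemma Sinc_nonpos_pos: "x \<le> 0 \<Longrightarrow> Sinc x > (0::real)"
  unfolding Sinc_def
  by (rule suminf_pos2[where i = 0]) (auto intro: summable_exp_type simp del: fact_Suc)

lemma Cos_pos:
  assumes "x < (pi / 2)\<^sup>2"
  shows "Cos x > 0"
proof (cases "x \<le> 0")
  case False
  then have "sqrt x < pi / 2"
    by (intro real_less_lsqrt) (use assms in auto)
  with False have "cos (sqrt x) > 0"
    by (intro cos_gt_zero) auto
  with False show ?thesis
    using Cos_square[of "sqrt x"] by simp
qed (rule Cos_nonpos_pos)

lemma Sinc_pos: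
  assumes "x < pi\<^sup>2"
  shows "Sinc x > 0"
proof (cases "x \<le> 0")
  case False
  then have "sqrt x < pi"
    by (intro real_less_lsqrt) (use assms in auto)
  with False have "sqrt x * Sinc x > 0"
    using Sinc_square[of "sqrt x"] sin_gt_zero[of "sqrt x"] by simp
  with False show ?thesis
    by (simp add: zero_less_mult_iff)
qed (rule Sinc_nonpos_pos)

text \<open>Passing through \<open>Cos\<close> and \<open>Sinc\<close> makes both functions entire
  in \<open>a\<close> as well, without the choice of a square root, so that one set of formulas
  covers \<alpha> < 0, \<alpha> = 0 and \<alpha> > 0. In \<open>w\<close> they solve f'' = a f with
  initial data (1, 0) and (0, 1).\<close>

definition Ch :: "'a::{real_normed_field,banach} \<Rightarrow> 'a \<Rightarrow> 'a" where
  "Ch a w = Cos (- (a * w\<^sup>2))"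

definition Sh :: "'a::{real_normed_field,banach} \<Rightarrow> 'a \<Rightarrow> 'a" where
  "Sh a w = w * Sinc (- (a * w\<^sup>2))"

lemma Ch_of_real: "Ch (of_real a) (of_real x) = (of_real (Ch a x) :: 'a::{real_normed_field,banach})"
  unfolding Ch_def by (simp flip: Cos_of_real)

lemma Sh_of_real: "Sh (of_real a) (of_real x) = (of_real (Sh a x) :: 'a::{real_normed_field,banach})"
  unfolding Sh_def by (simp flip: Sinc_of_real)

lemma Ch_imaginary: "Ch (of_real a) (\<i> * of_real y) = of_real (Ch (- a) y)"
  unfolding Ch_def by (simp add: power_mult_distrib flip: Cos_of_real)

lemma Sh_imaginary: "Sh (of_real a) (\<i> * of_real y) = \<i> * of_real (Sh (- a) y)"
  unfolding Sh_def by (simp add: power_mult_distrib flip: Sinc_of_real)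

lemma Ch_0_left [simp]: "Ch 0 w = 1" and Sh_0_left [simp]: "Sh 0 w = w"
  and Ch_0_right [simp]: "Ch a 0 = 1" and Sh_0_right [simp]: "Sh a 0 = 0"
  by (simp_all add: Ch_def Sh_def)

lemma Ch_minus [simp]: "Ch a (- w) = Ch a w" and Sh_minus [simp]: "Sh a (- w) = - Sh a w"
  by (simp_all add: Ch_def Sh_def)

lemma Ch_power2: "Ch (k\<^sup>2) w = cosh (k * w)" for k w :: complex
proof -
  have "Ch (k\<^sup>2) w = Cos ((\<i> * (k * w))\<^sup>2)"
    by (simp add: Ch_def power_mult_distrib)
  then show ?thesis
    unfolding Cos_square by (simp add: cosh_conv_cos)
qed

lemma Sh_power2: "k * Sh (k\<^sup>2) w = sinh (k * w)" for k w :: complex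
proof -
  have "\<i> * (k * Sh (k\<^sup>2) w) = (\<i> * (k * w)) * Sinc ((\<i> * (k * w))\<^sup>2)"
    by (simp add: Sh_def power_mult_distrib)
  also have "\<dots> = sin (\<i> * (k * w))"
    by (rule Sinc_square)
  finally have "sin (\<i> * (k * w)) = \<i> * (k * Sh (k\<^sup>2) w)" ..
  then show ?thesis
    unfolding sinh_conv_sin by (simp flip: mult.assoc)
qed

text \<open>Every complex \<open>a\<close> is a square k^2, so these are the addition theorems of
  cosh and sinh. The one for \<open>Sh\<close> is obtained after cancelling a factor k, which makes
  k = 0 a separate case.\<close>

lemma
  fixes a u v :: complex
  shows Ch_add: "Ch a (u + v) = Ch a u * Ch a v + a * Sh a u * Sh a v"
    and Sh_add: "Sh a (u + v) = Sh a u * Ch a v + Ch a u * Sh a v"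
proof -
  define k where "k = csqrt a"
  have a: "a = k\<^sup>2"
    by (simp add: k_def)
  show "Ch a (u + v) = Ch a u * Ch a v + a * Sh a u * Sh a v"
    using cosh_add[of "k * u" "k * v"]
    by (simp add: a Ch_power2 ring_distribs flip: Sh_power2) (simp add: power2_eq_square)
  show "Sh a (u + v) = Sh a u * Ch a v + Ch a u * Sh a v"
  proof (cases "k = 0")
    case False
    have "k * Sh a (u + v) = sinh (k * u + k * v)"
      by (simp add: a Sh_power2 distrib_left)
    also have "\<dots> = k * (Sh a u * Ch a v + Ch a u * Sh a v)"
      unfolding sinh_add by (simp add: a Ch_power2 distrib_left mult.left_commute flip: Sh_power2)
    finally have "k * Sh a (u + v) = k * (Sh a u * Ch a v + Ch a u * Sh a v)" .
    with False show ?thesis by simp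
  qed (simp add: a)
qed

lemma
  fixes a w :: complex
  shows DERIV_Ch: "(Ch a has_field_derivative a * Sh a w) (at w)"
    and DERIV_Sh: "(Sh a has_field_derivative Ch a w) (at w)"
proof -
  define k where "k = csqrt a"
  have a: "a = k\<^sup>2"
    by (simp add: k_def)
  have "((\<lambda>w. cosh (k * w)) has_field_derivative k * sinh (k * w)) (at w)"
    by (auto intro!: derivative_eq_intros)
  moreover have "(\<lambda>w. cosh (k * w)) = Ch a"
    by (simp add: a Ch_power2 fun_eq_iff)
  ultimately show "(Ch a has_field_derivative a * Sh a w) (at w)"
    by (simp add: a power2_eq_square mult.assoc flip: Sh_power2)
  show "(Sh a has_field_derivative Ch a w) (at w)"
  proof (cases "k = 0")
    case True
    then have "Sh a = (\<lambda>w. w)" by (simp add: a fun_eq_iff)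
    with True show ?thesis by (simp add: a)
  next
    case False
    have "((\<lambda>w. sinh (k * w) / k) has_field_derivative cosh (k * w)) (at w)"
      using False by (auto intro!: derivative_eq_intros)
    moreover have "(\<lambda>w. sinh (k * w) / k) = Sh a"
      using False by (simp add: a fun_eq_iff flip: Sh_power2)
    ultimately show ?thesis
      by (simp add: a Ch_power2)
  qed
qed

text \<open>A negative \<open>a\<close> has no real square root, so the real identities are pulled
  back from the complex ones along \<open>of_real\<close>.\<close>

lemma
  fixes a u v :: real
  shows Ch_add_real: "Ch a (u + v) = Ch a u * Ch a v + a * Sh a u * Sh a v"
    and Sh_add_real: "Sh a (u + v) = Sh a u * Ch a v + Ch a u * Sh a v"
proof -
  have "complex_of_real (Ch a (u + v)) = of_real (Ch a u * Ch a v + a * Sh a u * Sh a v)"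
    unfolding of_real_add of_real_mult
    by (simp only: Ch_add flip: Ch_of_real Sh_of_real of_real_add)
      (simp only: of_real_add Ch_add)
  then show "Ch a (u + v) = Ch a u * Ch a v + a * Sh a u * Sh a v"
    by (simp only: of_real_eq_iff)
  have "complex_of_real (Sh a (u + v)) = of_real (Sh a u * Ch a v + Ch a u * Sh a v)"
    unfolding of_real_add of_real_mult
    by (simp only: Sh_add flip: Ch_of_real Sh_of_real of_real_add)
      (simp only: of_real_add Sh_add)
  then show "Sh a (u + v) = Sh a u * Ch a v + Ch a u * Sh a v"
    by (simp only: of_real_eq_iff)
qed

section \<open>Positivity and growth on the real axis\<close>

lemma Ch_Sh_pythagoras_real: "(Ch a w)\<^sup>2 - a * (Sh a w)\<^sup>2 = 1" for a w :: real
  using Ch_add_real[of a w "- w"] by (simp add: power2_eq_square mult.assoc)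

text \<open>The argument of \<open>Cos\<close> is \<alpha> y^2 < (pi / 2)^2: the condition \<alpha>
  < 1 keeps it below the first zero for every height in the closed strip.\<close>

lemma Ch_uminus_pos:
  fixes \<alpha> y :: real
  assumes "\<alpha> < 1" "\<bar>y\<bar> \<le> pi / 2"
  shows "Ch (- \<alpha>) y > 0"
proof -
  have y: "y\<^sup>2 \<le> (pi / 2)\<^sup>2"
    using assms(2) by (simp add: abs_le_square_iff[symmetric])
  have "\<alpha> * y\<^sup>2 < (pi / 2)\<^sup>2"
  proof (cases "y = 0")
    case False
    then have "\<alpha> * y\<^sup>2 < 1 * y\<^sup>2"
      using assms(1) by (intro mult_strict_right_mono) auto
    with y show ?thesis by simp
  qed simp
  then show ?thesis
    by (simp add: Ch_def Cos_pos)
qed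

lemma Sh_uminus_pos:
  fixes \<alpha> y :: real
  assumes "\<alpha> < 1" "0 < y" "y \<le> pi"
  shows "Sh (- \<alpha>) y > 0"
proof -
  have "y\<^sup>2 \<le> pi\<^sup>2"
    using assms by (intro power_mono) auto
  moreover have "\<alpha> * y\<^sup>2 < 1 * y\<^sup>2"
    using assms by (intro mult_strict_right_mono) auto
  ultimately have "\<alpha> * y\<^sup>2 < pi\<^sup>2"
    by simp
  then show ?thesis
    using assms(2) by (simp add: Sh_def Sinc_pos)
qed

text \<open>For \<open>\<alpha> < 0\<close> both functions are bounded, for \<open>\<alpha> \<ge> 0\<close> the exponential type is \<open>\<surd>\<alpha> < \<kappa>\<close>.\<close>

lemma Ch_Sh_bound_real:
  fixes \<alpha> \<kappa> :: real
  assumes "0 < \<kappa>" "\<alpha> < \<kappa>\<^sup>2"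
  obtains C where "C > 0" "\<And>x. \<bar>Ch \<alpha> x\<bar> \<le> C * exp (\<kappa> * \<bar>x\<bar>)" "\<And>x. \<bar>Sh \<alpha> x\<bar> \<le> C * exp (\<kappa> * \<bar>x\<bar>)"
proof (cases "\<alpha> < 0")
  case True
  \<comment> \<open>For negative \<alpha> the Pythagorean identity is a sum of squares equal to 1,
    so |Ch| \<le> 1 and |Sh| \<le> 1 / sqrt (- \<alpha>).\<close>
  define C where "C = 1 + 1 / sqrt (- \<alpha>)"
  have C: "C \<ge> 1" "C \<ge> 1 / sqrt (- \<alpha>)"
    using True by (auto simp: C_def)
  have *: "y \<le> C * exp (\<kappa> * \<bar>x\<bar>)" if "y \<le> C" for x y
  proof -
    have "C \<le> C * exp (\<kappa> * \<bar>x\<bar>)"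
      using C assms by (simp add: mult_le_cancel_left1)
    with that show ?thesis by simp
  qed
  have "\<bar>Ch \<alpha> x\<bar> \<le> C" for x
  proof -
    have "(Ch \<alpha> x)\<^sup>2 \<le> 1"
      using Ch_Sh_pythagoras_real[of \<alpha> x] True mult_nonpos_nonneg[of \<alpha> "(Sh \<alpha> x)\<^sup>2"] by simp
    then show ?thesis
      using C(1) by (simp add: abs_square_le_1)
  qed
  moreover have "\<bar>Sh \<alpha> x\<bar> \<le> C" for x
  proof -
    have "- \<alpha> * (Sh \<alpha> x)\<^sup>2 \<le> 1"
      using Ch_Sh_pythagoras_real[of \<alpha> x] zero_le_power2[of "Ch \<alpha> x"] by linarith
    then have "(Sh \<alpha> x)\<^sup>2 \<le> (1 / sqrt (- \<alpha>))\<^sup>2"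
      using True by (simp add: power_divide field_simps)
    then have "\<bar>Sh \<alpha> x\<bar> \<le> 1 / sqrt (- \<alpha>)"
      using True by (simp flip: abs_le_square_iff)
    with C show ?thesis by simp
  qed
  ultimately show ?thesis
    using C by (intro that[of C] *) auto
next
  case False
  define k where "k = sqrt \<alpha>"
  have k: "k \<ge> 0" "k\<^sup>2 = \<alpha>"
    using False by (auto simp: k_def)
  then have "k < \<kappa>"
    using assms by (metis power2_less_imp_less less_eq_real_def)
  have "Ch \<alpha> x = cosh (k * x)" for x
  proof -
    have "complex_of_real (Ch (k\<^sup>2) x) = Ch ((of_real k)\<^sup>2) (of_real x)"
      by (simp flip: Ch_of_real)
    also have "\<dots> = of_real (cosh (k * x))"
      unfolding Ch_power2 by (simp add: cosh_field_def flip: exp_of_real)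
    finally have "complex_of_real (Ch \<alpha> x) = of_real (cosh (k * x))"
      by (simp only: k)
    then show ?thesis by (simp only: of_real_eq_iff)
  qed
  moreover have cosh_le: "cosh y \<le> exp \<bar>y\<bar>" for y :: real
    by (cases "y \<ge> 0") (auto simp: cosh_def field_simps)
  ultimately have Ch_le: "\<bar>Ch \<alpha> x\<bar> \<le> exp (k * \<bar>x\<bar>)" for x
    using k cosh_le[of "k * x"] by (simp add: abs_mult)
  define C where "C = 1 + 1 / (\<kappa> - k)"
  have C: "C \<ge> 1" "C \<ge> 1 / (\<kappa> - k)"
    using \<open>k < \<kappa>\<close> by (auto simp: C_def)
  have "\<bar>Ch \<alpha> x\<bar> \<le> C * exp (\<kappa> * \<bar>x\<bar>)" for x
  proof -
    have "exp (k * \<bar>x\<bar>) \<le> 1 * exp (\<kappa> * \<bar>x\<bar>)"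
      using \<open>k < \<kappa>\<close> by (simp add: mult_right_mono)
    also have "\<dots> \<le> C * exp (\<kappa> * \<bar>x\<bar>)"
      using C by (intro mult_right_mono) auto
    finally show ?thesis
      using Ch_le[of x] by linarith
  qed
  moreover have "\<bar>Sh \<alpha> x\<bar> \<le> C * exp (\<kappa> * \<bar>x\<bar>)" for x
  proof -
    have Sh_le: "\<bar>Sh \<alpha> x\<bar> \<le> \<bar>x\<bar> * exp (k * \<bar>x\<bar>)"
    proof (cases "k = 0")
      case True
      with k show ?thesis by simp
    next
      case False
      have "complex_of_real (k * Sh (k\<^sup>2) x) = of_real k * Sh ((of_real k)\<^sup>2) (of_real x)"
        by (simp flip: Sh_of_real)
      also have "\<dots> = of_real (sinh (k * x))"
        unfolding Sh_power2 by (simp add: sinh_field_def flip: exp_of_real)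
      finally have "complex_of_real (k * Sh \<alpha> x) = of_real (sinh (k * x))"
        by (simp only: k)
      then have "k * Sh \<alpha> x = sinh (k * x)"
        by (simp only: of_real_eq_iff)
      then have "k * \<bar>Sh \<alpha> x\<bar> = \<bar>sinh (k * x)\<bar>"
        using k(1) by (metis abs_mult abs_of_nonneg)
      moreover have *: "sinh y \<le> y * exp y" if "y \<ge> 0" for y :: real
      proof -
        have "1 - 2 * y \<le> exp (- 2 * y)"
          using exp_ge_add_one_self[of "-2 * y"] by simp
        then have "(1 - 2 * y) * exp y \<le> exp (- 2 * y) * exp y"
          by (rule mult_right_mono) simp
        then show ?thesis
          by (simp add: sinh_def algebra_simps flip: exp_add)
      qed
      have "\<bar>sinh y\<bar> \<le> \<bar>y\<bar> * exp \<bar>y\<bar>" for y :: real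
        using *[of "\<bar>y\<bar>"] by (cases "y \<ge> 0") auto
      from this[of "k * x"] have "\<bar>sinh (k * x)\<bar> \<le> k * (\<bar>x\<bar> * exp (k * \<bar>x\<bar>))"
        using k(1) by (simp add: abs_mult)
      ultimately have "k * \<bar>Sh \<alpha> x\<bar> \<le> k * (\<bar>x\<bar> * exp (k * \<bar>x\<bar>))"
        by simp
      moreover have "k > 0"
        using False k(1) by simp
      ultimately show ?thesis
        by (simp only: mult_le_cancel_left_pos)
    qed
    \<comment> \<open>The factor |x| in the bound of \<open>Sh\<close> is absorbed by the gap
      between k and \<kappa>; at k = 0 this is genuine, since then Sh \<alpha> x = x.\<close>
    have "(\<kappa> - k) * \<bar>x\<bar> \<le> exp ((\<kappa> - k) * \<bar>x\<bar>)"
      using exp_ge_add_one_self[of "(\<kappa> - k) * \<bar>x\<bar>"] by linarith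
    then have "\<bar>x\<bar> \<le> 1 / (\<kappa> - k) * exp ((\<kappa> - k) * \<bar>x\<bar>)"
      using \<open>k < \<kappa>\<close> by (simp add: field_simps)
    also have "\<dots> \<le> C * exp ((\<kappa> - k) * \<bar>x\<bar>)"
      using C by (intro mult_right_mono) auto
    finally have "\<bar>x\<bar> * exp (k * \<bar>x\<bar>) \<le> C * exp ((\<kappa> - k) * \<bar>x\<bar>) * exp (k * \<bar>x\<bar>)"
      by (rule mult_right_mono) simp
    also have "\<dots> = C * exp (\<kappa> * \<bar>x\<bar>)"
      by (simp add: mult.assoc algebra_simps flip: exp_add)
    finally show ?thesis
      using Sh_le by linarith
  qed
  ultimately show ?thesis
    using C by (intro that[of C]) auto
qed

lemma
  fixes a x :: real
  shows DERIV_Ch_real: "(Ch a has_field_derivative a * Sh a x) (at x)"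
    and DERIV_Sh_real: "(Sh a has_field_derivative Ch a x) (at x)"
proof -
  have *: "(f has_field_derivative f') (at x)"
    if "(F has_field_derivative of_real f') (at (of_real x))" "\<And>x. F (of_real x) = of_real (f x)"
    for f :: "real \<Rightarrow> real" and F :: "complex \<Rightarrow> complex" and f'
  proof -
    have "((\<lambda>x. F (of_real x)) has_vector_derivative of_real f') (at x)"
      by (rule has_vector_derivative_real_field) fact
    then have "((\<lambda>x. Re (F (of_real x))) has_vector_derivative Re (of_real f')) (at x)"
      by (rule bounded_linear.has_vector_derivative[OF bounded_linear_Re])
    then show ?thesis
      by (simp add: that(2) has_real_derivative_iff_has_vector_derivative)
  qed
  show "(Ch a has_field_derivative a * Sh a x) (at x)"
    by (rule *[where F = "Ch (of_real a)"]) (auto simp: Ch_of_real Sh_of_real intro!: DERIV_Ch[THEN DERIV_cong])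
  show "(Sh a has_field_derivative Ch a x) (at x)"
    by (rule *[where F = "Sh (of_real a)"]) (auto simp: Ch_of_real Sh_of_real intro!: DERIV_Sh[THEN DERIV_cong])
qed

lemma nonpos_if_le_exp_decay:
  fixes A K \<delta> X :: real
  assumes "\<delta> > 0" and le: "\<And>x. x \<ge> X \<Longrightarrow> A \<le> K * exp (- (\<delta> * x))"
  shows "A \<le> 0"
proof (rule ccontr)
  assume "\<not> A \<le> 0"
  \<comment> \<open>For A > 0 this x gives A * (\<delta> * x) \<ge> K, whereas exp u \<ge> 1 + u
    forces A * (1 + \<delta> * x) \<le> K.\<close>
  define x where "x = max X (max 0 (K / (\<delta> * A)))"
  have x: "x \<ge> X" "x \<ge> 0" "x \<ge> K / (\<delta> * A)"
    by (auto simp: x_def)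
  have "A * exp (\<delta> * x) \<le> K"
    using le[OF x(1)] by (simp add: exp_minus field_simps)
  moreover have "A * (1 + \<delta> * x) \<le> A * exp (\<delta> * x)"
    using \<open>\<not> A \<le> 0\<close> by (intro mult_left_mono exp_ge_add_one_self) auto
  moreover have "K \<le> A * (\<delta> * x)"
    using x(3) \<open>\<not> A \<le> 0\<close> assms(1) by (simp add: field_simps)
  ultimately show False
    using \<open>\<not> A \<le> 0\<close> by (simp add: distrib_left)
qed

lemma cnj_Cos: "cnj (Cos \<zeta>) = Cos (cnj \<zeta>)"
proof -
  have "(\<lambda>k. cnj ((- \<zeta>) ^ k / fact (2 * k))) sums cnj (Cos \<zeta>)"
    by (simp only: sums_cnj Cos_sums)
  then have "(\<lambda>k. (- cnj \<zeta>) ^ k / fact (2 * k)) sums cnj (Cos \<zeta>)"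
    by simp
  then show ?thesis
    using Cos_sums sums_unique2 by blast
qed

lemma cnj_Sinc: "cnj (Sinc \<zeta>) = Sinc (cnj \<zeta>)"
proof -
  have "(\<lambda>k. cnj ((- \<zeta>) ^ k / fact (2 * k + 1))) sums cnj (Sinc \<zeta>)"
    by (simp only: sums_cnj Sinc_sums)
  then have "(\<lambda>k. (- cnj \<zeta>) ^ k / fact (2 * k + 1)) sums cnj (Sinc \<zeta>)"
    by (simp del: fact_Suc)
  then show ?thesis
    using Sinc_sums sums_unique2 by blast
qed

lemma cnj_Ch: "cnj (Ch a w) = Ch (cnj a) (cnj w)" and cnj_Sh: "cnj (Sh a w) = Sh (cnj a) (cnj w)"
  by (simp_all add: Ch_def Sh_def cnj_Cos cnj_Sinc)


section \<open>The solutions D and N on the strip\<close>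

locale strip =
  fixes \<alpha> \<theta> :: real
  assumes \<alpha>_less_1: "\<alpha> < 1"
begin

text \<open>For \<alpha> > 0 the numbers \<open>c\<close> and \<open>s\<close> are cos (sqrt
  \<alpha> * pi / 2) and sin (sqrt \<alpha> * pi / 2) / sqrt \<alpha>: the vertical factors in
  \<open>D_Complex\<close> at the edge Im w = pi / 2.\<close>

definition c :: real where "c = Ch (- \<alpha>) (pi / 2)"
definition s :: real where "s = Sh (- \<alpha>) (pi / 2)"
definition q :: real where "q = c\<^sup>2 - (sin \<theta>)\<^sup>2"

text \<open>Polymorphic, because it serves both as an entire function and as a real function of the
  abscissa; \<open>of_real_D\<close> passes from one to the other.\<close>

definition D :: "'a::{real_normed_field,banach} \<Rightarrow> 'a" where
  "D w = of_real (c * cos \<theta>) * Sh (of_real \<alpha>) w + of_real (s * sin \<theta>) * Ch (of_real \<alpha>) w"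

definition D' :: "'a::{real_normed_field,banach} \<Rightarrow> 'a" where
  "D' w = of_real (c * cos \<theta>) * Ch (of_real \<alpha>) w + of_real (\<alpha> * s * sin \<theta>) * Sh (of_real \<alpha>) w"

text \<open>This is \<open>D\<close> with \<theta> replaced by \<theta> + pi / 2, hence half of the
  numerator in \<open>M\<close>.\<close>

definition N :: "'a::{real_normed_field,banach} \<Rightarrow> 'a" where
  "N w = of_real (s * cos \<theta>) * Ch (of_real \<alpha>) w - of_real (c * sin \<theta>) * Sh (of_real \<alpha>) w"

definition N' :: "'a::{real_normed_field,banach} \<Rightarrow> 'a" where
  "N' w = of_real (\<alpha> * s * cos \<theta>) * Sh (of_real \<alpha>) w - of_real (c * sin \<theta>) * Ch (of_real \<alpha>) w"

text \<open>The constant 8 c^2 s^2 is 2 pi^2 Sinc^2 (pi^2 \<alpha>), by the doubling formula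
  \<open>Sinc_eq\<close>.\<close>

definition m :: "complex \<Rightarrow> complex" where
  "m w = - N w / (of_real (8 * c\<^sup>2 * s\<^sup>2) * D w)"

lemma c_pos: "c > 0" and s_pos: "s > 0"
  unfolding c_def s_def using \<alpha>_less_1 by (auto intro: Ch_uminus_pos Sh_uminus_pos)

lemma c_s_pythagoras: "c\<^sup>2 + \<alpha> * s\<^sup>2 = 1"
  using Ch_Sh_pythagoras_real[of "- \<alpha>" "pi / 2"] by (simp add: c_def s_def)

lemma of_real_D: "D (of_real x) = (of_real (D x) :: 'a::{real_normed_field,banach})"
  and of_real_D': "D' (of_real x) = (of_real (D' x) :: 'a::{real_normed_field,banach})"
  and of_real_N: "N (of_real x) = (of_real (N x) :: 'a::{real_normed_field,banach})"
  by (simp_all add: D_def D'_def N_def Ch_of_real Sh_of_real)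

lemma cnj_D: "cnj (D w) = D (cnj w)" and cnj_N: "cnj (N w) = N (cnj w)"
  by (simp_all add: D_def N_def cnj_Ch cnj_Sh)

lemma cnj_m: "cnj (m w) = m (cnj w)"
  by (simp add: m_def cnj_D cnj_N)

section \<open>Wronskian and first integral on the real axis\<close>

lemma wronskian: "N w * D' w - D w * N' w = s * c" for w :: real
proof -
  have "N w * D' w - D w * N' w
      = s * c * ((cos \<theta>)\<^sup>2 + (sin \<theta>)\<^sup>2) * ((Ch \<alpha> w)\<^sup>2 - \<alpha> * (Sh \<alpha> w)\<^sup>2)"
    unfolding N_def N'_def D_def D'_def of_real_eq_id id_apply by algebra
  then show ?thesis
    unfolding Ch_Sh_pythagoras_real by simp
qed

lemma D'_square: "(D' w)\<^sup>2 = q + \<alpha> * (D w)\<^sup>2" for w :: real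
proof -
  have "(D' w)\<^sup>2 - \<alpha> * (D w)\<^sup>2
      = (c\<^sup>2 * (cos \<theta>)\<^sup>2 - \<alpha> * s\<^sup>2 * (sin \<theta>)\<^sup>2) * ((Ch \<alpha> w)\<^sup>2 - \<alpha> * (Sh \<alpha> w)\<^sup>2)"
    by (simp add: D_def D'_def power2_eq_square algebra_simps)
  also have "\<dots> = c\<^sup>2 * (cos \<theta>)\<^sup>2 - \<alpha> * s\<^sup>2 * (sin \<theta>)\<^sup>2"
    unfolding Ch_Sh_pythagoras_real by simp
  also have "\<alpha> * s\<^sup>2 = 1 - c\<^sup>2"
    using c_s_pythagoras by simp
  finally show ?thesis
    by (simp add: q_def cos_squared_eq algebra_simps)
qed

lemma D'_nonzero: "D w = 0 \<Longrightarrow> D' w \<noteq> 0" for w :: real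
  using wronskian[of w] c_pos s_pos by auto

lemma q_pos: "D w = 0 \<Longrightarrow> q > 0" for w :: real
  using D'_square[of w] D'_nonzero[of w] by (metis add.right_neutral mult_zero_right zero_less_power2 zero_power2)

text \<open>Multiplication by \<open>D' w\<close> turns the numerator into the Wronskian and the
  denominator into the first integral. The quotient is therefore the same at every zero, which is
  why the atoms differ only by the factor |E|.\<close>

lemma N_over_D':
  fixes w :: real
  assumes "D w = 0"
  shows "N w / D' w = s * c / q"
proof -
  have "N w / D' w = (N w * D' w) / (D' w)\<^sup>2"
    using D'_nonzero[OF assms] by (simp add: power2_eq_square)
  then show ?thesis
    using wronskian[of w] D'_square[of w] assms by simp
qed

section \<open>Values in the closed strip\<close>

lemma DERIV_D: "(D has_field_derivative D' w) (at w)" for w :: complex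
  unfolding D_def[abs_def] D'_def
  by (auto intro!: derivative_eq_intros DERIV_Ch DERIV_Sh simp: algebra_simps)

lemma DERIV_D_real: "(D has_field_derivative D' w) (at w)" for w :: real
  unfolding D_def[abs_def] D'_def
  by (auto intro!: derivative_eq_intros DERIV_Ch_real DERIV_Sh_real simp: algebra_simps)

lemma DERIV_N: "(N has_field_derivative N' w) (at w)" for w :: complex
  unfolding N_def[abs_def] N'_def
  by (auto intro!: derivative_eq_intros DERIV_Ch DERIV_Sh simp: algebra_simps)

lemma D_holomorphic: "(D :: complex \<Rightarrow> complex) holomorphic_on A"
  and N_holomorphic: "(N :: complex \<Rightarrow> complex) holomorphic_on A"
  using DERIV_D DERIV_N by (meson holomorphic_on_def field_differentiable_def field_differentiable_at_within)+

text \<open>The addition theorem separates the variables: at i y the function \<open>Ch\<close> is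
  real and \<open>Sh\<close> imaginary, so the real and imaginary parts of \<open>D\<close> carry D
  x and D' x. Nonvanishing, boundary values and lower bounds in the strip all come from this
  splitting.\<close>

lemma D_Complex: "D (Complex x y) = Complex (D x * Ch (- \<alpha>) y) (D' x * Sh (- \<alpha>) y)"
  and N_Complex: "N (Complex x y) = Complex (N x * Ch (- \<alpha>) y) (N' x * Sh (- \<alpha>) y)"
  by (simp_all add: D_def D'_def N_def N'_def Complex_eq Ch_add Sh_add Ch_imaginary Sh_imaginary
      Ch_of_real Sh_of_real algebra_simps)

text \<open>Both vertical factors are nonzero at these heights, so a zero would give D x = D' x = 0
  against the Wronskian.\<close>

lemma D_nonzero:
  assumes "0 < \<bar>y\<bar>" "\<bar>y\<bar> \<le> pi / 2"
  shows "D (Complex x y) \<noteq> 0"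
proof
  assume "D (Complex x y) = 0"
  then have *: "D x * Ch (- \<alpha>) y = 0" "D' x * Sh (- \<alpha>) y = 0"
    by (simp_all add: D_Complex complex_eq_iff)
  moreover have "Ch (- \<alpha>) y \<noteq> 0"
    using Ch_uminus_pos[OF \<alpha>_less_1 assms(2)] by simp
  moreover have "Sh (- \<alpha>) y \<noteq> 0"
    using Sh_uminus_pos[OF \<alpha>_less_1, of "\<bar>y\<bar>"] assms pi_gt_zero
    by (cases "y \<ge> 0") (auto simp: abs_if split: if_splits)
  ultimately show False
    using D'_nonzero by auto
qed

text \<open>On this edge - Im (N * cnj D) is s c times the Wronskian, and the Wronskian is s c
  again; the product cancels c^2 s^2 in the denominator of \<open>m\<close>.\<close>

lemma Im_m_top: "Im (m (Complex x (pi / 2))) = 1 / (8 * (cmod (D (Complex x (pi / 2))))\<^sup>2)"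
proof -
  define d where "d = D (Complex x (pi / 2))"
  have d: "d = Complex (D x * c) (D' x * s)"
    by (simp add: d_def D_Complex c_def s_def)
  have n: "N (Complex x (pi / 2)) = Complex (N x * c) (N' x * s)"
    by (simp add: N_Complex c_def s_def)
  have "d \<noteq> 0"
    unfolding d_def by (rule D_nonzero) auto
  have "m (Complex x (pi / 2)) = - (N (Complex x (pi / 2)) * cnj d) / of_real (8 * c\<^sup>2 * s\<^sup>2 * (cmod d)\<^sup>2)"
    unfolding m_def d_def[symmetric] using \<open>d \<noteq> 0\<close> complex_norm_square[of d]
    by (simp add: field_simps)
  then have "Im (m (Complex x (pi / 2))) = - Im (N (Complex x (pi / 2)) * cnj d) / (8 * c\<^sup>2 * s\<^sup>2 * (cmod d)\<^sup>2)"
    by (simp only: Im_divide_of_real uminus_complex.sel)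
  also have "- Im (N (Complex x (pi / 2)) * cnj d) = (N x * D' x - D x * N' x) * (s * c)"
    unfolding n d by (simp add: algebra_simps)
  also have "\<dots> / (8 * c\<^sup>2 * s\<^sup>2 * (cmod d)\<^sup>2) = 1 / (8 * (cmod d)\<^sup>2)"
    unfolding wronskian using c_pos s_pos by (simp add: power2_eq_square)
  finally show ?thesis
    by (simp add: d_def)
qed

text \<open>The real part is D x * Ch (- \<alpha>) y, and the second factor has a positive minimum
  over the compact range of heights. One good value of \<open>D\<close> on the real axis thus
  controls a whole vertical edge.\<close>

lemma D_lower_bound:
  obtains \<mu> where "\<mu> > 0" "\<And>x y. \<bar>y\<bar> \<le> pi / 2 \<Longrightarrow> \<mu> * \<bar>D x\<bar> \<le> cmod (D (Complex x y))"
proof -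
  have "continuous_on {- pi / 2..pi / 2} (Ch (- \<alpha>))"
    by (meson DERIV_Ch_real DERIV_continuous_on has_field_derivative_at_within)
  then obtain y0 where y0: "y0 \<in> {- pi / 2..pi / 2}" "\<And>y. y \<in> {- pi / 2..pi / 2} \<Longrightarrow> Ch (- \<alpha>) y0 \<le> Ch (- \<alpha>) y"
    using continuous_attains_inf[of "{- pi / 2..pi / 2}" "Ch (- \<alpha>)"] by auto
  define \<mu> where "\<mu> = Ch (- \<alpha>) y0"
  have "\<mu> > 0"
    using y0(1) unfolding \<mu>_def by (intro Ch_uminus_pos \<alpha>_less_1) auto
  moreover have "\<mu> * \<bar>D x\<bar> \<le> cmod (D (Complex x y))" if "\<bar>y\<bar> \<le> pi / 2" for x y
  proof -
    have le: "\<mu> \<le> Ch (- \<alpha>) y"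
      unfolding \<mu>_def using that by (intro y0(2)) auto
    then have "\<mu> * \<bar>D x\<bar> \<le> Ch (- \<alpha>) y * \<bar>D x\<bar>"
      by (rule mult_right_mono) simp
    also have "\<dots> = \<bar>Re (D (Complex x y))\<bar>"
      using le \<open>\<mu> > 0\<close> by (simp add: D_Complex abs_mult)
    also have "\<dots> \<le> cmod (D (Complex x y))"
      by (rule abs_Re_le_cmod)
    finally show ?thesis .
  qed
  ultimately show ?thesis by (rule that)
qed

section \<open>Growth of the solutions\<close>

lemma N_bound_real:
  assumes "0 < \<kappa>" "\<alpha> < \<kappa>\<^sup>2"
  obtains C where "C > 0" "\<And>x. \<bar>N x\<bar> \<le> C * exp (\<kappa> * \<bar>x\<bar>)" "\<And>x. \<bar>N' x\<bar> \<le> C * exp (\<kappa> * \<bar>x\<bar>)"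
proof -
  obtain B where B: "B > 0" "\<And>x. \<bar>Ch \<alpha> x\<bar> \<le> B * exp (\<kappa> * \<bar>x\<bar>)" "\<And>x. \<bar>Sh \<alpha> x\<bar> \<le> B * exp (\<kappa> * \<bar>x\<bar>)"
    using Ch_Sh_bound_real[OF assms] by metis
  define A where "A = 1 + \<bar>s * cos \<theta>\<bar> + \<bar>\<alpha> * s * cos \<theta>\<bar> + \<bar>c * sin \<theta>\<bar>"
  have *: "\<bar>u * Ch \<alpha> x\<bar> \<le> \<bar>u\<bar> * (B * exp (\<kappa> * \<bar>x\<bar>))" "\<bar>u * Sh \<alpha> x\<bar> \<le> \<bar>u\<bar> * (B * exp (\<kappa> * \<bar>x\<bar>))" for u x
    using B(2,3) by (auto simp: abs_mult intro!: mult_left_mono)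
  have A: "\<bar>s * cos \<theta>\<bar> + \<bar>c * sin \<theta>\<bar> \<le> A" "\<bar>\<alpha> * s * cos \<theta>\<bar> + \<bar>c * sin \<theta>\<bar> \<le> A" "A > 0"
    by (auto simp: A_def)
  show ?thesis
  proof (rule that[of "A * B"])
    show "A * B > 0" using A B by simp
    fix x
    have e: "B * exp (\<kappa> * \<bar>x\<bar>) \<ge> 0" using B by simp
    have "\<bar>N x\<bar> \<le> (\<bar>s * cos \<theta>\<bar> + \<bar>c * sin \<theta>\<bar>) * (B * exp (\<kappa> * \<bar>x\<bar>))"
      unfolding N_def of_real_eq_id id_apply distrib_right
      by (rule order_trans[OF abs_triangle_ineq4 add_mono[OF *]])
    also have "\<dots> \<le> A * (B * exp (\<kappa> * \<bar>x\<bar>))"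
      by (rule mult_right_mono[OF A(1) e])
    finally show "\<bar>N x\<bar> \<le> A * B * exp (\<kappa> * \<bar>x\<bar>)" by simp
    have "\<bar>N' x\<bar> \<le> (\<bar>\<alpha> * s * cos \<theta>\<bar> + \<bar>c * sin \<theta>\<bar>) * (B * exp (\<kappa> * \<bar>x\<bar>))"
      unfolding N'_def of_real_eq_id id_apply distrib_right
      by (rule order_trans[OF abs_triangle_ineq4 add_mono[OF *(2) *(1)]])
    also have "\<dots> \<le> A * (B * exp (\<kappa> * \<bar>x\<bar>))"
      by (rule mult_right_mono[OF A(2) e])
    finally show "\<bar>N' x\<bar> \<le> A * B * exp (\<kappa> * \<bar>x\<bar>)" by simp
  qed
qed

lemma N_bound:
  assumes "0 < \<kappa>" "\<alpha> < \<kappa>\<^sup>2"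
  obtains C where "C > 0" "\<And>x y. \<bar>y\<bar> \<le> pi / 2 \<Longrightarrow> cmod (N (Complex x y)) \<le> C * exp (\<kappa> * \<bar>x\<bar>)"
proof -
  obtain C where C: "C > 0" "\<And>x. \<bar>N x\<bar> \<le> C * exp (\<kappa> * \<bar>x\<bar>)" "\<And>x. \<bar>N' x\<bar> \<le> C * exp (\<kappa> * \<bar>x\<bar>)"
    using N_bound_real[OF assms] by metis
  \<comment> \<open>Only a crude exponent with - \<alpha> < k^2: it bounds the vertical factors on
    the compact range of heights.\<close>
  define k where "k = 1 + \<bar>\<alpha>\<bar>"
  have "k\<^sup>2 = 1 + 2 * \<bar>\<alpha>\<bar> + \<alpha>\<^sup>2" "0 < k"
    by (auto simp: k_def power2_eq_square algebra_simps)
  then have "- \<alpha> < k\<^sup>2" "0 < k"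
    using zero_le_power2[of \<alpha>] abs_ge_minus_self[of \<alpha>] by linarith+
  then obtain B where B: "B > 0" "\<And>y. \<bar>Ch (- \<alpha>) y\<bar> \<le> B * exp (k * \<bar>y\<bar>)" "\<And>y. \<bar>Sh (- \<alpha>) y\<bar> \<le> B * exp (k * \<bar>y\<bar>)"
    using Ch_Sh_bound_real[of k "- \<alpha>"] by metis
  define E where "E = B * exp (k * (pi / 2))"
  have E: "E > 0" using B by (simp add: E_def)
  show ?thesis
  proof (rule that[of "2 * C * E"])
    show "2 * C * E > 0" using C E by simp
    fix x y :: real
    assume y: "\<bar>y\<bar> \<le> pi / 2"
    have "B * exp (k * \<bar>y\<bar>) \<le> E"
      unfolding E_def using B(1) y \<open>0 < k\<close> by simp
    then have le: "\<bar>Ch (- \<alpha>) y\<bar> \<le> E" "\<bar>Sh (- \<alpha>) y\<bar> \<le> E"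
      using B(2,3)[of y] by linarith+
    have "cmod (N (Complex x y)) \<le> \<bar>N x\<bar> * \<bar>Ch (- \<alpha>) y\<bar> + \<bar>N' x\<bar> * \<bar>Sh (- \<alpha>) y\<bar>"
      using cmod_le[of "N (Complex x y)"] by (simp add: N_Complex abs_mult)
    also have "\<dots> \<le> C * exp (\<kappa> * \<bar>x\<bar>) * E + C * exp (\<kappa> * \<bar>x\<bar>) * E"
      using C le by (intro add_mono mult_mono) auto
    finally show "cmod (N (Complex x y)) \<le> 2 * C * E * exp (\<kappa> * \<bar>x\<bar>)"
      by (simp add: mult_ac)
  qed
qed

text \<open>If \<open>D\<close> decayed faster than \<open>exp (- \<kappa> x)\<close>, the first integral \<open>D'_square\<close> would force
  \<open>D'\<close> to decay as fast, and the Wronskian would tend to 0.\<close>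

lemma D_not_decaying:
  fixes \<sigma> :: real
  assumes \<sigma>: "\<sigma> = 1 \<or> \<sigma> = -1" and \<kappa>: "0 < \<kappa>" "\<alpha> < \<kappa>\<^sup>2"
  shows "\<exists>x\<ge>X. exp (- (\<kappa> * x)) \<le> \<bar>D (\<sigma> * x)\<bar>"
proof (rule ccontr)
  assume neg: "\<not> ?thesis"
  have dec: "\<bar>D (\<sigma> * x)\<bar> < exp (- (\<kappa> * x))" if "x \<ge> X" for x
    using neg that by (meson not_less)
  have dec2: "(D (\<sigma> * x))\<^sup>2 \<le> exp (- (2 * \<kappa> * x))" if "x \<ge> X" for x
  proof -
    have "\<bar>D (\<sigma> * x)\<bar>\<^sup>2 \<le> (exp (- (\<kappa> * x)))\<^sup>2"
      using dec[OF that] by (intro power_mono) auto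
    then show ?thesis
      by (simp add: exp_double[symmetric] mult_ac)
  qed
  \<comment> \<open>Two small values of \<open>D\<close> at distance 1 give, by the mean value
    theorem, an intermediate point where \<open>D'\<close> is small too. There the first integral
    bounds the constant q, which must then vanish.\<close>
  have "\<bar>q\<bar> \<le> (4 + \<bar>\<alpha>\<bar>) * exp (- (2 * \<kappa> * x))" if x: "x \<ge> X" for x
  proof -
    have "((\<lambda>x. D (\<sigma> * x)) has_field_derivative D' (\<sigma> * x) * \<sigma>) (at x)" for x
      by (rule DERIV_chain2[OF DERIV_D_real]) (auto intro!: derivative_eq_intros)
    then obtain \<xi> where \<xi>: "x < \<xi>" "\<xi> < x + 1" "D (\<sigma> * (x + 1)) - D (\<sigma> * x) = (x + 1 - x) * (D' (\<sigma> * \<xi>) * \<sigma>)"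
      using MVT2[of x "x + 1" "\<lambda>x. D (\<sigma> * x)" "\<lambda>x. D' (\<sigma> * x) * \<sigma>"] by auto
    have mono: "exp (- (2 * \<kappa> * \<xi>)) \<le> exp (- (2 * \<kappa> * x))" "exp (- (\<kappa> * (x + 1))) \<le> exp (- (\<kappa> * x))"
      using \<xi> \<kappa> by (auto intro!: mult_left_mono)
    have "\<bar>D' (\<sigma> * \<xi>)\<bar> = \<bar>D (\<sigma> * (x + 1)) - D (\<sigma> * x)\<bar>"
      using \<xi>(3) \<sigma> by auto
    also have "\<dots> \<le> 2 * exp (- (\<kappa> * x))"
      using dec[of x] dec[of "x + 1"] x mono(2) by linarith
    finally have "(D' (\<sigma> * \<xi>))\<^sup>2 \<le> (2 * exp (- (\<kappa> * x)))\<^sup>2"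
      by (subst power2_le_iff_abs_le) auto
    then have "(D' (\<sigma> * \<xi>))\<^sup>2 \<le> 4 * exp (- (2 * \<kappa> * x))"
      by (simp add: power_mult_distrib exp_double[symmetric] mult_ac)
    moreover have "(D (\<sigma> * \<xi>))\<^sup>2 \<le> exp (- (2 * \<kappa> * x))"
      using dec2[of \<xi>] x \<xi>(1) mono(1) by linarith
    then have "\<bar>\<alpha> * (D (\<sigma> * \<xi>))\<^sup>2\<bar> \<le> \<bar>\<alpha>\<bar> * exp (- (2 * \<kappa> * x))"
      by (auto simp: abs_mult intro!: mult_left_mono)
    ultimately show ?thesis
      using D'_square[of "\<sigma> * \<xi>"] zero_le_power2[of "D' (\<sigma> * \<xi>)"] by (simp add: distrib_right)
  qed
  then have "\<bar>q\<bar> \<le> 0"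
    using \<kappa> by (intro nonpos_if_le_exp_decay[of "2 * \<kappa>" X]) auto
  \<comment> \<open>With q = 0 the first integral reads D'^2 = \<alpha> D^2, so the decay of
    \<open>D\<close> passes to \<open>D'\<close> at every point.\<close>
  then have D': "\<bar>D' (\<sigma> * x)\<bar> \<le> (1 + \<bar>\<alpha>\<bar>) * exp (- (\<kappa> * x))" if "x \<ge> X" for x
  proof -
    have "(D' (\<sigma> * x))\<^sup>2 \<le> \<bar>\<alpha>\<bar> * (D (\<sigma> * x))\<^sup>2"
      using D'_square[of "\<sigma> * x"] \<open>\<bar>q\<bar> \<le> 0\<close> by (simp add: mult_right_mono)
    also have "\<dots> \<le> (1 + \<bar>\<alpha>\<bar>)\<^sup>2 * exp (- (2 * \<kappa> * x))"
      using dec2[OF that] by (intro mult_mono) (auto simp: power2_eq_square algebra_simps)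
    also have "\<dots> = ((1 + \<bar>\<alpha>\<bar>) * exp (- (\<kappa> * x)))\<^sup>2"
      by (simp add: power_mult_distrib exp_double[symmetric] mult_ac)
    finally show ?thesis
      by (subst (asm) power2_le_iff_abs_le) auto
  qed
  \<comment> \<open>A rate strictly between sqrt (max \<alpha> 0) and \<kappa>: \<open>N\<close> and
    \<open>N'\<close> grow at most with rate k, \<open>D\<close> and \<open>D'\<close> decay with
    rate \<kappa>, so the Wronskian decays with rate \<kappa> - k.\<close>
  define k where "k = sqrt ((max \<alpha> 0 + \<kappa>\<^sup>2) / 2)"
  have "max \<alpha> 0 < \<kappa>\<^sup>2" using \<kappa> by simp
  then have "k\<^sup>2 = (max \<alpha> 0 + \<kappa>\<^sup>2) / 2"
    by (simp add: k_def)
  then have k: "0 < k" "\<alpha> < k\<^sup>2" "k < \<kappa>"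
    using \<open>max \<alpha> 0 < \<kappa>\<^sup>2\<close> \<kappa> by (auto simp: k_def intro!: real_less_lsqrt add_nonneg_pos)
  obtain C where C: "C > 0" "\<And>x. \<bar>N x\<bar> \<le> C * exp (k * \<bar>x\<bar>)" "\<And>x. \<bar>N' x\<bar> \<le> C * exp (k * \<bar>x\<bar>)"
    using N_bound_real[OF k(1,2)] by metis
  have "s * c \<le> (C * (2 + \<bar>\<alpha>\<bar>)) * exp (- ((\<kappa> - k) * x))" if x: "x \<ge> max X 0" for x
  proof -
    have ax: "\<bar>\<sigma> * x\<bar> = x"
      using x \<sigma> by auto
    have "s * c \<le> \<bar>N (\<sigma> * x)\<bar> * \<bar>D' (\<sigma> * x)\<bar> + \<bar>D (\<sigma> * x)\<bar> * \<bar>N' (\<sigma> * x)\<bar>"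
      unfolding wronskian[of "\<sigma> * x", symmetric] by (simp flip: abs_mult)
    also have "\<dots> \<le> (C * exp (k * x)) * ((1 + \<bar>\<alpha>\<bar>) * exp (- (\<kappa> * x))) + exp (- (\<kappa> * x)) * (C * exp (k * x))"
      using C(2,3)[of "\<sigma> * x"] D'[of x] dec[of x] x C(1) unfolding ax
      by (intro add_mono mult_mono) auto
    also have "\<dots> = (C * (2 + \<bar>\<alpha>\<bar>)) * (exp (k * x) * exp (- (\<kappa> * x)))"
      by (simp add: algebra_simps)
    also have "exp (k * x) * exp (- (\<kappa> * x)) = exp (- ((\<kappa> - k) * x))"
      by (simp add: algebra_simps flip: exp_add)
    finally show ?thesis .
  qed
  then have "s * c \<le> 0"
    using k by (intro nonpos_if_le_exp_decay[of "\<kappa> - k" "max X 0"]) auto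
  with c_pos s_pos show False
    by (simp add: mult_le_0_iff)
qed

end


section \<open>Uniqueness of the Herglotz measure\<close>

lemma norm_herglotz_kernel:
  fixes z :: complex
  assumes "Im z \<noteq> 0"
  shows "cmod (1 / (of_real t - z) - of_real (t / (t\<^sup>2 + 1))) \<le> (cmod z + cmod (1 + z\<^sup>2) / \<bar>Im z\<bar>) * (1 / (t\<^sup>2 + 1))"
proof -
  have nz: "of_real t - z \<noteq> 0" "(of_real t)\<^sup>2 + 1 \<noteq> (0::complex)"
    using assms by (auto simp: complex_eq_iff power2_eq_square) (smt (verit) zero_le_square)
  \<comment> \<open>Both sides equal (1 + t z) / ((t - z) (t^2 + 1)); this form isolates the weight
    1 / (t^2 + 1), and the remaining factor is bounded in t.\<close>
  have "1 / (of_real t - z) - of_real (t / (t\<^sup>2 + 1)) = (z + (1 + z\<^sup>2) / (of_real t - z)) * of_real (1 / (t\<^sup>2 + 1))"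
    using nz by (simp add: field_simps power2_eq_square)
  moreover have "cmod (z + (1 + z\<^sup>2) / (of_real t - z)) \<le> cmod z + cmod (1 + z\<^sup>2) / \<bar>Im z\<bar>"
  proof -
    have "\<bar>Im z\<bar> \<le> cmod (of_real t - z)"
      using abs_Im_le_cmod[of "of_real t - z"] assms by simp
    then have "cmod (1 + z\<^sup>2) / cmod (of_real t - z) \<le> cmod (1 + z\<^sup>2) / \<bar>Im z\<bar>"
      using assms nz(1) by (intro divide_left_mono mult_pos_pos) auto
    then show ?thesis
      using norm_triangle_ineq[of z "(1 + z\<^sup>2) / (of_real t - z)"] by (simp add: norm_divide)
  qed
  then have "cmod (z + (1 + z\<^sup>2) / (of_real t - z)) * (1 / (t\<^sup>2 + 1)) \<le> (cmod z + cmod (1 + z\<^sup>2) / \<bar>Im z\<bar>) * (1 / (t\<^sup>2 + 1))"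
    by (intro mult_right_mono) auto
  moreover have "cmod (of_real (1 / (t\<^sup>2 + 1))) = 1 / (t\<^sup>2 + 1)"
    by (simp only: norm_of_real) simp
  ultimately show ?thesis
    by (simp only: norm_mult)
qed

lemma integrable_herglotz_kernel:
  fixes \<nu> :: "real measure"
  assumes "sets \<nu> = sets borel" "integrable \<nu> (\<lambda>t. 1 / (t\<^sup>2 + 1))" "Im z \<noteq> 0"
  shows "integrable \<nu> (\<lambda>t. 1 / (of_real t - z) - of_real (t / (t\<^sup>2 + 1)) :: complex)"
proof (rule Bochner_Integration.integrable_bound)
  show "integrable \<nu> (\<lambda>t. (cmod z + cmod (1 + z\<^sup>2) / \<bar>Im z\<bar>) * (1 / (t\<^sup>2 + 1)))"
    by (intro integrable_mult_right assms)
  note [measurable_cong] = assms(1)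
  show "(\<lambda>t. 1 / (of_real t - z) - of_real (t / (t\<^sup>2 + 1))) \<in> borel_measurable \<nu>"
    by measurable
  show "AE t in \<nu>. norm (1 / (of_real t - z) - of_real (t / (t\<^sup>2 + 1)))
      \<le> norm ((cmod z + cmod (1 + z\<^sup>2) / \<bar>Im z\<bar>) * (1 / (t\<^sup>2 + 1)))"
    unfolding real_norm_def
    by (intro AE_I2 order_trans[OF norm_herglotz_kernel[OF assms(3)] abs_ge_self])
qed

lemma Im_herglotz_kernel:
  "Im (1 / (of_real t - z) - of_real (t / (t\<^sup>2 + 1))) = Im z / ((t - Re z)\<^sup>2 + (Im z)\<^sup>2)"
  by (simp add: Im_divide)

lemma radon_measure_sigma_finite:
  assumes "radon_measure \<nu>"
  shows "sigma_finite_measure \<nu>"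
proof
  have sets: "sets \<nu> = sets borel"
    using assms by (simp add: radon_measure_def)
  then have space: "space \<nu> = UNIV"
    by (simp add: sets_eq_imp_space_eq)
  show "\<exists>A. countable A \<and> A \<subseteq> sets \<nu> \<and> \<Union> A = space \<nu> \<and> (\<forall>a\<in>A. emeasure \<nu> a \<noteq> \<infinity>)"
  proof (intro exI[of _ "range (\<lambda>n::nat. {- real n..real n})"] conjI ballI)
    have "\<exists>n. x \<in> {- real n..real n}" for x :: real
    proof -
      obtain n where "\<bar>x\<bar> \<le> real n"
        using real_arch_simple[of "\<bar>x\<bar>"] by auto
      then show ?thesis
        by (intro exI[of _ n]) auto
    qed
    then show "\<Union> (range (\<lambda>n::nat. {- real n..real n})) = space \<nu>"
      unfolding space by blast
    show "emeasure \<nu> a \<noteq> \<infinity>" if "a \<in> range (\<lambda>n::nat. {- real n..real n})" for a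
    proof -
      from that obtain n :: nat where a: "a = {- real n..real n}" by blast
      have "compact a" unfolding a by (rule compact_Icc)
      with assms have "emeasure \<nu> a < \<infinity>" unfolding radon_measure_def by blast
      then show ?thesis by simp
    qed
  qed (auto simp: sets)
qed

section \<open>Poisson kernel and Stieltjes inversion\<close>

lemma poisson_kernel_eq:
  fixes \<epsilon> u :: real
  assumes "\<epsilon> > 0"
  shows "1 / (1 + (u / \<epsilon>)\<^sup>2) / \<epsilon> = \<epsilon> / (u\<^sup>2 + \<epsilon>\<^sup>2)"
proof -
  have "1 + (u / \<epsilon>)\<^sup>2 = (u\<^sup>2 + \<epsilon>\<^sup>2) / \<epsilon>\<^sup>2"
    using assms by (simp add: power_divide add_divide_distrib)
  then show ?thesis
    using assms by (simp add: power2_eq_square)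
qed

lemma DERIV_arctan_scaled:
  fixes \<epsilon> u x :: real
  assumes "\<epsilon> > 0"
  shows "((\<lambda>x. arctan ((x - u) / \<epsilon>)) has_field_derivative \<epsilon> / ((x - u)\<^sup>2 + \<epsilon>\<^sup>2)) (at x)"
  using assms poisson_kernel_eq[OF assms, of "x - u"]
  by (auto intro!: derivative_eq_intros simp: inverse_eq_divide)

lemma nn_integral_poisson_kernel:
  fixes a b \<epsilon> t :: real
  assumes "\<epsilon> > 0" "a \<le> b"
  shows "(\<integral>\<^sup>+x. ennreal (\<epsilon> / ((t - x)\<^sup>2 + \<epsilon>\<^sup>2)) * indicator {a..b} x \<partial>lborel)
    = ennreal (arctan ((b - t) / \<epsilon>) - arctan ((a - t) / \<epsilon>))"
proof (rule nn_integral_FTC_Icc)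
  fix x
  show "((\<lambda>x. arctan ((x - t) / \<epsilon>)) has_field_derivative \<epsilon> / ((t - x)\<^sup>2 + \<epsilon>\<^sup>2)) (at x)"
    using DERIV_arctan_scaled[OF assms(1), of t x] by (simp only: power2_commute)
qed (use assms in auto)

text \<open>The imaginary part of the Herglotz kernel is the Poisson kernel, whose integral in x is
  a difference of arctangents. Integrals of nonnegative functions are used, so that the exchange of
  integrations only asks for sigma-finiteness of both measures.\<close>

lemma herglotz_boundary_integral:
  assumes "herglotz_measure f \<nu>"
  obtains \<beta> where "\<beta> \<ge> 0" "\<And>a b \<epsilon>. a \<le> b \<Longrightarrow> \<epsilon> > 0 \<Longrightarrow>
    (\<integral>\<^sup>+x. ennreal (Im (f (Complex x \<epsilon>))) * indicator {a..b} x \<partial>lborel) =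
      ennreal (\<beta> * \<epsilon> * (b - a)) + (\<integral>\<^sup>+t. ennreal (arctan ((b - t) / \<epsilon>) - arctan ((a - t) / \<epsilon>)) \<partial>\<nu>)"
proof -
  have \<nu>: "radon_measure \<nu>" "integrable \<nu> (\<lambda>t. 1 / (t\<^sup>2 + 1))"
    using assms by (auto simp: herglotz_measure_def)
  have sets [measurable_cong]: "sets \<nu> = sets borel"
    using \<nu> by (simp add: radon_measure_def)
  obtain \<alpha> \<beta> where \<beta>: "\<beta> \<ge> (0::real)"
    and f: "\<And>z. Im z > 0 \<Longrightarrow> f z = of_real \<alpha> + of_real \<beta> * z
        + (\<integral>t. 1 / (of_real t - z) - of_real (t / (t\<^sup>2 + 1)) \<partial>\<nu>)"
    using assms unfolding herglotz_measure_def by blast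
  interpret sigma_finite_measure \<nu>
    by (rule radon_measure_sigma_finite) fact
  interpret pair_sigma_finite \<nu> lborel ..
  have Im_f: "ennreal (Im (f (Complex x \<epsilon>))) = ennreal (\<beta> * \<epsilon>) + (\<integral>\<^sup>+t. ennreal (\<epsilon> / ((t - x)\<^sup>2 + \<epsilon>\<^sup>2)) \<partial>\<nu>)"
    if "\<epsilon> > 0" for x \<epsilon>
  proof -
    have int: "integrable \<nu> (\<lambda>t. 1 / (of_real t - Complex x \<epsilon>) - of_real (t / (t\<^sup>2 + 1)))"
      using that \<nu> sets by (intro integrable_herglotz_kernel) auto
    have int': "integrable \<nu> (\<lambda>t. \<epsilon> / ((t - x)\<^sup>2 + \<epsilon>\<^sup>2))"
      using integrable_Im[OF int] unfolding Im_herglotz_kernel by simp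
    have "Im (f (Complex x \<epsilon>)) = \<beta> * \<epsilon> + (\<integral>t. \<epsilon> / ((t - x)\<^sup>2 + \<epsilon>\<^sup>2) \<partial>\<nu>)"
      using that integral_Im[OF int] unfolding Im_herglotz_kernel by (simp add: f)
    moreover have "(\<integral>\<^sup>+t. ennreal (\<epsilon> / ((t - x)\<^sup>2 + \<epsilon>\<^sup>2)) \<partial>\<nu>) = ennreal (\<integral>t. \<epsilon> / ((t - x)\<^sup>2 + \<epsilon>\<^sup>2) \<partial>\<nu>)"
      using int' that by (intro nn_integral_eq_integral) auto
    ultimately show ?thesis
      using \<beta> that by (simp add: ennreal_plus integral_nonneg_AE)
  qed
  have "(\<integral>\<^sup>+x. ennreal (Im (f (Complex x \<epsilon>))) * indicator {a..b} x \<partial>lborel) =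
      ennreal (\<beta> * \<epsilon> * (b - a)) + (\<integral>\<^sup>+t. ennreal (arctan ((b - t) / \<epsilon>) - arctan ((a - t) / \<epsilon>)) \<partial>\<nu>)"
    if "a \<le> b" "\<epsilon> > 0" for a b \<epsilon>
  proof -
    have "(\<integral>\<^sup>+x. ennreal (Im (f (Complex x \<epsilon>))) * indicator {a..b} x \<partial>lborel)
        = (\<integral>\<^sup>+x. ennreal (\<beta> * \<epsilon>) * indicator {a..b} x
            + (\<integral>\<^sup>+t. ennreal (\<epsilon> / ((t - x)\<^sup>2 + \<epsilon>\<^sup>2)) * indicator {a..b} x \<partial>\<nu>) \<partial>lborel)"
      unfolding Im_f[OF that(2)] by (simp add: distrib_right nn_integral_multc)
    also have "\<dots> = (\<integral>\<^sup>+x. ennreal (\<beta> * \<epsilon>) * indicator {a..b} x \<partial>lborel)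
        + (\<integral>\<^sup>+x. (\<integral>\<^sup>+t. ennreal (\<epsilon> / ((t - x)\<^sup>2 + \<epsilon>\<^sup>2)) * indicator {a..b} x \<partial>\<nu>) \<partial>lborel)"
      by (rule nn_integral_add) measurable
    also have "(\<integral>\<^sup>+x. ennreal (\<beta> * \<epsilon>) * indicator {a..b} x \<partial>lborel) = ennreal (\<beta> * \<epsilon> * (b - a))"
      using that \<beta> by (simp add: nn_integral_cmult_indicator ennreal_mult)
    also have "(\<integral>\<^sup>+x. (\<integral>\<^sup>+t. ennreal (\<epsilon> / ((t - x)\<^sup>2 + \<epsilon>\<^sup>2)) * indicator {a..b} x \<partial>\<nu>) \<partial>lborel)
        = (\<integral>\<^sup>+t. (\<integral>\<^sup>+x. ennreal (\<epsilon> / ((t - x)\<^sup>2 + \<epsilon>\<^sup>2)) * indicator {a..b} x \<partial>lborel) \<partial>\<nu>)"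
      by (rule Fubini') measurable
    also have "\<dots> = (\<integral>\<^sup>+t. ennreal (arctan ((b - t) / \<epsilon>) - arctan ((a - t) / \<epsilon>)) \<partial>\<nu>)"
      by (simp only: nn_integral_poisson_kernel[OF that(2,1)])
    finally show ?thesis .
  qed
  with \<beta> show ?thesis by (rule that)
qed

text \<open>A majorant uniform in \<delta>, for dominated convergence. For |t| \<le> r the
  difference is at most pi; for larger |t| the mean value theorem yields a Poisson kernel, and \<xi>
  + \<delta> stays within |t| / 2 by the choice of r.\<close>

lemma arctan_diff_bound:
  fixes a b :: real
  assumes "a < b"
  obtains C where "\<And>\<delta> t. 0 < \<delta> \<Longrightarrow> \<delta> \<le> 1 \<Longrightarrow>
    arctan ((b + \<delta> - t) / \<delta>\<^sup>2) - arctan ((a + \<delta> - t) / \<delta>\<^sup>2) \<le> C * (1 / (t\<^sup>2 + 1))"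
proof -
  obtain p where p: "0 \<le> p" "- p \<le> a" "b \<le> p"
    by (rule that[of "\<bar>a\<bar> + \<bar>b\<bar>"]) auto
  define r where "r = 2 * (p + 1)"
  \<comment> \<open>One summand for each case; the 8 comes from t^2 + 1 \<le> 2 t^2 \<le> 8 (\<xi> +
    \<delta> - t)^2, valid for |t| > r.\<close>
  define C where "C = pi * (r\<^sup>2 + 1) + 8 * (b - a)"
  have "arctan ((b + \<delta> - t) / \<delta>\<^sup>2) - arctan ((a + \<delta> - t) / \<delta>\<^sup>2) \<le> C / (t\<^sup>2 + 1)"
    if \<delta>: "0 < \<delta>" "\<delta> \<le> 1" for \<delta> t
  proof (cases "\<bar>t\<bar> \<le> r")
    case True
    then have "t\<^sup>2 \<le> r\<^sup>2"
      by (simp add: r_def abs_le_square_iff[symmetric])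
    then have "pi * (t\<^sup>2 + 1) \<le> pi * (r\<^sup>2 + 1)"
      by (intro mult_left_mono) auto
    then have "pi * (t\<^sup>2 + 1) \<le> C"
      unfolding C_def using assms by (intro add_increasing2) auto
    then have "pi \<le> C / (t\<^sup>2 + 1)"
      by (simp add: pos_le_divide_eq add_nonneg_pos)
    then show ?thesis
      using arctan_ubound[of "(b + \<delta> - t) / \<delta>\<^sup>2"] arctan_lbound[of "(a + \<delta> - t) / \<delta>\<^sup>2"] by linarith
  next
    case False
    have deriv: "((\<lambda>x. arctan ((x + \<delta> - t) / \<delta>\<^sup>2)) has_field_derivative \<delta>\<^sup>2 / ((x + \<delta> - t)\<^sup>2 + (\<delta>\<^sup>2)\<^sup>2)) (at x)" for x
      using DERIV_arctan_scaled[of "\<delta>\<^sup>2" "t - \<delta>" x] \<delta> by (simp add: diff_diff_eq2)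
    have "\<exists>\<xi>>a. \<xi> < b \<and> arctan ((b + \<delta> - t) / \<delta>\<^sup>2) - arctan ((a + \<delta> - t) / \<delta>\<^sup>2)
        = (b - a) * (\<delta>\<^sup>2 / ((\<xi> + \<delta> - t)\<^sup>2 + (\<delta>\<^sup>2)\<^sup>2))"
      by (rule MVT2[OF assms]) (rule deriv)
    then obtain \<xi> where \<xi>: "a < \<xi>" "\<xi> < b" "arctan ((b + \<delta> - t) / \<delta>\<^sup>2) - arctan ((a + \<delta> - t) / \<delta>\<^sup>2)
        = (b - a) * (\<delta>\<^sup>2 / ((\<xi> + \<delta> - t)\<^sup>2 + (\<delta>\<^sup>2)\<^sup>2))"
      by blast
    have "\<bar>\<xi> + \<delta>\<bar> \<le> p + 1"
      using \<xi>(1,2) \<delta> p by (intro abs_leI) linarith+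
    with False have "\<bar>\<xi> + \<delta>\<bar> \<le> \<bar>t\<bar> / 2"
      by (simp add: r_def)
    then have "\<bar>t\<bar> / 2 \<le> \<bar>\<xi> + \<delta> - t\<bar>"
      by linarith
    then have "(t / 2)\<^sup>2 \<le> (\<xi> + \<delta> - t)\<^sup>2"
      by (simp add: abs_le_square_iff[symmetric])
    moreover have "\<bar>1\<bar> \<le> \<bar>t\<bar>"
      using False p(1) by (simp add: r_def)
    then have "1\<^sup>2 \<le> t\<^sup>2"
      by (simp only: abs_le_square_iff)
    moreover have "(t / 2)\<^sup>2 = t\<^sup>2 / 4" "0 \<le> (\<delta>\<^sup>2)\<^sup>2"
      by (simp_all add: power_divide)
    ultimately have "t\<^sup>2 \<le> 4 * (\<xi> + \<delta> - t)\<^sup>2" "1 \<le> t\<^sup>2" "0 \<le> (\<delta>\<^sup>2)\<^sup>2"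
      by simp_all
    then have "t\<^sup>2 + 1 \<le> 8 * ((\<xi> + \<delta> - t)\<^sup>2 + (\<delta>\<^sup>2)\<^sup>2)"
      unfolding distrib_left by linarith
    then have *: "(t\<^sup>2 + 1) / 8 \<le> (\<xi> + \<delta> - t)\<^sup>2 + (\<delta>\<^sup>2)\<^sup>2"
      by (subst pos_divide_le_eq) (simp_all add: mult.commute)
    have "\<delta>\<^sup>2 \<le> 1"
      using \<delta> by (simp add: power_le_one)
    then have "\<delta>\<^sup>2 / ((\<xi> + \<delta> - t)\<^sup>2 + (\<delta>\<^sup>2)\<^sup>2) \<le> 1 / ((t\<^sup>2 + 1) / 8)"
      using * by (intro frac_le) (auto intro: add_nonneg_pos)
    then have "(b - a) * (\<delta>\<^sup>2 / ((\<xi> + \<delta> - t)\<^sup>2 + (\<delta>\<^sup>2)\<^sup>2)) \<le> (b - a) * (1 / ((t\<^sup>2 + 1) / 8))"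
      using assms by (intro mult_left_mono) auto
    also have "\<dots> = 8 * (b - a) / (t\<^sup>2 + 1)"
      by (simp only: times_divide_eq_right divide_divide_eq_right mult_1_right mult_1_left mult.commute)
    also have "\<dots> \<le> C / (t\<^sup>2 + 1)"
      unfolding C_def by (intro divide_right_mono) auto
    finally show ?thesis
      using \<xi>(3) by simp
  qed
  then show ?thesis
    by (intro that[of C]) simp
qed

text \<open>With k = \<open>Suc n\<close> the argument is k ((u - t) k + 1). For t \<le> u it is at
  least k, even at t = u, so u falls on the left side of the step; for t > u the negative quadratic
  term wins.\<close>

lemma tendsto_arctan_step:
  fixes u t :: real
  shows "(\<lambda>n. arctan ((u + 1 / real (Suc n) - t) / (1 / real (Suc n))\<^sup>2))
    \<longlonglongrightarrow> (if t \<le> u then pi / 2 else - (pi / 2))"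
proof -
  have eq: "(u + 1 / real (Suc n) - t) / (1 / real (Suc n))\<^sup>2 = real (Suc n) * ((u - t) * real (Suc n) + 1)" for n
  proof -
    have "(u + 1 / k - t) / (1 / k)\<^sup>2 = k * ((u - t) * k + 1)" if "k \<noteq> 0" for k :: real
      using that by (simp add: divide_simps power2_eq_square) (simp add: algebra_simps)
    then show ?thesis by simp
  qed
  have S: "filterlim (\<lambda>n. real (Suc n)) at_top sequentially"
    by (rule filterlim_compose[OF filterlim_real_sequentially filterlim_Suc])
  show ?thesis
  proof (cases "t \<le> u")
    case True
    have "filterlim (\<lambda>n. real (Suc n) * ((u - t) * real (Suc n) + 1)) at_top sequentially"
    proof (rule filterlim_at_top_mono[OF S])
      show "\<forall>\<^sub>F n in sequentially. real (Suc n) \<le> real (Suc n) * ((u - t) * real (Suc n) + 1)"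
        using True by (intro always_eventually allI) (simp only: mult_le_cancel_left1, simp)
    qed
    then show ?thesis
      unfolding eq using True filterlim_compose[OF tendsto_arctan_at_top] by auto
  next
    case False
    have "filterlim (\<lambda>n. - (real (Suc n) * ((u - t) * real (Suc n) + 1))) at_top sequentially"
    proof (rule filterlim_at_top_mono[OF S])
      have "\<forall>\<^sub>F n in sequentially. 2 / (t - u) \<le> real (Suc n)"
        using S by (simp add: filterlim_at_top)
      then show "\<forall>\<^sub>F n in sequentially. real (Suc n) \<le> - (real (Suc n) * ((u - t) * real (Suc n) + 1))"
      proof eventually_elim
        case (elim n)
        then have "1 \<le> - ((u - t) * real (Suc n) + 1)"
          using False by (simp add: field_simps)
        then have "real (Suc n) * 1 \<le> real (Suc n) * (- ((u - t) * real (Suc n) + 1))"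
          by (rule mult_left_mono) simp
        then show ?case by (simp only: mult_1_right mult_minus_right)
      qed
    qed
    then have "filterlim (\<lambda>n. real (Suc n) * ((u - t) * real (Suc n) + 1)) at_bot sequentially"
      by (simp add: filterlim_uminus_at_top)
    then show ?thesis
      unfolding eq using False filterlim_compose[OF tendsto_arctan_at_bot] by auto
  qed
qed

text \<open>Stieltjes inversion. The shift of the interval by \<open>1/n\<close>, large compared with the height
  \<open>1/n\<^sup>2\<close>, makes the limit a half-open interval whatever the mass at the endpoints.\<close>

lemma herglotz_measure_Ioc:
  assumes "herglotz_measure f \<nu>" "a < b"
  shows "(\<lambda>n. \<integral>\<^sup>+x. ennreal (Im (f (Complex x ((1 / real (Suc n))\<^sup>2))))
      * indicator {a + 1 / real (Suc n)..b + 1 / real (Suc n)} x \<partial>lborel)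
    \<longlonglongrightarrow> ennreal (pi * measure \<nu> {a<..b})"
proof -
  define \<delta> where "\<delta> n = 1 / real (Suc n)" for n
  have \<delta>: "0 < \<delta> n" "\<delta> n \<le> 1" for n
    by (auto simp: \<delta>_def)
  have \<nu>: "radon_measure \<nu>" "integrable \<nu> (\<lambda>t. 1 / (t\<^sup>2 + 1))"
    using assms by (auto simp: herglotz_measure_def)
  have sets [measurable_cong]: "sets \<nu> = sets borel"
    using \<nu> by (simp add: radon_measure_def)
  obtain \<beta> where \<beta>: "\<beta> \<ge> 0" "\<And>a b \<epsilon>. a \<le> b \<Longrightarrow> \<epsilon> > 0 \<Longrightarrow>
    (\<integral>\<^sup>+x. ennreal (Im (f (Complex x \<epsilon>))) * indicator {a..b} x \<partial>lborel) =
      ennreal (\<beta> * \<epsilon> * (b - a)) + (\<integral>\<^sup>+t. ennreal (arctan ((b - t) / \<epsilon>) - arctan ((a - t) / \<epsilon>)) \<partial>\<nu>)"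
    by (rule herglotz_boundary_integral[OF assms(1)]) (rule that)
  obtain C where C: "\<And>\<delta> t. 0 < \<delta> \<Longrightarrow> \<delta> \<le> 1 \<Longrightarrow>
    arctan ((b + \<delta> - t) / \<delta>\<^sup>2) - arctan ((a + \<delta> - t) / \<delta>\<^sup>2) \<le> C * (1 / (t\<^sup>2 + 1))"
    by (rule arctan_diff_bound[OF assms(2)]) (rule that)
  define A where "A n t = arctan ((b + \<delta> n - t) / (\<delta> n)\<^sup>2) - arctan ((a + \<delta> n - t) / (\<delta> n)\<^sup>2)" for n t
  have A_nonneg: "0 \<le> A n t" for n t
    unfolding A_def using \<delta>[of n] assms(2) by (auto simp: arctan_le_iff divide_right_mono)
  have A_bound: "AE t in \<nu>. norm (A n t) \<le> C * (1 / (t\<^sup>2 + 1))" for n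
    using C[OF \<delta>] A_nonneg unfolding A_def by simp
  have [measurable]: "A n \<in> borel_measurable \<nu>" for n
    unfolding A_def[abs_def] by measurable
  have int_bound: "integrable \<nu> (\<lambda>t. C * (1 / (t\<^sup>2 + 1)))"
    by (intro integrable_mult_right \<nu>)
  have A_lim: "(\<lambda>n. A n t) \<longlonglongrightarrow> pi * indicator {a<..b} t" for t
    using tendsto_diff[OF tendsto_arctan_step[of b t] tendsto_arctan_step[of a t]] assms(2)
    unfolding A_def \<delta>_def by (auto simp: indicator_def split: if_splits)
  have "(\<lambda>n. \<integral>t. A n t \<partial>\<nu>) \<longlonglongrightarrow> (\<integral>t. pi * indicator {a<..b} t \<partial>\<nu>)"
    by (rule integral_dominated_convergence[OF _ _ int_bound]) (use A_lim A_bound in auto)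
  moreover have "(\<integral>t. pi * indicator {a<..b} t \<partial>\<nu>) = pi * measure \<nu> {a<..b}"
    using sets_eq_imp_space_eq[OF sets] by simp
  moreover have "(\<lambda>n. \<beta> * (\<delta> n)\<^sup>2 * (b - a)) \<longlonglongrightarrow> 0"
  proof -
    have "\<delta> \<longlonglongrightarrow> 0"
      unfolding \<delta>_def[abs_def] by (rule LIMSEQ_Suc[OF lim_1_over_n])
    from tendsto_mult[OF tendsto_mult[OF tendsto_const[of \<beta>] tendsto_power[OF this, of 2]] tendsto_const[of "b - a"]]
    show ?thesis by simp
  qed
  ultimately have "(\<lambda>n. \<beta> * (\<delta> n)\<^sup>2 * (b - a) + (\<integral>t. A n t \<partial>\<nu>)) \<longlonglongrightarrow> 0 + pi * measure \<nu> {a<..b}"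
    by (metis tendsto_add)
  then have "(\<lambda>n. ennreal (\<beta> * (\<delta> n)\<^sup>2 * (b - a) + (\<integral>t. A n t \<partial>\<nu>))) \<longlonglongrightarrow> ennreal (pi * measure \<nu> {a<..b})"
    by (simp add: tendsto_ennrealI)
  moreover have "(\<integral>\<^sup>+x. ennreal (Im (f (Complex x ((\<delta> n)\<^sup>2)))) * indicator {a + \<delta> n..b + \<delta> n} x \<partial>lborel)
      = ennreal (\<beta> * (\<delta> n)\<^sup>2 * (b - a) + (\<integral>t. A n t \<partial>\<nu>))" for n
  proof -
    have "integrable \<nu> (A n)"
    proof (rule Bochner_Integration.integrable_bound[OF int_bound])
      show "AE t in \<nu>. norm (A n t) \<le> norm (C * (1 / (t\<^sup>2 + 1)))"
        using A_bound[of n] by (rule eventually_mono) (metis order_trans abs_ge_self real_norm_def)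
    qed measurable
    then have "(\<integral>\<^sup>+t. ennreal (A n t) \<partial>\<nu>) = ennreal (\<integral>t. A n t \<partial>\<nu>)"
      using A_nonneg by (intro nn_integral_eq_integral) auto
    then show ?thesis
      using \<beta>(1) \<delta>[of n] assms(2) A_nonneg[of n] unfolding A_def
      by (subst \<beta>(2)) (auto intro!: ennreal_plus[symmetric] integral_nonneg)
  qed
  ultimately show ?thesis
    unfolding \<delta>_def by simp
qed

text \<open>The sequence in \<open>herglotz_measure_Ioc\<close> depends on f alone, so the two
  measures agree on all half-open intervals, an intersection-stable generator exhausted by sets of
  finite measure.\<close>

theorem herglotz_measure_unique:
  assumes "herglotz_measure f \<mu>" "herglotz_measure f \<nu>"
  shows "\<mu> = \<nu>"
proof (rule measure_eqI_generator_eq[where E = "range (\<lambda>(a, b). {a<..b::real})" and \<Omega> = UNIV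
      and A = "\<lambda>n. {- real n<..real n}"])
  have radon: "radon_measure \<mu>" "radon_measure \<nu>"
    using assms by (auto simp: herglotz_measure_def)
  have fin: "emeasure \<xi> {a<..b} < \<infinity>" if "radon_measure \<xi>" for \<xi> and a b :: real
  proof -
    have "emeasure \<xi> {a<..b} \<le> emeasure \<xi> {a..b}"
      using that by (intro emeasure_mono) (auto simp: radon_measure_def)
    also have "\<dots> < \<infinity>"
      using that by (simp add: radon_measure_def)
    finally show ?thesis .
  qed
  show "Int_stable (range (\<lambda>(a, b). {a<..b::real}))"
    by (auto simp: Int_stable_def image_iff Int_greaterThanAtMost)
  show "sets \<mu> = sigma_sets UNIV (range (\<lambda>(a, b). {a<..b::real}))"
    "sets \<nu> = sigma_sets UNIV (range (\<lambda>(a, b). {a<..b::real}))"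
    using radon by (simp_all add: radon_measure_def borel_sigma_sets_Ioc)
  show "(\<Union>n. {- real n<..real n}) = UNIV"
  proof safe
    fix x :: real
    obtain n where "\<bar>x\<bar> < real n"
      using reals_Archimedean2 by blast
    then show "x \<in> (\<Union>n. {- real n<..real n})"
      by (auto intro!: exI[of _ n])
  qed auto
  show "emeasure \<mu> {- real n<..real n} \<noteq> \<infinity>" for n
    using fin[OF radon(1)] by (simp add: less_top[symmetric])
  show "emeasure \<mu> X = emeasure \<nu> X" if X: "X \<in> range (\<lambda>(a, b). {a<..b::real})" for X
  proof -
    obtain a b where X: "X = {a<..b}"
      using X by auto
    show ?thesis
    proof (cases "a < b")
      case True
      have "ennreal (pi * measure \<mu> X) = ennreal (pi * measure \<nu> X)"
        using herglotz_measure_Ioc[OF assms(1) True] herglotz_measure_Ioc[OF assms(2) True]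
        unfolding X by (rule LIMSEQ_unique)
      then have "measure \<mu> X = measure \<nu> X"
        by simp
      then show ?thesis
        using fin[OF radon(1), of a b] fin[OF radon(2), of a b]
        by (simp add: X emeasure_eq_ennreal_measure less_top[symmetric])
    qed (simp add: X)
  qed
qed (auto simp: )


section \<open>Measures with a density on the positive and atoms on the negative half-line\<close>

definition add_measure :: "'a measure \<Rightarrow> 'a measure \<Rightarrow> 'a measure" where
  "add_measure \<mu> \<nu> = measure_of (space \<mu>) (sets \<mu>) (\<lambda>A. emeasure \<mu> A + emeasure \<nu> A)"

lemma space_add_measure [simp]: "space (add_measure \<mu> \<nu>) = space \<mu>"
  and sets_add_measure [simp, measurable_cong]: "sets (add_measure \<mu> \<nu>) = sets \<mu>"
  by (simp_all add: add_measure_def)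

lemma emeasure_add_measure:
  assumes "sets \<nu> = sets \<mu>" "A \<in> sets \<mu>"
  shows "emeasure (add_measure \<mu> \<nu>) A = emeasure \<mu> A + emeasure \<nu> A"
  unfolding add_measure_def
proof (rule emeasure_measure_of_sigma)
  show "sigma_algebra (space \<mu>) (sets \<mu>)" ..
  show "positive (sets \<mu>) (\<lambda>A. emeasure \<mu> A + emeasure \<nu> A)"
    by (simp add: positive_def)
  show "countably_additive (sets \<mu>) (\<lambda>A. emeasure \<mu> A + emeasure \<nu> A)"
  proof (rule countably_additiveI)
    fix F :: "nat \<Rightarrow> _"
    assume F: "range F \<subseteq> sets \<mu>" "disjoint_family F"
    have "(\<Sum>i. emeasure \<mu> (F i) + emeasure \<nu> (F i)) = (\<Sum>i. emeasure \<mu> (F i)) + (\<Sum>i. emeasure \<nu> (F i))"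
      by (rule suminf_add[symmetric]) auto
    then show "(\<Sum>i. emeasure \<mu> (F i) + emeasure \<nu> (F i)) = emeasure \<mu> (\<Union>(range F)) + emeasure \<nu> (\<Union>(range F))"
      using F assms(1) by (simp add: suminf_emeasure)
  qed
qed fact

text \<open>The weights live on \<open>count_space S\<close>, where every subset is measurable;
  \<open>distr\<close> along the identity carries them to the Borel sets of the line.\<close>

definition density_plus_atoms :: "(real \<Rightarrow> real) \<Rightarrow> real set \<Rightarrow> (real \<Rightarrow> real) \<Rightarrow> real measure" where
  "density_plus_atoms t S w = add_measure (density lborel t)
     (distr (density (count_space S) w) borel (\<lambda>x. x))"

text \<open>Finiteness of \<open>S\<close> is asked only away from 0 and from minus infinity, since
  the atoms may accumulate at both. Hence local finiteness of the measure at 0 is not part of the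
  setting and is proved separately in \<open>radon_\<nu>\<close>.\<close>

locale density_and_atoms =
  fixes t :: "real \<Rightarrow> real" and S :: "real set" and w :: "real \<Rightarrow> real"
  assumes t_measurable [measurable]: "t \<in> borel_measurable borel"
    and t_nonneg: "0 \<le> t x"
    and t_zero: "x \<le> 0 \<Longrightarrow> t x = 0"
    and t_continuous: "continuous_on {0<..} t"
    and S_neg: "S \<subseteq> {..<0}"
    and S_finite: "0 < a \<Longrightarrow> finite (S \<inter> {- b..- a})"
    and w_pos: "x \<in> S \<Longrightarrow> 0 < w x"
begin

definition \<nu> :: "real measure" where
  "\<nu> = density_plus_atoms t S w"

lemma sets_\<nu> [simp, measurable_cong]: "sets \<nu> = sets borel"
  by (simp add: \<nu>_def density_plus_atoms_def)

lemma space_\<nu> [simp]: "space \<nu> = UNIV"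
  by (simp add: \<nu>_def density_plus_atoms_def)

lemma emeasure_\<nu>:
  assumes "A \<in> sets borel"
  shows "emeasure \<nu> A = (\<integral>\<^sup>+x. ennreal (t x) * indicator A x \<partial>lborel)
    + (\<integral>\<^sup>+x. ennreal (w x) * indicator (A \<inter> S) x \<partial>count_space S)"
proof -
  have "emeasure (distr (density (count_space S) w) borel (\<lambda>x. x)) A = emeasure (density (count_space S) w) (A \<inter> S)"
    using assms by (subst emeasure_distr) auto
  also have "\<dots> = (\<integral>\<^sup>+x. ennreal (w x) * indicator (A \<inter> S) x \<partial>count_space S)"
    by (rule emeasure_density) auto
  finally show ?thesis
    using assms unfolding \<nu>_def density_plus_atoms_def
    by (subst emeasure_add_measure) (auto simp: emeasure_density)
qed

lemma emeasure_\<nu>_disjoint: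
  assumes "A \<in> sets borel" "A \<inter> S = {}"
  shows "emeasure \<nu> A = (\<integral>\<^sup>+x. ennreal (t x) * indicator A x \<partial>lborel)"
  using assms by (simp add: emeasure_\<nu>)

lemma emeasure_\<nu>_negative:
  assumes "A \<in> sets borel" "A \<inter> S = {}" "A \<subseteq> {..0}"
  shows "emeasure \<nu> A = 0"
proof -
  have "(\<integral>\<^sup>+x. ennreal (t x) * indicator A x \<partial>lborel) = nn_integral lborel (\<lambda>x::real. 0)"
    using assms by (intro nn_integral_cong) (auto simp: indicator_def t_zero)
  with assms show ?thesis
    by (simp add: emeasure_\<nu>_disjoint)
qed

lemma emeasure_\<nu>_singleton: "emeasure \<nu> {x} = (if x \<in> S then ennreal (w x) else 0)"
proof -
  have "AE y in lborel. ennreal (t y) * indicator {x} y = 0"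
    using AE_lborel_singleton[of x] by (rule AE_mp) auto
  then have "(\<integral>\<^sup>+y. ennreal (t y) * indicator {x} y \<partial>lborel) = 0"
    by (subst nn_integral_0_iff_AE) auto
  moreover have "(\<integral>\<^sup>+y. ennreal (w y) * indicator {x} y \<partial>count_space S) = ennreal (w x)" if "x \<in> S"
    using that by (simp add: nn_integral_indicator_singleton)
  ultimately show ?thesis
    by (simp add: emeasure_\<nu>)
qed

lemma atoms_\<nu>: "atoms \<nu> = S"
  using w_pos by (auto simp: atoms_def emeasure_\<nu>_singleton)

lemma S_borel [measurable]: "S \<in> sets borel"
proof -
  have "S \<subseteq> (\<Union>n. S \<inter> {- real n..- (1 / real (Suc n))})"
  proof
    fix x assume x: "x \<in> S"
    then have "x < 0" using S_neg by auto
    obtain n1 where n1: "- x \<le> real n1"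
      using real_arch_simple by blast
    obtain n2 where n2: "1 / real (Suc n2) < - x"
      using \<open>x < 0\<close> nat_approx_posE[of "- x"] by auto
    define n where "n = max n1 n2"
    have "1 / real (Suc n) \<le> 1 / real (Suc n2)"
      unfolding n_def by (intro divide_left_mono) auto
    moreover have "real n1 \<le> real n"
      unfolding n_def by simp
    ultimately have "x \<in> {- real n..- (1 / real (Suc n))}"
      using n1 n2 by auto
    then show "x \<in> (\<Union>n. S \<inter> {- real n..- (1 / real (Suc n))})"
      using x by blast
  qed
  moreover have "countable (\<Union>n. S \<inter> {- real n..- (1 / real (Suc n))})"
    by (rule countable_UN, simp, rule countable_finite, rule S_finite) simp
  ultimately have "countable S"
    by (rule countable_subset)
  then show ?thesis
    by (rule sets.countable[rotated]) auto
qed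

lemma continuous_part_\<nu>: "continuous_part \<nu> = density lborel (\<lambda>x. ennreal (t x))"
proof (rule measure_eqI)
  show "sets (continuous_part \<nu>) = sets (density lborel (\<lambda>x. ennreal (t x)))"
    by (simp add: continuous_part_def)
  fix A assume "A \<in> sets (continuous_part \<nu>)"
  then have A [measurable]: "A \<in> sets borel"
    by (simp add: continuous_part_def)
  have "emeasure (continuous_part \<nu>) A = (\<integral>\<^sup>+x. (1 - indicator S x) * indicator A x \<partial>\<nu>)"
    unfolding continuous_part_def atoms_\<nu> by (rule emeasure_density) auto
  also have "\<dots> = (\<integral>\<^sup>+x. indicator (A - S) x \<partial>\<nu>)"
    by (intro nn_integral_cong) (auto simp: indicator_def)
  also have "\<dots> = emeasure \<nu> (A - S)"
    by (rule nn_integral_indicator) auto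
  also have "\<dots> = (\<integral>\<^sup>+x. ennreal (t x) * indicator (A - S) x \<partial>lborel)"
    by (rule emeasure_\<nu>_disjoint) auto
  also have "\<dots> = (\<integral>\<^sup>+x. ennreal (t x) * indicator A x \<partial>lborel)"
    using S_neg t_zero by (intro nn_integral_cong) (force simp: indicator_def)
  also have "\<dots> = emeasure (density lborel (\<lambda>x. ennreal (t x))) A"
    by (rule emeasure_density[symmetric]) auto
  finally show "emeasure (continuous_part \<nu>) A = emeasure (density lborel (\<lambda>x. ennreal (t x))) A" .
qed

lemma integral_\<nu>_positive:
  fixes g :: "real \<Rightarrow> complex"
  assumes g: "continuous_on UNIV g" and "0 < a"
  shows "set_integrable \<nu> {a..b} g"
    and "(LINT x:{a..b}|\<nu>. g x) = integral {a..b} (\<lambda>x. t x *\<^sub>R g x)"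
proof -
  have [measurable]: "g \<in> borel_measurable borel"
    by (rule borel_measurable_continuous_onI) fact
  \<comment> \<open>All atoms are negative, so on [a, b] the measure is its density alone; both
    claims are then transferred through this common restriction.\<close>
  have dens: "density \<nu> (indicator {a..b} :: real \<Rightarrow> real) = density lborel (\<lambda>x. indicator {a..b} x * t x)"
  proof (rule measure_eqI)
    fix A assume "A \<in> sets (density \<nu> (indicator {a..b} :: real \<Rightarrow> real))"
    then have [measurable]: "A \<in> sets borel" by simp
    have "emeasure (density \<nu> (indicator {a..b} :: real \<Rightarrow> real)) A = (\<integral>\<^sup>+x. ennreal (indicator {a..b} x) * indicator A x \<partial>\<nu>)"
      by (rule emeasure_density) auto
    also have "\<dots> = (\<integral>\<^sup>+x. indicator (A \<inter> {a..b}) x \<partial>\<nu>)"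
      by (rule nn_integral_cong) (simp split: split_indicator)
    also have "\<dots> = emeasure \<nu> (A \<inter> {a..b})"
      by (rule nn_integral_indicator) auto
    also have "\<dots> = (\<integral>\<^sup>+x. ennreal (t x) * indicator (A \<inter> {a..b}) x \<partial>lborel)"
      using S_neg \<open>0 < a\<close> by (intro emeasure_\<nu>_disjoint) force+
    also have "\<dots> = emeasure (density lborel (\<lambda>x. indicator {a..b} x * t x)) A"
      by (subst emeasure_density) (auto intro!: nn_integral_cong simp: indicator_def)
    finally show "emeasure (density \<nu> (indicator {a..b} :: real \<Rightarrow> real)) A
      = emeasure (density lborel (\<lambda>x. indicator {a..b} x * t x)) A" .
  qed simp
  have "continuous_on {a..b} (\<lambda>x. t x *\<^sub>R g x)"
    using \<open>0 < a\<close> by (intro continuous_on_scaleR continuous_on_subset[OF t_continuous] continuous_on_subset[OF g]) auto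
  then have int: "set_integrable lborel {a..b} (\<lambda>x. t x *\<^sub>R g x)"
    by (rule borel_integrable_atLeastAtMost')
  have "integrable \<nu> (\<lambda>x. indicator {a..b} x *\<^sub>R g x) \<longleftrightarrow> integrable (density \<nu> (indicator {a..b} :: real \<Rightarrow> real)) g"
    by (subst integrable_density) auto
  also have "\<dots> \<longleftrightarrow> integrable lborel (\<lambda>x. (indicator {a..b} x * t x) *\<^sub>R g x)"
    unfolding dens by (subst integrable_density) (auto simp: t_nonneg)
  finally show "set_integrable \<nu> {a..b} g"
    using int by (simp add: set_integrable_def)
  have "(LINT x:{a..b}|\<nu>. g x) = integral\<^sup>L (density \<nu> (indicator {a..b} :: real \<Rightarrow> real)) g"
    unfolding set_lebesgue_integral_def by (subst integral_density) auto
  also have "\<dots> = (LINT x:{a..b}|lborel. t x *\<^sub>R g x)"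
    unfolding dens set_lebesgue_integral_def by (subst integral_density) (auto simp: t_nonneg)
  finally show "(LINT x:{a..b}|\<nu>. g x) = integral {a..b} (\<lambda>x. t x *\<^sub>R g x)"
    by (simp add: set_borel_integral_eq_integral(2)[OF int])
qed

text \<open>The density vanishes on the negative half-line and only finitely many atoms lie in the
  interval, so off these points the interval is null and the integrand is almost everywhere a finite
  sum.\<close>

lemma integral_\<nu>_negative:
  fixes g :: "real \<Rightarrow> complex"
  assumes g: "continuous_on UNIV g" and "0 < a"
  shows "set_integrable \<nu> {- b..- a} g"
    and "(LINT x:{- b..- a}|\<nu>. g x) = (\<Sum>x\<in>S \<inter> {- b..- a}. w x *\<^sub>R g x)"
proof -
  have [measurable]: "g \<in> borel_measurable borel"
    by (rule borel_measurable_continuous_onI) fact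
  define F where "F = S \<inter> {- b..- a}"
  have F: "finite F"
    unfolding F_def by (rule S_finite) fact
  have "emeasure \<nu> ({- b..- a} - F) = 0"
    using F \<open>0 < a\<close> by (intro emeasure_\<nu>_negative) (auto simp: F_def)
  then have null: "{- b..- a} - F \<in> null_sets \<nu>"
    using borel_closed[OF finite_imp_closed[OF F]] by (auto simp: null_sets_def)
  have eq: "indicator {- b..- a} x *\<^sub>R g x = (\<Sum>y\<in>F. indicator {y} x *\<^sub>R g y)"
    if "x \<notin> {- b..- a} - F" for x
  proof (cases "x \<in> F")
    case True
    then have "(\<Sum>y\<in>F. indicator {y} x *\<^sub>R g y) = (\<Sum>y\<in>F. if y = x then g y else 0)"
      by (intro sum.cong) (auto simp: indicator_def)
    with True F show ?thesis
      by (simp add: F_def)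
  next
    case False
    then have "(\<Sum>y\<in>F. indicator {y} x *\<^sub>R g y) = 0"
      by (intro sum.neutral) (auto simp: indicator_def)
    with False that show ?thesis
      by (auto simp: indicator_def)
  qed
  have AE: "AE x in \<nu>. indicator {- b..- a} x *\<^sub>R g x = (\<Sum>y\<in>F. indicator {y} x *\<^sub>R g y)"
    using AE_not_in[OF null] by (rule eventually_mono) (rule eq)
  have fin: "emeasure \<nu> {y} < \<infinity>" for y
    by (simp add: emeasure_\<nu>_singleton)
  then have int: "integrable \<nu> (\<lambda>x. indicator {y} x *\<^sub>R g y)" for y
    by (intro integrable_scaleR_left integrable_real_indicator) auto
  show "set_integrable \<nu> {- b..- a} g"
    unfolding set_integrable_def
    by (subst integrable_cong_AE[OF _ _ AE]) (auto intro!: int)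
  have "(LINT x:{- b..- a}|\<nu>. g x) = (\<integral>x. (\<Sum>y\<in>F. indicator {y} x *\<^sub>R g y) \<partial>\<nu>)"
    unfolding set_lebesgue_integral_def by (rule integral_cong_AE[OF _ _ AE]) auto
  also have "\<dots> = (\<Sum>y\<in>F. \<integral>x. indicator {y} x *\<^sub>R g y \<partial>\<nu>)"
    by (rule Bochner_Integration.integral_sum) (rule int)
  also have "\<dots> = (\<Sum>y\<in>F. w y *\<^sub>R g y)"
  proof (rule sum.cong)
    fix y assume y: "y \<in> F"
    have "(\<integral>x. indicator {y} x *\<^sub>R g y \<partial>\<nu>) = measure \<nu> {y} *\<^sub>R g y"
      using fin[of y] by (subst integral_scaleR_left) auto
    also have "measure \<nu> {y} = w y"
      using y w_pos[of y] by (simp add: measure_def emeasure_\<nu>_singleton F_def)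
    finally show "(\<integral>x. indicator {y} x *\<^sub>R g y \<partial>\<nu>) = w y *\<^sub>R g y" .
  qed simp
  finally show "(LINT x:{- b..- a}|\<nu>. g x) = (\<Sum>x\<in>S \<inter> {- b..- a}. w x *\<^sub>R g x)"
    by (simp add: F_def)
qed

lemma integral_\<nu>_annulus:
  fixes g :: "real \<Rightarrow> complex"
  assumes g: "continuous_on UNIV g" and "0 < a"
  shows "set_integrable \<nu> ({a..b} \<union> {- b..- a}) g"
    and "(LINT x:{a..b} \<union> {- b..- a}|\<nu>. g x)
      = integral {a..b} (\<lambda>x. t x *\<^sub>R g x) + (\<Sum>x\<in>S \<inter> {- b..- a}. w x *\<^sub>R g x)"
  using integral_\<nu>_positive[OF assms] integral_\<nu>_negative[OF assms] \<open>0 < a\<close>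
  by (auto intro!: set_integrable_Un set_integral_Un[THEN trans])

end


section \<open>Uniformization of the slit plane\<close>

lemma residue_simple_zero:
  assumes "open U" "z \<in> U" "f holomorphic_on U" "g holomorphic_on U - {z}"
    and "g z = 0" "(g has_field_derivative g') (at z)" "g' \<noteq> 0" "\<And>w. w \<in> U - {z} \<Longrightarrow> g w \<noteq> 0"
  shows "residue (\<lambda>w. f w / g w) z = f z / g'"
proof (rule residue_simple'[OF assms(1,2)])
  show "(\<lambda>w. f w / g w) holomorphic_on U - {z}"
    using assms by (intro holomorphic_intros) (auto intro: holomorphic_on_subset)
  have "f \<midarrow>z\<rightarrow> f z"
    using assms by (meson holomorphic_on_imp_continuous_on continuous_on_eq_continuous_at isContD)
  moreover have "(\<lambda>w. (g w - g z) / (w - z)) \<midarrow>z\<rightarrow> g'"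
    using assms(6) by (simp add: has_field_derivative_iff)
  ultimately have "(\<lambda>w. f w / ((g w - g z) / (w - z))) \<midarrow>z\<rightarrow> f z / g'"
    by (intro tendsto_divide assms)
  then show "(\<lambda>w. f w / g w * (w - z)) \<midarrow>z\<rightarrow> f z / g'"
    by (simp add: assms(5))
qed

lemma contour_integral_horizontal:
  fixes f :: "complex \<Rightarrow> complex"
  assumes "Y \<le> X" and cont: "continuous_on {Y..X} (\<lambda>x. f (Complex x b))"
  shows "contour_integral (linepath (Complex Y b) (Complex X b)) f = integral {Y..X} (\<lambda>x. f (Complex x b))"
proof -
  define u where "u t = Y + (X - Y) * t" for t
  have "((\<lambda>t. (X - Y) *\<^sub>R f (Complex (u t) b)) has_integral
      integral {u 0..u 1} (\<lambda>x. f (Complex x b))) {0..1}"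
  proof (rule has_integral_substitution[where c = Y and d = X])
    have "(X - Y) * t \<le> (X - Y) * 1" if "t \<le> 1" for t
      using that assms(1) by (intro mult_left_mono) auto
    then show "u ` {0..1} \<subseteq> {Y..X}"
      using assms(1) by (auto simp: u_def) (smt (verit))
    show "(u has_field_derivative X - Y) (at t within {0..1})" for t
      unfolding u_def by (auto intro!: derivative_eq_intros)
  qed (use assms in \<open>auto simp: u_def\<close>)
  moreover have "linepath (Complex Y b) (Complex X b) t = Complex (u t) b" for t
    by (simp add: linepath_def u_def complex_eq_iff algebra_simps)
  moreover have "Complex X b - Complex Y b = of_real (X - Y)"
    by (simp add: complex_eq_iff)
  ultimately have "((\<lambda>t. f (linepath (Complex Y b) (Complex X b) t) * (Complex X b - Complex Y b))
      has_integral integral {Y..X} (\<lambda>x. f (Complex x b))) {0..1}"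
    by (simp add: u_def scaleR_conv_of_real mult.commute)
  then have "(f has_contour_integral integral {Y..X} (\<lambda>x. f (Complex x b))) (linepath (Complex Y b) (Complex X b))"
    by (simp add: has_contour_integral_linepath)
  then show ?thesis
    by (rule contour_integral_unique)
qed

text \<open>The strip \<open>\<bar>Im w\<bar> < pi / 2\<close> is mapped conformally onto the plane cut along \<open>[0, \<infinity>)\<close>, and its
  real axis onto \<open>(-\<infinity>, 0)\<close>.\<close>

definition slit_map :: "complex \<Rightarrow> complex" where
  "slit_map w = - exp (- 2 * w)"

lemma slit_map_nonzero [simp]: "slit_map w \<noteq> 0"
  by (simp add: slit_map_def)

lemma norm_slit_map: "cmod (slit_map w) = exp (- 2 * Re w)"
  by (simp add: slit_map_def)

lemma DERIV_slit_map: "(slit_map has_field_derivative - 2 * slit_map w) (at w)"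
  unfolding slit_map_def[abs_def] by (auto intro!: derivative_eq_intros)

lemma slit_map_holomorphic: "slit_map holomorphic_on A"
  unfolding slit_map_def[abs_def] by (intro holomorphic_intros)

lemma slit_map_of_real: "slit_map (of_real x) = of_real (- exp (- 2 * x))"
  unfolding slit_map_def by (simp flip: exp_of_real)

lemma slit_map_top: "slit_map (Complex x (pi / 2)) = of_real (exp (- 2 * x))"
  and slit_map_bottom: "slit_map (Complex x (- (pi / 2))) = of_real (exp (- 2 * x))"
  by (simp_all add: slit_map_def complex_eq_iff Re_exp Im_exp)

text \<open>The map has period i pi, so preimages of one point whose heights differ by less than pi
  coincide.\<close>

lemma slit_map_inj:
  assumes "slit_map u = slit_map v" "\<bar>Im u - Im v\<bar> < pi"
  shows "u = v"
proof -
  have "exp (- 2 * u) = exp (- 2 * v)"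
    using assms(1) by (simp add: slit_map_def)
  then obtain n :: int where n: "- 2 * u = - 2 * v + of_int (2 * n) * of_real pi * \<i>"
    by (auto simp: exp_eq)
  from arg_cong[OF this, of Im] have Im: "Im u - Im v = - (of_int n * pi)"
    by simp
  then have "\<bar>of_int n * pi\<bar> < 1 * pi"
    using assms(2) by simp
  then have "\<bar>real_of_int n\<bar> < 1"
    by (simp add: abs_mult)
  then have "n = 0"
    by linarith
  with n show ?thesis by simp
qed

lemma slit_map_not_pos:
  assumes "\<bar>Im w\<bar> < pi / 2" "E > 0"
  shows "slit_map w \<noteq> of_real E"
proof
  assume "slit_map w = of_real E"
  \<comment> \<open>E > 0 has a preimage on each edge of the strip. The edge on the same side as
    \<open>w\<close> is taken, so that the heights differ by less than pi.\<close>
  then have "slit_map w = slit_map (Complex (- ln E / 2) (if Im w \<ge> 0 then pi / 2 else - (pi / 2)))"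
    using assms(2) by (cases "Im w \<ge> 0") (simp_all add: slit_map_top slit_map_bottom)
  moreover have "\<bar>Im w - Im (Complex (- ln E / 2) (if Im w \<ge> 0 then pi / 2 else - (pi / 2)))\<bar> < pi"
    using assms(1) by auto
  ultimately have "w = Complex (- ln E / 2) (if Im w \<ge> 0 then pi / 2 else - (pi / 2))"
    by (rule slit_map_inj)
  from arg_cong[OF this, of Im] show False
    using assms(1) by (auto split: if_splits)
qed

lemma slit_map_not_real:
  assumes "0 < \<bar>Im w\<bar>" "\<bar>Im w\<bar> < pi / 2"
  shows "slit_map w \<noteq> of_real E"
proof
  assume eq: "slit_map w = of_real E"
  consider "E > 0" | "E = 0" | "E < 0" by linarith
  then show False
  proof cases
    case 3
    then have h: "slit_map w = slit_map (of_real (- ln (- E) / 2))"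
      using eq by (simp only: slit_map_of_real) simp
    have "\<bar>Im w - Im (of_real (- ln (- E) / 2))\<bar> < pi"
      using assms(2) pi_gt_zero by simp
    with h have "w = of_real (- ln (- E) / 2)"
      by (rule slit_map_inj)
    from arg_cong[OF this, of Im] show False
      using assms(1) by simp
  qed (use eq slit_map_not_pos[OF assms(2)] slit_map_nonzero[of w] in auto)
qed

text \<open>With Z = \<open>slit_map w\<close> the expression is of order Z near Z = 0 and of order
  1 / Z near infinity, and |Z| = exp (- 2 Re w).\<close>

lemma kernel_decay:
  fixes z0 z1 :: complex
  assumes "z0 \<noteq> 0" "z1 \<noteq> 0"
  obtains B L where "B \<ge> 0" "L > 0" "\<And>w. \<bar>Re w\<bar> \<ge> L \<Longrightarrow> slit_map w \<noteq> z0 \<and> slit_map w \<noteq> z1 \<and>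
    cmod (((z0 - z1) * (- 2 * slit_map w)) / ((slit_map w - z0) * (slit_map w - z1))) \<le> B * exp (- 2 * \<bar>Re w\<bar>)"
proof -
  \<comment> \<open>For |Z| \<le> lo both distances to z0 and z1 are at least lo; for |Z| \<ge> hi
    they are at least |Z| / 2, which produces the 8 in \<open>B\<close>.\<close>
  define lo where "lo = min (cmod z0) (cmod z1) / 2"
  define hi where "hi = 2 * max (cmod z0) (cmod z1)"
  have lo: "lo > 0" "lo \<le> cmod z0 / 2" "lo \<le> cmod z1 / 2"
    using assms by (auto simp: lo_def)
  have hi: "hi > 0" "cmod z0 \<le> hi / 2" "cmod z1 \<le> hi / 2"
    using assms by (auto simp: hi_def less_max_iff_disj)
  define L where "L = 1 + \<bar>ln lo\<bar> + \<bar>ln hi\<bar>"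
  define B where "B = 8 * cmod (z0 - z1) + 2 * cmod (z0 - z1) / lo\<^sup>2"
  have L: "L > 0" "- 2 * L \<le> ln lo" "ln hi \<le> 2 * L"
    by (auto simp: L_def)
  show ?thesis
  proof (rule that[of B L])
    show "B \<ge> 0" by (simp add: B_def)
    show "L > 0" by fact
    fix w
    assume w: "\<bar>Re w\<bar> \<ge> L"
    define Z where "Z = slit_map w"
    have Z: "cmod Z = exp (- 2 * Re w)"
      by (simp add: Z_def norm_slit_map)
    have main: "Z \<noteq> z0 \<and> Z \<noteq> z1 \<and> cmod (((z0 - z1) * (- 2 * Z)) / ((Z - z0) * (Z - z1))) \<le> B * exp (- 2 * \<bar>Re w\<bar>)"
      if d: "d > 0" "d \<le> cmod (Z - z0)" "d \<le> cmod (Z - z1)"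
        and B: "2 * cmod (z0 - z1) * (cmod Z / d\<^sup>2) \<le> B * exp (- 2 * \<bar>Re w\<bar>)" for d
    proof -
      have "d * d \<le> cmod (Z - z0) * cmod (Z - z1)"
        using d by (intro mult_mono) auto
      then have "cmod Z / (cmod (Z - z0) * cmod (Z - z1)) \<le> cmod Z / d\<^sup>2"
        using d(1) by (intro divide_left_mono) (auto simp: power2_eq_square intro: mult_pos_pos less_le_trans)
      then have "2 * cmod (z0 - z1) * (cmod Z / (cmod (Z - z0) * cmod (Z - z1))) \<le> 2 * cmod (z0 - z1) * (cmod Z / d\<^sup>2)"
        by (intro mult_left_mono) auto
      moreover have "cmod (((z0 - z1) * (- 2 * Z)) / ((Z - z0) * (Z - z1)))
          = 2 * cmod (z0 - z1) * (cmod Z / (cmod (Z - z0) * cmod (Z - z1)))"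
        unfolding norm_mult norm_divide by simp
      ultimately show ?thesis
        using B d by auto
    qed
    show "slit_map w \<noteq> z0 \<and> slit_map w \<noteq> z1 \<and>
      cmod (((z0 - z1) * (- 2 * slit_map w)) / ((slit_map w - z0) * (slit_map w - z1))) \<le> B * exp (- 2 * \<bar>Re w\<bar>)"
    proof (cases "Re w \<ge> 0")
      case True
      then have "cmod Z \<le> exp (ln lo)"
        using w L by (simp add: Z)
      then have "cmod Z \<le> lo"
        using lo by simp
      then have "lo \<le> cmod (Z - z0)" "lo \<le> cmod (Z - z1)"
        using lo norm_triangle_ineq2[of z0 Z] norm_triangle_ineq2[of z1 Z] by (auto simp: norm_minus_commute)
      moreover have "2 * cmod (z0 - z1) / lo\<^sup>2 \<le> B"
        by (simp add: B_def)
      then have "2 * cmod (z0 - z1) / lo\<^sup>2 * exp (- 2 * \<bar>Re w\<bar>) \<le> B * exp (- 2 * \<bar>Re w\<bar>)"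
        by (rule mult_right_mono) simp
      ultimately show ?thesis
        using main[OF lo(1)] True by (simp add: Z Z_def[symmetric])
    next
      case False
      then have "cmod Z \<ge> exp (ln hi)"
        using w L by (simp add: Z)
      then have "cmod Z \<ge> hi"
        using hi by simp
      then have "cmod Z / 2 \<le> cmod (Z - z0)" "cmod Z / 2 \<le> cmod (Z - z1)"
        using hi norm_triangle_ineq2[of Z z0] norm_triangle_ineq2[of Z z1] by auto
      moreover have "2 * cmod (z0 - z1) * (cmod Z / (cmod Z / 2)\<^sup>2) \<le> B * exp (- 2 * \<bar>Re w\<bar>)"
      proof -
        have "Z \<noteq> 0" by (simp add: Z_def)
        then have "cmod Z / (cmod Z / 2)\<^sup>2 = 4 * inverse (cmod Z)"
          by (simp add: power2_eq_square field_simps)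
        also have "inverse (cmod Z) = exp (- 2 * \<bar>Re w\<bar>)"
          using False by (simp add: Z flip: exp_minus)
        also have "2 * cmod (z0 - z1) * (4 * exp (- 2 * \<bar>Re w\<bar>)) = 8 * cmod (z0 - z1) * exp (- 2 * \<bar>Re w\<bar>)"
          by simp
        also have "\<dots> \<le> B * exp (- 2 * \<bar>Re w\<bar>)"
          by (intro mult_right_mono) (auto simp: B_def)
        finally show ?thesis .
      qed
      moreover have "cmod Z / 2 > 0" by (simp add: Z)
      ultimately show ?thesis
        using main[of "cmod Z / 2"] by (simp add: Z_def[symmetric])
    qed
  qed
qed


section \<open>The contour integral\<close>

context strip
begin

text \<open>The kernel 1 / (z - z0) - 1 / (z - z1) at z = \<open>slit_map w\<close>, multiplied by
  dz/dw = - 2 z.\<close>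

definition G :: "complex \<Rightarrow> complex \<Rightarrow> complex \<Rightarrow> complex" where
  "G z0 z1 w = (z0 - z1) * (- 2 * slit_map w) / ((slit_map w - z0) * (slit_map w - z1))"

lemma zero_real:
  assumes "D w = 0" "\<bar>Im w\<bar> \<le> pi / 2"
  shows "w = of_real (Re w)" "D (Re w) = 0"
proof -
  have "Im w = 0"
    using D_nonzero[of "Im w" "Re w"] assms by auto
  then show w: "w = of_real (Re w)"
    by (simp add: complex_eq_iff)
  have "complex_of_real (D (Re w)) = 0"
    using assms(1) of_real_D[of "Re w", where 'a = complex] w by simp
  then show "D (Re w) = 0" by simp
qed

lemma m_holomorphic: "(\<And>w. w \<in> A \<Longrightarrow> D w \<noteq> 0) \<Longrightarrow> m holomorphic_on A"
  unfolding m_def[abs_def] using c_pos s_pos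
  by (intro holomorphic_intros D_holomorphic N_holomorphic) auto

lemma G_holomorphic: "(\<And>w. w \<in> A \<Longrightarrow> slit_map w \<noteq> z0 \<and> slit_map w \<noteq> z1) \<Longrightarrow> G z0 z1 holomorphic_on A"
  unfolding G_def[abs_def] by (intro holomorphic_intros slit_map_holomorphic) auto

section \<open>Residues of \<open>m\<close> times the kernel\<close>

context
  fixes U :: "complex set" and p z0 z1 :: complex
  assumes U: "open U" "p \<in> U"
    and nz: "\<And>w. w \<in> U - {p} \<Longrightarrow> D w \<noteq> 0 \<and> slit_map w \<noteq> z0 \<and> slit_map w \<noteq> z1"
begin

lemma residue_at_zero_of_D:
  assumes "p = of_real x" "D x = 0" "slit_map p \<noteq> z0" "slit_map p \<noteq> z1"
  shows "residue (\<lambda>w. m w * G z0 z1 w) p = - G z0 z1 p / of_real (8 * c * s * q)"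
proof -
  have nz': "slit_map w \<noteq> z0 \<and> slit_map w \<noteq> z1" if "w \<in> U" for w
    using nz[of w] that assms by auto
  have "residue (\<lambda>w. (- N w * G z0 z1 w / of_real (8 * c\<^sup>2 * s\<^sup>2)) / D w) p
      = (- N p * G z0 z1 p / of_real (8 * c\<^sup>2 * s\<^sup>2)) / of_real (D' x)"
  proof (rule residue_simple_zero[OF U])
    show "(\<lambda>w. - N w * G z0 z1 w / of_real (8 * c\<^sup>2 * s\<^sup>2)) holomorphic_on U"
      using c_pos s_pos by (intro holomorphic_intros N_holomorphic G_holomorphic nz') auto
    show "(D has_field_derivative of_real (D' x)) (at p)"
      using DERIV_D[of p] by (simp add: assms(1) of_real_D')
    show "complex_of_real (D' x) \<noteq> 0"
      using D'_nonzero[OF assms(2)] by simp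
    show "D p = 0"
      by (simp add: assms(1,2) of_real_D)
  qed (use nz D_holomorphic in auto)
  also have "(\<lambda>w. (- N w * G z0 z1 w / of_real (8 * c\<^sup>2 * s\<^sup>2)) / D w) = (\<lambda>w. m w * G z0 z1 w)"
    by (simp add: m_def fun_eq_iff)
  also have "(- N p * G z0 z1 p / of_real (8 * c\<^sup>2 * s\<^sup>2)) / of_real (D' x)
      = - G z0 z1 p * of_real (N x / D' x) / of_real (8 * c\<^sup>2 * s\<^sup>2)"
    by (simp add: assms(1) of_real_N mult_ac)
  also have "\<dots> = - G z0 z1 p * of_real (s * c / q / (8 * c\<^sup>2 * s\<^sup>2))"
    unfolding N_over_D'[OF assms(2)] by simp
  also have "s * c / q / (8 * c\<^sup>2 * s\<^sup>2) = 1 / (8 * c * s * q)"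
    using c_pos s_pos q_pos[OF assms(2)] by (simp add: power2_eq_square)
  finally show ?thesis by simp
qed

text \<open>The factor - 2 * \<open>slit_map\<close> in \<open>G\<close> is the derivative of
  \<open>slit_map\<close> and cancels, as a change of variables must: the pulled-back Cauchy kernel
  has residue 1.\<close>

lemma residue_at_first_pole:
  assumes "slit_map p = z0" "z0 \<noteq> z1" "D p \<noteq> 0"
  shows "residue (\<lambda>w. m w * G z0 z1 w) p = m p"
proof -
  have "residue (\<lambda>w. (m w * (z0 - z1) * (- 2 * slit_map w) / (slit_map w - z1)) / (slit_map w - z0)) p
      = (m p * (z0 - z1) * (- 2 * slit_map p) / (slit_map p - z1)) / (- 2 * slit_map p)"
  proof (rule residue_simple_zero[OF U])
    show "(\<lambda>w. m w * (z0 - z1) * (- 2 * slit_map w) / (slit_map w - z1)) holomorphic_on U"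
      by (intro holomorphic_intros m_holomorphic slit_map_holomorphic) (use nz assms in force)+
    show "((\<lambda>w. slit_map w - z0) has_field_derivative - 2 * slit_map p) (at p)"
      by (auto intro!: derivative_eq_intros DERIV_slit_map)
    show "(\<lambda>w. slit_map w - z0) holomorphic_on U - {p}"
      by (intro holomorphic_intros slit_map_holomorphic)
  qed (use nz assms in auto)
  also have "(\<lambda>w. (m w * (z0 - z1) * (- 2 * slit_map w) / (slit_map w - z1)) / (slit_map w - z0)) = (\<lambda>w. m w * G z0 z1 w)"
    by (simp add: G_def fun_eq_iff mult_ac)
  finally show ?thesis
    using assms slit_map_nonzero[of p] by auto
qed

lemma residue_at_second_pole:
  assumes "slit_map p = z1" "z0 \<noteq> z1" "D p \<noteq> 0"
  shows "residue (\<lambda>w. m w * G z0 z1 w) p = - m p"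
proof -
  have "residue (\<lambda>w. (m w * (z0 - z1) * (- 2 * slit_map w) / (slit_map w - z0)) / (slit_map w - z1)) p
      = (m p * (z0 - z1) * (- 2 * slit_map p) / (slit_map p - z0)) / (- 2 * slit_map p)"
  proof (rule residue_simple_zero[OF U])
    show "(\<lambda>w. m w * (z0 - z1) * (- 2 * slit_map w) / (slit_map w - z0)) holomorphic_on U"
      by (intro holomorphic_intros m_holomorphic slit_map_holomorphic) (use nz assms in force)+
    show "((\<lambda>w. slit_map w - z1) has_field_derivative - 2 * slit_map p) (at p)"
      by (auto intro!: derivative_eq_intros DERIV_slit_map)
    show "(\<lambda>w. slit_map w - z1) holomorphic_on U - {p}"
      by (intro holomorphic_intros slit_map_holomorphic)
  qed (use nz assms in auto)
  also have "(\<lambda>w. (m w * (z0 - z1) * (- 2 * slit_map w) / (slit_map w - z0)) / (slit_map w - z1)) = (\<lambda>w. m w * G z0 z1 w)"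
    by (simp add: G_def fun_eq_iff mult_ac)
  also have "(m p * (z0 - z1) * (- 2 * slit_map p) / (slit_map p - z0)) / (- 2 * slit_map p) = - m p"
    using assms slit_map_nonzero[of p] by (simp add: divide_simps) (simp add: algebra_simps)
  finally show ?thesis .
qed

end

lemma contour_integral_rectangle:
  fixes X Y :: real and w0 w1 :: complex
  defines "z0 \<equiv> slit_map w0" and "z1 \<equiv> slit_map w1"
  assumes w0: "0 < \<bar>Im w0\<bar>" "\<bar>Im w0\<bar> < pi / 2" "Y < Re w0" "Re w0 < X"
    and w1: "0 < \<bar>Im w1\<bar>" "\<bar>Im w1\<bar> < pi / 2" "Y < Re w1" "Re w1 < X"
    and neq: "w0 \<noteq> w1" and ends: "D X \<noteq> 0" "D Y \<noteq> 0"
  shows "contour_integral (rectpath (Complex Y (- (pi / 2))) (Complex X (pi / 2))) (\<lambda>w. m w * G z0 z1 w)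
      = 2 * of_real pi * \<i> * (m w0 - m w1
          - (\<Sum>x\<in>{x. Y < x \<and> x < X \<and> D x = 0}. G z0 z1 (of_real x)) / of_real (8 * c * s * q))"
    and "path_image (rectpath (Complex Y (- (pi / 2))) (Complex X (pi / 2)))
      \<subseteq> {w. D w \<noteq> 0 \<and> slit_map w \<noteq> z0 \<and> slit_map w \<noteq> z1}"
    and "finite {x. Y < x \<and> x < X \<and> D x = 0}"
proof -
  define a b where "a = Complex Y (- (pi / 2))" and "b = Complex X (pi / 2)"
  \<comment> \<open>The zeros of F collect all possible poles of the integrand: the zeros of
    \<open>D\<close> and the preimages of z0 and z1.\<close>
  define F where "F w = D w * ((slit_map w - z0) * (slit_map w - z1))" for w
  define h where "h w = m w * G z0 z1 w" for w
  have "Y < X" using w0 by simp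
  then have le: "Re a \<le> Re b" "Im a \<le> Im b"
    by (simp_all add: a_def b_def)
  have "\<bar>Im w0 - Im w1\<bar> < pi"
    using w0 w1 by linarith
  then have "z0 \<noteq> z1"
    unfolding z0_def z1_def using slit_map_inj[of w0 w1] neq by auto
  have D_off: "D w0 \<noteq> 0" "D w1 \<noteq> 0"
    using D_nonzero[of "Im w0" "Re w0"] D_nonzero[of "Im w1" "Re w1"] w0 w1 by auto
  have F_hol: "F holomorphic_on A" for A
    unfolding F_def[abs_def] by (intro holomorphic_intros D_holomorphic slit_map_holomorphic)
  obtain \<rho> where \<rho>: "cbox a b \<subseteq> ball 0 \<rho>"
    using bounded_subset_ballD[OF bounded_cbox] by blast
  \<comment> \<open>The residue theorem is applied on an open ball around the rectangle, so all
    poles in the ball are listed; those outside the rectangle get winding number 0.\<close>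
  define pts where "pts = {w \<in> cball 0 \<rho>. F w = 0}"
  have fin: "finite pts"
    unfolding pts_def
  proof (rule holomorphic_compact_finite_zeros[OF F_hol[of UNIV]])
    have "F w0 = 0"
      by (simp add: F_def z0_def)
    \<comment> \<open>At i pi / 2 the map takes the value 1, which no point of the open strip
      attains, so z0 and z1 differ from it; and \<open>D\<close> has no zero on the edge.\<close>
    moreover have "F (Complex 0 (pi / 2)) \<noteq> 0"
      using slit_map_not_pos[of w0 1] slit_map_not_pos[of w1 1] w0 w1 D_nonzero[of "pi / 2" 0]
      by (simp add: F_def slit_map_top z0_def z1_def eq_commute[of 1])
    ultimately show "\<not> F constant_on UNIV"
      unfolding constant_on_def by (metis UNIV_I)
  qed auto
  define Z where "Z = {x. Y < x \<and> x < X \<and> D x = (0::real)}"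
  have zeros: "{w \<in> cbox a b. F w = 0} = insert w0 (insert w1 (of_real ` Z))" (is "?L = ?R")
  proof (intro equalityI subsetI)
    fix w assume "w \<in> ?L"
    then have w: "Y \<le> Re w" "Re w \<le> X" "\<bar>Im w\<bar> \<le> pi / 2" and "F w = 0"
      by (auto simp: in_cbox_complex_iff a_def b_def abs_le_iff)
    then consider "D w = 0" | "slit_map w = slit_map w0" | "slit_map w = slit_map w1"
      by (auto simp: F_def z0_def z1_def)
    then show "w \<in> ?R"
    proof cases
      case 1
      note zero_real[OF 1 w(3)]
      moreover from this have "Re w \<noteq> X" "Re w \<noteq> Y"
        using ends by auto
      ultimately show ?thesis
        using w unfolding Z_def by (auto intro!: image_eqI[of _ _ "Re w"])
    next
      case 2
      then show ?thesis
        using slit_map_inj[OF 2] w w0 by auto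
    next
      case 3
      then show ?thesis
        using slit_map_inj[OF 3] w w1 by auto
    qed
  next
    fix w assume "w \<in> ?R"
    then show "w \<in> ?L"
      using w0 w1 by (auto simp: F_def z0_def z1_def in_cbox_complex_iff a_def b_def abs_less_iff Z_def of_real_D)
  qed
  have box: "insert w0 (insert w1 (of_real ` Z)) \<subseteq> box a b"
    using w0 w1 by (auto simp: in_box_complex_iff a_def b_def abs_less_iff Z_def)
  note in_ball = order_trans[OF box order_trans[OF box_subset_cbox \<rho>]]
  have path: "path_image (rectpath a b) = cbox a b - box a b"
    by (rule path_image_rectpath_cbox_minus_box[OF le])
  have path_nz: "F w \<noteq> 0" if "w \<in> path_image (rectpath a b)" for w
    using that zeros box unfolding path by blast
  then show "path_image (rectpath (Complex Y (- (pi / 2))) (Complex X (pi / 2)))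
      \<subseteq> {w. D w \<noteq> 0 \<and> slit_map w \<noteq> z0 \<and> slit_map w \<noteq> z1}"
    by (auto simp: F_def a_def b_def)
  have "{w \<in> cbox a b. F w = 0} \<subseteq> pts"
    using \<rho> by (auto simp: pts_def)
  then have fin_zeros: "finite {w \<in> cbox a b. F w = 0}"
    using fin by (rule finite_subset)
  then have "finite (complex_of_real ` Z)"
    unfolding zeros by simp
  then have fin_Z: "finite Z"
    by (rule finite_imageD) (auto simp: inj_on_def)
  then show "finite {x. Y < x \<and> x < X \<and> D x = (0::real)}"
    by (simp add: Z_def)
  have "contour_integral (rectpath a b) h
      = 2 * pi * \<i> * (\<Sum>p\<in>pts. winding_number (rectpath a b) p * residue h p)"
  proof (rule Residue_theorem[of "ball 0 \<rho>"])
    show "h holomorphic_on ball 0 \<rho> - pts"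
      unfolding h_def[abs_def]
      by (intro holomorphic_intros m_holomorphic G_holomorphic) (auto simp: pts_def F_def)
    show "path_image (rectpath a b) \<subseteq> ball 0 \<rho> - pts"
      using path_nz \<rho> by (auto simp: path pts_def)
    show "\<forall>z. z \<notin> ball 0 \<rho> \<longrightarrow> winding_number (rectpath a b) z = 0"
      using winding_number_rectpath_outside[OF le] \<rho> by blast
  qed (use fin in auto)
  also have "(\<Sum>p\<in>pts. winding_number (rectpath a b) p * residue h p) = (\<Sum>p\<in>{w \<in> cbox a b. F w = 0}. residue h p)"
  proof -
    have "(\<Sum>p\<in>pts. winding_number (rectpath a b) p * residue h p)
        = (\<Sum>p\<in>{w \<in> cbox a b. F w = 0}. winding_number (rectpath a b) p * residue h p)"
      using winding_number_rectpath_outside[OF le]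
      by (intro sum.mono_neutral_right fin \<open>{w \<in> cbox a b. F w = 0} \<subseteq> pts\<close>) (auto simp: pts_def)
    also have "\<dots> = (\<Sum>p\<in>{w \<in> cbox a b. F w = 0}. residue h p)"
      using winding_number_rectpath box unfolding zeros by (intro sum.cong) auto
    finally show ?thesis .
  qed
  also have "\<dots> = residue h w0 + (residue h w1 + (\<Sum>p\<in>of_real ` Z. residue h p))"
  proof -
    have "w0 \<notin> of_real ` Z" "w1 \<notin> of_real ` Z"
      using w0(1) w1(1) by auto
    then show ?thesis
      unfolding zeros using fin_Z neq by simp
  qed
  also have "(\<Sum>p\<in>of_real ` Z. residue h p) = (\<Sum>x\<in>Z. residue h (of_real x))"
    by (rule sum.reindex_cong[of of_real]) (auto simp: inj_on_def)
  also have "\<dots> = (\<Sum>x\<in>Z. - G z0 z1 (of_real x) / of_real (8 * c * s * q))"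
  proof (rule sum.cong)
    fix x assume x: "x \<in> Z"
    have p: "complex_of_real x \<in> ball 0 \<rho>"
      using x in_ball by blast
    have "slit_map (of_real x) \<noteq> z0" "slit_map (of_real x) \<noteq> z1"
      unfolding slit_map_of_real z0_def z1_def 
      using slit_map_not_real[OF w0(1,2), of "- exp (- 2 * x)"] slit_map_not_real[OF w1(1,2), of "- exp (- 2 * x)"]
      by (simp_all only: not_sym)
    \<comment> \<open>Deleting the other poles from the ball leaves an open set in which this one is
      the only singularity.\<close>
    then show "residue h (of_real x) = - G z0 z1 (of_real x) / of_real (8 * c * s * q)"
      unfolding h_def[abs_def] using x p fin
      by (intro residue_at_zero_of_D[of "ball 0 \<rho> - (pts - {of_real x})"])
        (auto simp: pts_def F_def Z_def intro!: open_Diff finite_imp_closed)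
  qed simp
  also have "residue h w0 = m w0"
  proof -
    have p: "w0 \<in> ball 0 \<rho>"
      using in_ball by auto
    show ?thesis
      unfolding h_def[abs_def] using p fin \<open>z0 \<noteq> z1\<close> D_off
      by (intro residue_at_first_pole[of "ball 0 \<rho> - (pts - {w0})"])
        (auto simp: pts_def F_def z0_def intro!: open_Diff finite_imp_closed)
  qed
  also have "residue h w1 = - m w1"
  proof -
    have p: "w1 \<in> ball 0 \<rho>"
      using in_ball by auto
    show ?thesis
      unfolding h_def[abs_def] using p fin \<open>z0 \<noteq> z1\<close> D_off
      by (intro residue_at_second_pole[of "ball 0 \<rho> - (pts - {w1})"])
        (auto simp: pts_def F_def z1_def intro!: open_Diff finite_imp_closed)
  qed
  finally show "contour_integral (rectpath (Complex Y (- (pi / 2))) (Complex X (pi / 2))) (\<lambda>w. m w * G z0 z1 w)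
      = 2 * of_real pi * \<i> * (m w0 - m w1
          - (\<Sum>x\<in>{x. Y < x \<and> x < X \<and> D x = 0}. G z0 z1 (of_real x)) / of_real (8 * c * s * q))"
    unfolding a_def b_def h_def[abs_def] Z_def
    by (simp add: sum_negf sum_divide_distrib)
qed

end

section \<open>The candidate measure\<close>

lemma continuous_on_Complex_left [continuous_intros]:
  "continuous_on A f \<Longrightarrow> continuous_on A (\<lambda>x. Complex (f x) b)"
  unfolding Complex_eq by (intro continuous_intros)

context strip
begin

text \<open>Im m at the point of the upper edge lying over E, by \<open>Im_m_top\<close>.\<close>

definition t :: "real \<Rightarrow> real" where
  "t E = (if E > 0 then 1 / (8 * (cmod (D (Complex (- ln E / 2) (pi / 2))))\<^sup>2) else 0)"

definition S :: "real set" where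
  "S = {E. E < 0 \<and> D (- ln (- E) / 2) = (0::real)}"

text \<open>The residue constant 1 / (8 c s q), times 2 |E| from the factor - 2 z in the kernel,
  times pi because the represented function is pi * m.\<close>

definition wt :: "real \<Rightarrow> real" where
  "wt E = \<bar>E\<bar> * pi / (4 * c * s * q)"

lemma continuous_D: "continuous_on A (D :: complex \<Rightarrow> complex)"
  by (intro holomorphic_on_imp_continuous_on D_holomorphic)

lemma finite_zeros: "finite {x::real. \<bar>x\<bar> \<le> r \<and> D x = 0}"
proof (cases "\<exists>x::real. D x = 0")
  case True
  then obtain x where "D (x::real) = 0" by blast
  then have "D (complex_of_real x) = 0"
    by (simp add: of_real_D)
  moreover have "D (Complex 0 (pi / 2)) \<noteq> 0"
    by (rule D_nonzero) auto
  ultimately have "\<not> (D :: complex \<Rightarrow> complex) constant_on UNIV"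
    unfolding constant_on_def by (metis UNIV_I)
  then have "finite {w \<in> cball 0 r. D w = (0::complex)}"
    by (intro holomorphic_compact_finite_zeros[OF D_holomorphic[of UNIV]]) auto
  moreover have "complex_of_real ` {x. \<bar>x\<bar> \<le> r \<and> D x = 0} \<subseteq> {w \<in> cball 0 r. D w = 0}"
    by (auto simp: of_real_D)
  ultimately have "finite (complex_of_real ` {x. \<bar>x\<bar> \<le> r \<and> D x = 0})"
    by (rule finite_subset[rotated])
  then show ?thesis
    by (rule finite_imageD) (auto simp: inj_on_def)
qed auto

sublocale density_and_atoms t S wt
proof
  have "(\<lambda>E. D (Complex (- ln E / 2) (pi / 2))) \<in> borel_measurable borel"
    unfolding Complex_eq by (intro borel_measurable_continuous_on[OF continuous_D]) measurable
  then show "t \<in> borel_measurable borel"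
    unfolding t_def[abs_def] by measurable
  show "0 \<le> t x" for x
    by (simp add: t_def)
  show "t x = 0" if "x \<le> 0" for x
    using that by (simp add: t_def)
  show "S \<subseteq> {..<0}"
    by (auto simp: S_def)
  show "0 < wt x" if "x \<in> S" for x
    using that q_pos c_pos s_pos unfolding S_def wt_def
    by (intro divide_pos_pos mult_pos_pos) auto
  have "continuous_on {0<..} (\<lambda>E. 1 / (8 * (cmod (D (Complex (- ln E / 2) (pi / 2))))\<^sup>2))"
  proof (intro continuous_intros continuous_on_compose2[OF continuous_D[of UNIV]])
    show "\<forall>E\<in>{0<..}. 8 * (cmod (D (Complex (- ln E / 2) (pi / 2))))\<^sup>2 \<noteq> 0"
      using D_nonzero[of "pi / 2"] by simp
  qed auto
  then show "continuous_on {0<..} t"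
    by (rule continuous_on_eq) (simp add: t_def)
  show "finite (S \<inter> {- b..- a})" if "0 < a" for a b
  proof (rule finite_imageD)
    define r where "r = \<bar>ln a\<bar> + \<bar>ln b\<bar>"
    have "(\<lambda>E. - ln (- E) / 2) ` (S \<inter> {- b..- a}) \<subseteq> {x. \<bar>x\<bar> \<le> r \<and> D x = 0}"
    proof (rule image_subsetI)
      fix E assume E: "E \<in> S \<inter> {- b..- a}"
      then have "a \<le> - E" "- E \<le> b" by auto
      then have "ln a \<le> ln (- E)" "ln (- E) \<le> ln b"
        using \<open>0 < a\<close> by auto
      then have "\<bar>- ln (- E) / 2\<bar> \<le> r"
        unfolding r_def by (auto simp: abs_if)
      with E show "- ln (- E) / 2 \<in> {x. \<bar>x\<bar> \<le> r \<and> D x = 0}"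
        by (simp add: S_def)
    qed
    then show "finite ((\<lambda>E. - ln (- E) / 2) ` (S \<inter> {- b..- a}))"
      using finite_zeros by (rule finite_subset)
    show "inj_on (\<lambda>E. - ln (- E) / 2) (S \<inter> {- b..- a})"
      by (auto simp: inj_on_def S_def)
  qed
qed

text \<open>The contour identity divided by 2 i: the horizontal edges yield the density, the
  residues at the zeros of \<open>D\<close> the atoms, and the two vertical edges, each of length
  pi, contribute at most 2 pi B / 2.\<close>

lemma truncated_representation:
  fixes X Y :: real and w0 w1 :: complex
  defines "z0 \<equiv> slit_map w0" and "z1 \<equiv> slit_map w1"
  defines "l \<equiv> exp (- 2 * X)" and "u \<equiv> exp (- 2 * Y)"
  assumes w0: "0 < \<bar>Im w0\<bar>" "\<bar>Im w0\<bar> < pi / 2" "Y < Re w0" "Re w0 < X"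
    and w1: "0 < \<bar>Im w1\<bar>" "\<bar>Im w1\<bar> < pi / 2" "Y < Re w1" "Re w1 < X"
    and neq: "w0 \<noteq> w1" and ends: "D X \<noteq> 0" "D Y \<noteq> 0"
    and bound: "\<And>y. \<bar>y\<bar> \<le> pi / 2 \<Longrightarrow> cmod (m (Complex X y) * G z0 z1 (Complex X y)) \<le> B"
      "\<And>y. \<bar>y\<bar> \<le> pi / 2 \<Longrightarrow> cmod (m (Complex Y y) * G z0 z1 (Complex Y y)) \<le> B"
  shows "cmod ((LINT E:{l..u} \<union> {- u..- l}|\<nu>. 1 / (of_real E - z0) - 1 / (of_real E - z1)) - pi * (m w0 - m w1)) \<le> pi * B"
proof -
  define h where "h w = m w * G z0 z1 w" for w
  define g where "g E = 1 / (of_real E - z0) - 1 / (of_real E - z1)" for E :: real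
  define a1 a2 a3 a4 where "a1 = Complex Y (- (pi / 2))" and "a2 = Complex X (- (pi / 2))"
    and "a3 = Complex X (pi / 2)" and "a4 = Complex Y (pi / 2)"
  define Z where "Z = {x. Y < x \<and> x < X \<and> D x = (0::real)}"
  have "Y < X" using w0 by simp
  have "B \<ge> 0"
    using order_trans[OF norm_ge_zero bound(1)[of 0]] by simp
  have nonreal: "of_real E \<noteq> z0" "of_real E \<noteq> z1" for E
    using slit_map_not_real[of w0 E] slit_map_not_real[of w1 E] w0 w1 by (auto simp: z0_def z1_def)
  have g_eq: "g E = (z0 - z1) / ((of_real E - z0) * (of_real E - z1))" for E
    using nonreal[of E] by (simp add: g_def field_simps)
  have G_real: "G z0 z1 w = - 2 * of_real E * g E" if "slit_map w = of_real E" for w E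
    unfolding G_def g_eq that by simp
  have cont_g: "continuous_on UNIV g"
    unfolding g_def[abs_def] using nonreal by (intro continuous_intros) auto
  note rect = contour_integral_rectangle[OF w0 w1 neq ends, folded z0_def z1_def]
  have rectpath: "rectpath a1 a3 = linepath a1 a2 +++ linepath a2 a3 +++ linepath a3 a4 +++ linepath a4 a1"
    by (simp add: rectpath_def Let_def a1_def a2_def a3_def a4_def)
  have parts: "path_image (rectpath a1 a3)
      = closed_segment a1 a2 \<union> closed_segment a2 a3 \<union> closed_segment a3 a4 \<union> closed_segment a4 a1"
    unfolding rectpath by (simp add: path_image_join Un_assoc)
  have h_hol: "h holomorphic_on path_image (rectpath a1 a3)"
    unfolding h_def[abs_def] using rect(2) unfolding a1_def a3_def
    by (intro holomorphic_intros m_holomorphic G_holomorphic) auto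
  have cont: "continuous_on (closed_segment a1 a2) h" "continuous_on (closed_segment a2 a3) h"
    "continuous_on (closed_segment a3 a4) h" "continuous_on (closed_segment a4 a1) h"
    using holomorphic_on_imp_continuous_on[OF h_hol] unfolding parts
    by (auto elim: continuous_on_subset)
  note cint = cont[THEN contour_integrable_continuous_linepath]
  have "contour_integral (rectpath a1 a3) h = contour_integral (linepath a1 a2) h
      + (contour_integral (linepath a2 a3) h + (contour_integral (linepath a3 a4) h + contour_integral (linepath a4 a1) h))"
    unfolding rectpath using cint by simp
  note edges = this
  have seg: "Complex x (- (pi / 2)) \<in> closed_segment a1 a2" "Complex x (pi / 2) \<in> closed_segment a3 a4"
    if "x \<in> {Y..X}" for x
    using that by (auto simp: a1_def a2_def a3_def a4_def closed_segment_same_Im closed_segment_eq_real_ivl)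
  have cont_bottom: "continuous_on {Y..X} (\<lambda>x. h (Complex x (- (pi / 2))))"
    by (rule continuous_on_compose2[OF cont(1)]) (use seg in \<open>auto intro!: continuous_intros\<close>)
  have cont_top: "continuous_on {Y..X} (\<lambda>x. h (Complex x (pi / 2)))"
    by (rule continuous_on_compose2[OF cont(3)]) (use seg in \<open>auto intro!: continuous_intros\<close>)
  have I1: "contour_integral (linepath a1 a2) h = integral {Y..X} (\<lambda>x. h (Complex x (- (pi / 2))))"
    unfolding a1_def a2_def using \<open>Y < X\<close> by (intro contour_integral_horizontal cont_bottom) simp
  have I3: "contour_integral (linepath a3 a4) h = - integral {Y..X} (\<lambda>x. h (Complex x (pi / 2)))"
    unfolding contour_integral_reverse_linepath[OF cont(3)] unfolding a3_def a4_def
    using \<open>Y < X\<close> by (subst contour_integral_horizontal) (auto intro: cont_top)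
  have "contour_integral (linepath a1 a2) h + contour_integral (linepath a3 a4) h
      = integral {Y..X} (\<lambda>x. h (Complex x (- (pi / 2))) - h (Complex x (pi / 2)))"
    unfolding I1 I3 by (subst integral_diff) (auto intro: integrable_continuous_real cont_bottom cont_top)
  also have "\<dots> = integral {Y..X} (\<lambda>x. 2 * \<i> * ((2 * exp (- 2 * x)) *\<^sub>R (t (exp (- 2 * x)) *\<^sub>R g (exp (- 2 * x)))))"
  proof (rule integral_cong)
    fix x
    \<comment> \<open>Both edges lie over the same positive E, so the kernel agrees on them, while
      the values of \<open>m\<close> are conjugate: only Im m survives.\<close>
    have "h (Complex x (- (pi / 2))) - h (Complex x (pi / 2))
        = (cnj (m (Complex x (pi / 2))) - m (Complex x (pi / 2))) * (- 2 * of_real (exp (- 2 * x)) * g (exp (- 2 * x)))"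
      unfolding h_def G_real[OF slit_map_top] G_real[OF slit_map_bottom] cnj_m by (simp add: left_diff_distrib complex_cnj)
    also have "cnj (m (Complex x (pi / 2))) - m (Complex x (pi / 2)) = - 2 * \<i> * of_real (t (exp (- 2 * x)))"
    proof -
      have "Im (m (Complex x (pi / 2))) = t (exp (- 2 * x))"
        by (simp add: Im_m_top t_def)
      then show ?thesis
        by (simp add: complex_eq_iff)
    qed
    finally show "h (Complex x (- (pi / 2))) - h (Complex x (pi / 2))
        = 2 * \<i> * ((2 * exp (- 2 * x)) *\<^sub>R (t (exp (- 2 * x)) *\<^sub>R g (exp (- 2 * x))))"
      by (simp add: scaleR_conv_of_real)
  qed
  also have "\<dots> = 2 * \<i> * integral {l..u} (\<lambda>E. t E *\<^sub>R g E)"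
  proof -
    have lu: "0 < l" "l < u"
      using \<open>Y < X\<close> by (simp_all add: l_def u_def)
    \<comment> \<open>The substitution E = exp (- 2 x) is decreasing, so the general rule gives a
      difference of two integrals of which the first is over an empty interval.\<close>
    have "((\<lambda>x. (- 2 * exp (- 2 * x)) *\<^sub>R (t (exp (- 2 * x)) *\<^sub>R g (exp (- 2 * x)))) has_integral
        (integral {exp (- 2 * Y)..exp (- 2 * X)} (\<lambda>E. t E *\<^sub>R g E) - integral {exp (- 2 * X)..exp (- 2 * Y)} (\<lambda>E. t E *\<^sub>R g E))) {Y..X}"
    proof (rule has_integral_substitution_general[where s = "{}" and c = l and d = u])
      show "continuous_on {l..u} (\<lambda>E. t E *\<^sub>R g E)"
        using lu by (intro continuous_on_scaleR continuous_on_subset[OF t_continuous] continuous_on_subset[OF cont_g]) auto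
      show "((\<lambda>x. exp (- 2 * x)) has_field_derivative - 2 * exp (- 2 * x)) (at x within {Y..X})" for x :: real
        by (auto intro!: derivative_eq_intros)
    qed (use \<open>Y < X\<close> in \<open>auto simp: l_def u_def intro!: continuous_intros\<close>)
    moreover have "integral {exp (- 2 * Y)..exp (- 2 * X)} (\<lambda>E. t E *\<^sub>R g E) = 0"
      using lu by (simp add: l_def u_def)
    ultimately have "((\<lambda>x. (- 2 * exp (- 2 * x)) *\<^sub>R (t (exp (- 2 * x)) *\<^sub>R g (exp (- 2 * x)))) has_integral
        - integral {l..u} (\<lambda>E. t E *\<^sub>R g E)) {Y..X}"
      by (simp add: l_def u_def)
    from has_integral_neg[OF this] have "((\<lambda>x. (2 * exp (- 2 * x)) *\<^sub>R (t (exp (- 2 * x)) *\<^sub>R g (exp (- 2 * x)))) has_integral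
        integral {l..u} (\<lambda>E. t E *\<^sub>R g E)) {Y..X}"
      by simp
    from has_integral_mult_right[OF this, of "2 * \<i>"] show ?thesis
      by (rule integral_unique)
  qed
  finally have horizontal: "contour_integral (linepath a1 a2) h + contour_integral (linepath a3 a4) h
      = 2 * \<i> * integral {l..u} (\<lambda>E. t E *\<^sub>R g E)" .
  have sum: "(\<Sum>x\<in>Z. G z0 z1 (of_real x)) / of_real (8 * c * s * q) = (\<Sum>E\<in>S \<inter> {- u..- l}. wt E *\<^sub>R g E) / pi"
  proof -
    have "(\<Sum>E\<in>S \<inter> {- u..- l}. wt E *\<^sub>R g E) = (\<Sum>x\<in>Z. wt (- exp (- 2 * x)) *\<^sub>R g (- exp (- 2 * x)))"
    proof (rule sum.reindex_bij_witness[where i = "\<lambda>x. - exp (- 2 * x)" and j = "\<lambda>E. - ln (- E) / 2"])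
      fix E assume E: "E \<in> S \<inter> {- u..- l}"
      then have E': "E < 0" "D (- ln (- E) / 2) = (0::real)" "l \<le> - E" "- E \<le> u"
        by (auto simp: S_def)
      show "- exp (- 2 * (- ln (- E) / 2)) = E"
        using E' by simp
      have "0 < l" "0 < u"
        by (simp_all add: l_def u_def)
      then have "ln l \<le> ln (- E)" "ln (- E) \<le> ln u"
        using E' by simp_all
      then have "Y \<le> - ln (- E) / 2" "- ln (- E) / 2 \<le> X"
        by (simp_all add: l_def u_def)
      moreover have "- ln (- E) / 2 \<noteq> X" "- ln (- E) / 2 \<noteq> Y"
        using E'(2) ends by metis+
      ultimately show "- ln (- E) / 2 \<in> Z"
        using E'(2) by (auto simp: Z_def)
    qed (auto simp: Z_def S_def l_def u_def)
    moreover have "G z0 z1 (of_real x) / of_real (8 * c * s * q) = wt (- exp (- 2 * x)) *\<^sub>R g (- exp (- 2 * x)) / pi" for x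
      unfolding G_real[OF slit_map_of_real] by (simp add: wt_def scaleR_conv_of_real)
    ultimately show ?thesis
      by (simp add: sum_divide_distrib)
  qed
  have vertical: "cmod (contour_integral (linepath a2 a3) h) \<le> B * pi" "cmod (contour_integral (linepath a4 a1) h) \<le> B * pi"
  proof -
    have "cmod (contour_integral (linepath a2 a3) h) \<le> B * cmod (a3 - a2)"
    proof (rule contour_integral_bound_linepath[OF cint(2) \<open>B \<ge> 0\<close>])
      fix w assume "w \<in> closed_segment a2 a3"
      then have "Re w = X" "\<bar>Im w\<bar> \<le> pi / 2"
        by (auto simp: a2_def a3_def closed_segment_same_Re closed_segment_eq_real_ivl)
      then show "cmod (h w) \<le> B"
        using bound(1)[of "Im w"] by (auto simp: h_def)
    qed
    moreover have "a3 - a2 = \<i> * of_real pi"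
      by (simp add: a2_def a3_def complex_eq_iff)
    ultimately show "cmod (contour_integral (linepath a2 a3) h) \<le> B * pi"
      by (simp add: norm_mult)
    have "cmod (contour_integral (linepath a4 a1) h) \<le> B * cmod (a1 - a4)"
    proof (rule contour_integral_bound_linepath[OF cint(4) \<open>B \<ge> 0\<close>])
      fix w assume "w \<in> closed_segment a4 a1"
      then have "Re w = Y" "\<bar>Im w\<bar> \<le> pi / 2"
        using pi_gt_zero by (auto simp: a1_def a4_def closed_segment_same_Re closed_segment_eq_real_ivl not_le[symmetric] split: if_splits)
      then show "cmod (h w) \<le> B"
        using bound(2)[of "Im w"] by (auto simp: h_def)
    qed
    moreover have "a1 - a4 = - \<i> * of_real pi"
      by (simp add: a1_def a4_def complex_eq_iff)
    ultimately show "cmod (contour_integral (linepath a4 a1) h) \<le> B * pi"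
      by (simp add: norm_mult)
  qed
  define vert where "vert = contour_integral (linepath a2 a3) h + contour_integral (linepath a4 a1) h"
  define J where "J = (LINT E:{l..u} \<union> {- u..- l}|\<nu>. g E)"
  have J: "J = integral {l..u} (\<lambda>E. t E *\<^sub>R g E) + (\<Sum>E\<in>S \<inter> {- u..- l}. wt E *\<^sub>R g E)"
    unfolding J_def by (rule integral_\<nu>_annulus[OF cont_g]) (simp add: l_def)
  have "2 * \<i> * integral {l..u} (\<lambda>E. t E *\<^sub>R g E) + vert = contour_integral (rectpath a1 a3) h"
    unfolding edges horizontal[symmetric] vert_def by (simp only: ac_simps)
  also have "\<dots> = 2 * of_real pi * \<i> * (m w0 - m w1 - (\<Sum>E\<in>S \<inter> {- u..- l}. wt E *\<^sub>R g E) / pi)"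
    unfolding sum[symmetric] unfolding Z_def h_def[abs_def] a1_def a3_def by (rule rect(1))
  also have "\<dots> = 2 * \<i> * (pi * (m w0 - m w1) - (\<Sum>E\<in>S \<inter> {- u..- l}. wt E *\<^sub>R g E))"
    by (simp add: right_diff_distrib)
  finally have "2 * \<i> * (J - pi * (m w0 - m w1)) = - vert"
    unfolding J by (simp add: algebra_simps)
  then have "2 * cmod (J - pi * (m w0 - m w1)) = cmod vert"
    by (metis norm_minus_cancel norm_mult norm_ii norm_numeral mult_1_right)
  moreover have "cmod vert \<le> B * pi + B * pi"
    unfolding vert_def using vertical norm_triangle_le add_mono by blast
  ultimately show ?thesis
    unfolding J_def g_def by (simp add: mult.commute)
qed

end


section \<open>The Herglotz representation\<close>

context strip
begin

lemma good_abscissae: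
  obtains \<kappa> :: real and X Y :: "nat \<Rightarrow> real"
  where "0 < \<kappa>" "\<kappa> < 1" "\<alpha> < \<kappa>\<^sup>2"
    and "\<And>n. real n \<le> X n" "\<And>n. exp (- (\<kappa> * \<bar>X n\<bar>)) \<le> \<bar>D (X n)\<bar>"
    and "\<And>n. Y n \<le> - real n" "\<And>n. exp (- (\<kappa> * \<bar>Y n\<bar>)) \<le> \<bar>D (Y n)\<bar>"
proof -
  \<comment> \<open>\<kappa>^2 is the midpoint of max \<alpha> 0 and 1, hence above \<alpha> and
    below 1.\<close>
  define \<kappa> where "\<kappa> = sqrt ((max \<alpha> 0 + 1) / 2)"
  have "\<kappa>\<^sup>2 = (max \<alpha> 0 + 1) / 2"
    by (simp add: \<kappa>_def)
  then have \<kappa>: "0 < \<kappa>" "\<kappa> < 1" "\<alpha> < \<kappa>\<^sup>2"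
    using \<alpha>_less_1 by (auto simp: \<kappa>_def intro!: add_nonneg_pos)
  have "\<exists>x\<ge>real n. exp (- (\<kappa> * x)) \<le> \<bar>D x\<bar>" "\<exists>x\<ge>real n. exp (- (\<kappa> * x)) \<le> \<bar>D (- x)\<bar>" for n
    using D_not_decaying[of 1 \<kappa> "real n"] D_not_decaying[of "-1" \<kappa> "real n"] \<kappa> by simp_all
  then obtain X X' where X: "\<And>n. real n \<le> X n" "\<And>n. exp (- (\<kappa> * X n)) \<le> \<bar>D (X n)\<bar>"
    and X': "\<And>n. real n \<le> X' n" "\<And>n. exp (- (\<kappa> * X' n)) \<le> \<bar>D (- X' n)\<bar>"
    by metis
  have "\<bar>X n\<bar> = X n" "\<bar>X' n\<bar> = X' n" for n
    using X(1)[of n] X'(1)[of n] by auto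
  then show ?thesis
    using X X' by (intro that[OF \<kappa>, of X "\<lambda>n. - X' n"]) auto
qed

text \<open>\<open>N\<close> and 1 / \<open>D\<close> each contribute a factor exp (\<kappa> |x|)
  and the kernel exp (- 2 |x|), whence the rate 2 - 2 \<kappa>.\<close>

lemma edge_bound:
  assumes \<kappa>: "0 < \<kappa>" "\<kappa> < 1" "\<alpha> < \<kappa>\<^sup>2" and "z0 \<noteq> 0" "z1 \<noteq> 0"
  obtains K \<delta> L where "\<delta> > 0" "K \<ge> 0" "\<And>x y. \<bar>x\<bar> \<ge> L \<Longrightarrow> exp (- (\<kappa> * \<bar>x\<bar>)) \<le> \<bar>D x\<bar> \<Longrightarrow> \<bar>y\<bar> \<le> pi / 2 \<Longrightarrow>
    cmod (m (Complex x y) * G z0 z1 (Complex x y)) \<le> K * exp (- (\<delta> * \<bar>x\<bar>))"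
proof -
  obtain \<mu> where \<mu>: "\<mu> > 0" "\<And>x y. \<bar>y\<bar> \<le> pi / 2 \<Longrightarrow> \<mu> * \<bar>D x\<bar> \<le> cmod (D (Complex x y))"
    by (rule D_lower_bound) (rule that)
  obtain C where C: "C > 0" "\<And>x y. \<bar>y\<bar> \<le> pi / 2 \<Longrightarrow> cmod (N (Complex x y)) \<le> C * exp (\<kappa> * \<bar>x\<bar>)"
    by (rule N_bound[OF \<kappa>(1,3)]) (rule that)
  obtain B L where B: "B \<ge> 0" "\<And>w. \<bar>Re w\<bar> \<ge> L \<Longrightarrow> slit_map w \<noteq> z0 \<and> slit_map w \<noteq> z1 \<and>
    cmod (((z0 - z1) * (- 2 * slit_map w)) / ((slit_map w - z0) * (slit_map w - z1))) \<le> B * exp (- 2 * \<bar>Re w\<bar>)"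
    by (rule kernel_decay[OF assms(4,5)]) (rule that)
  define k where "k = 8 * c\<^sup>2 * s\<^sup>2"
  have k: "k > 0" using c_pos s_pos by (simp add: k_def)
  show ?thesis
  proof (rule that[of "2 - 2 * \<kappa>" "C / (k * \<mu>) * B" L])
    show "2 - 2 * \<kappa> > 0" using \<kappa> by simp
    show "C / (k * \<mu>) * B \<ge> 0" using C \<mu> B k by simp
    fix x y :: real
    assume x: "\<bar>x\<bar> \<ge> L" "exp (- (\<kappa> * \<bar>x\<bar>)) \<le> \<bar>D x\<bar>" and y: "\<bar>y\<bar> \<le> pi / 2"
    have "\<mu> * exp (- (\<kappa> * \<bar>x\<bar>)) \<le> \<mu> * \<bar>D x\<bar>"
      using \<mu>(1) x(2) by simp
    then have "\<mu> * exp (- (\<kappa> * \<bar>x\<bar>)) \<le> cmod (D (Complex x y))"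
      using \<mu>(2)[OF y] by (rule order_trans)
    then have "k * (\<mu> * exp (- (\<kappa> * \<bar>x\<bar>))) \<le> k * cmod (D (Complex x y))"
      using k by simp
    then have "cmod (N (Complex x y)) / (k * cmod (D (Complex x y))) \<le> C * exp (\<kappa> * \<bar>x\<bar>) / (k * (\<mu> * exp (- (\<kappa> * \<bar>x\<bar>))))"
      using C(2)[OF y] C(1) k \<mu>(1) by (intro frac_le) auto
    also have "\<dots> = C / (k * \<mu>) * exp (2 * \<kappa> * \<bar>x\<bar>)"
      by (simp add: exp_minus divide_simps flip: exp_add)
    finally have "cmod (m (Complex x y)) \<le> C / (k * \<mu>) * exp (2 * \<kappa> * \<bar>x\<bar>)"
      using k unfolding m_def k_def[symmetric] by (simp add: norm_divide norm_mult)
    moreover have "cmod (G z0 z1 (Complex x y)) \<le> B * exp (- 2 * \<bar>x\<bar>)"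
      using B(2)[of "Complex x y"] x(1) by (simp add: G_def)
    ultimately have "cmod (m (Complex x y)) * cmod (G z0 z1 (Complex x y))
        \<le> (C / (k * \<mu>) * exp (2 * \<kappa> * \<bar>x\<bar>)) * (B * exp (- 2 * \<bar>x\<bar>))"
      using C(1) k \<mu>(1) by (intro mult_mono) auto
    also have "\<dots> = C / (k * \<mu>) * B * (exp (2 * \<kappa> * \<bar>x\<bar>) * exp (- 2 * \<bar>x\<bar>))"
      by (simp only: mult_ac)
    also have "exp (2 * \<kappa> * \<bar>x\<bar>) * exp (- 2 * \<bar>x\<bar>) = exp (- ((2 - 2 * \<kappa>) * \<bar>x\<bar>))"
      by (simp add: algebra_simps flip: exp_add)
    finally show "cmod (m (Complex x y) * G z0 z1 (Complex x y)) \<le> C / (k * \<mu>) * B * exp (- ((2 - 2 * \<kappa>) * \<bar>x\<bar>))"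
      by (simp only: norm_mult)
  qed
qed

text \<open>The real points of the annulus exp (- 2 X) \<le> |z| \<le> exp (- 2 Y), which is the
  image of the closed rectangle under \<open>slit_map\<close>.\<close>

definition annulus :: "real \<Rightarrow> real \<Rightarrow> real set" where
  "annulus Y X = {exp (- 2 * X)..exp (- 2 * Y)} \<union> {- exp (- 2 * Y)..- exp (- 2 * X)}"

text \<open>At this stage the kernel is not known to be integrable over the whole line, so the
  identity is stated as a limit along truncations. Both points w0 and w1 stay free: a conjugate pair
  gives integrability, arbitrary ones the representation.\<close>

lemma representation_limit:
  obtains X Y :: "nat \<Rightarrow> real"
  where "\<And>n. real n \<le> X n" "\<And>n. Y n \<le> - real n"
    and "\<And>w0 w1. 0 < \<bar>Im w0\<bar> \<Longrightarrow> \<bar>Im w0\<bar> < pi / 2 \<Longrightarrow> 0 < \<bar>Im w1\<bar> \<Longrightarrow> \<bar>Im w1\<bar> < pi / 2 \<Longrightarrow> w0 \<noteq> w1 \<Longrightarrow>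
      (\<lambda>n. LINT E:annulus (Y n) (X n)|\<nu>. 1 / (of_real E - slit_map w0) - 1 / (of_real E - slit_map w1))
        \<longlonglongrightarrow> pi * (m w0 - m w1)"
proof -
  obtain \<kappa> X Y where \<kappa>: "0 < \<kappa>" "\<kappa> < 1" "\<alpha> < \<kappa>\<^sup>2"
    and X: "\<And>n. real n \<le> X n" "\<And>n. exp (- (\<kappa> * \<bar>X n\<bar>)) \<le> \<bar>D (X n)\<bar>"
    and Y: "\<And>n. Y n \<le> - real n" "\<And>n. exp (- (\<kappa> * \<bar>Y n\<bar>)) \<le> \<bar>D (Y n)\<bar>"
    by (rule good_abscissae) (rule that)
  have ends: "D (X n) \<noteq> 0" "D (Y n) \<noteq> 0" for n
    using X(2)[of n] Y(2)[of n] exp_gt_zero by (metis abs_zero not_less)+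
  show ?thesis
  proof (rule that[OF X(1) Y(1)])
    fix w0 w1 :: complex
    assume w: "0 < \<bar>Im w0\<bar>" "\<bar>Im w0\<bar> < pi / 2" "0 < \<bar>Im w1\<bar>" "\<bar>Im w1\<bar> < pi / 2" "w0 \<noteq> w1"
    define J where "J n = (LINT E:annulus (Y n) (X n)|\<nu>. 1 / (of_real E - slit_map w0) - 1 / (of_real E - slit_map w1))" for n
    obtain K \<delta> L where K: "\<delta> > 0" "K \<ge> 0" "\<And>x y. \<bar>x\<bar> \<ge> L \<Longrightarrow> exp (- (\<kappa> * \<bar>x\<bar>)) \<le> \<bar>D x\<bar> \<Longrightarrow> \<bar>y\<bar> \<le> pi / 2 \<Longrightarrow>
      cmod (m (Complex x y) * G (slit_map w0) (slit_map w1) (Complex x y)) \<le> K * exp (- (\<delta> * \<bar>x\<bar>))"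
      by (rule edge_bound[OF \<kappa> slit_map_nonzero slit_map_nonzero]) (rule that)
    obtain n0 where n0: "real n0 > \<bar>L\<bar> + \<bar>Re w0\<bar> + \<bar>Re w1\<bar>"
      using reals_Archimedean2 by blast
    have "cmod (J n - pi * (m w0 - m w1)) \<le> pi * (K * exp (- (\<delta> * real n)))" if "n \<ge> n0" for n
    proof -
      have n: "real n > \<bar>L\<bar> + \<bar>Re w0\<bar> + \<bar>Re w1\<bar>"
        using n0 that by linarith
      have ax: "\<bar>X n\<bar> \<ge> real n" "\<bar>Y n\<bar> \<ge> real n"
        using X(1)[of n] Y(1)[of n] by linarith+
      have decay: "K * exp (- (\<delta> * \<bar>x\<bar>)) \<le> K * exp (- (\<delta> * real n))" if "\<bar>x\<bar> \<ge> real n" for x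
        using K(1,2) that by (intro mult_left_mono) auto
      have "Y n < Re w0" "Re w0 < X n" "Y n < Re w1" "Re w1 < X n" "L \<le> real n"
        using n X(1)[of n] Y(1)[of n] by linarith+
      then show ?thesis
        unfolding J_def annulus_def using w ends
        by (intro truncated_representation order_trans[OF K(3) decay] X(2) Y(2) order_trans[OF _ ax(1)] order_trans[OF _ ax(2)] ax)
    qed
    then have "\<forall>\<^sub>F n in sequentially. norm (J n - pi * (m w0 - m w1)) \<le> pi * (K * exp (- (\<delta> * real n)))"
      unfolding eventually_sequentially by blast
    moreover have "(\<lambda>n. pi * (K * exp (- (\<delta> * real n)))) \<longlonglongrightarrow> 0"
    proof -
      have "(\<lambda>n. exp (- \<delta>) ^ n) \<longlonglongrightarrow> 0"
        using K(1) by (intro LIMSEQ_realpow_zero) auto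
      then have "(\<lambda>n. exp (- (\<delta> * real n))) \<longlonglongrightarrow> 0"
        by (simp add: mult.commute flip: exp_of_nat_mult)
      then show ?thesis
        by (intro tendsto_mult_right_zero)
    qed
    ultimately have "(\<lambda>n. J n - pi * (m w0 - m w1)) \<longlonglongrightarrow> 0"
      by (rule Lim_null_comparison)
    then show "(\<lambda>n. LINT E:annulus (Y n) (X n)|\<nu>. 1 / (of_real E - slit_map w0) - 1 / (of_real E - slit_map w1))
        \<longlonglongrightarrow> pi * (m w0 - m w1)"
      unfolding J_def by (rule LIM_zero_cancel)
  qed
qed

section \<open>Integrability, finiteness on compact sets, and passage to the limit\<close>

lemma annulus_eventually:
  assumes "\<And>n. real n \<le> X n" "\<And>n. Y n \<le> - real n" "E \<noteq> 0"
  shows "\<forall>\<^sub>F n in sequentially. E \<in> annulus (Y n) (X n)"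
proof -
  obtain n0 where n0: "\<bar>ln \<bar>E\<bar>\<bar> < real n0"
    using reals_Archimedean2 by blast
  have "E \<in> annulus (Y n) (X n)" if "n \<ge> n0" for n
  proof -
    have "- 2 * X n \<le> ln \<bar>E\<bar>" "ln \<bar>E\<bar> \<le> - 2 * Y n"
      using n0 that assms(1)[of n] assms(2)[of n] by linarith+
    then have "exp (- 2 * X n) \<le> exp (ln \<bar>E\<bar>)" "exp (ln \<bar>E\<bar>) \<le> exp (- 2 * Y n)"
      by (simp_all only: exp_le_cancel_iff)
    then show ?thesis
      using assms(3) by (auto simp: annulus_def abs_if split: if_splits)
  qed
  then show ?thesis
    unfolding eventually_sequentially by blast
qed

lemma annulus_borel [measurable]: "annulus Y X \<in> sets borel"
  by (simp add: annulus_def)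

lemma emeasure_\<nu>_0: "{0} \<in> null_sets \<nu>"
  using S_neg by (auto simp: null_sets_def emeasure_\<nu>_singleton)

definition w\<^sub>i :: complex where
  "w\<^sub>i = Complex 0 (pi / 4)"

lemma slit_map_cnj: "slit_map (cnj w) = cnj (slit_map w)"
  by (simp add: slit_map_def exp_cnj)

lemma slit_map_w\<^sub>i: "slit_map w\<^sub>i = \<i>" "slit_map (cnj w\<^sub>i) = - \<i>"
proof -
  show "slit_map w\<^sub>i = \<i>"
    by (simp add: slit_map_def w\<^sub>i_def complex_eq_iff Re_exp Im_exp)
  then show "slit_map (cnj w\<^sub>i) = - \<i>"
    by (simp add: slit_map_cnj)
qed

lemma integrable_\<nu>: "integrable \<nu> (\<lambda>E. 1 / (E\<^sup>2 + 1))"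
proof (rule integrableI_nonneg)
  obtain X Y :: "nat \<Rightarrow> real"
  where XY: "\<And>n. real n \<le> X n" "\<And>n. Y n \<le> - real n"
    and lim: "\<And>w0 w1. 0 < \<bar>Im w0\<bar> \<Longrightarrow> \<bar>Im w0\<bar> < pi / 2 \<Longrightarrow> 0 < \<bar>Im w1\<bar> \<Longrightarrow> \<bar>Im w1\<bar> < pi / 2 \<Longrightarrow> w0 \<noteq> w1 \<Longrightarrow>
      (\<lambda>n. LINT E:annulus (Y n) (X n)|\<nu>. 1 / (of_real E - slit_map w0) - 1 / (of_real E - slit_map w1))
        \<longlonglongrightarrow> pi * (m w0 - m w1)"
    by (rule representation_limit) (rule that)
  define J where "J n = (LINT E:annulus (Y n) (X n)|\<nu>. 1 / (E\<^sup>2 + 1))" for n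
  have sq: "(complex_of_real E)\<^sup>2 + 1 \<noteq> 0" for E
  proof -
    have "complex_of_real (E\<^sup>2 + 1) \<noteq> 0"
      by (simp only: of_real_eq_0_iff) (smt (verit) zero_le_power2)
    then show ?thesis by simp
  qed
  have int: "set_integrable \<nu> (annulus (Y n) (X n)) (\<lambda>E. complex_of_real (1 / (E\<^sup>2 + 1)))" for n
    unfolding annulus_def
    using sq by (intro integral_\<nu>_annulus) (auto intro!: continuous_intros)
  have int': "set_integrable \<nu> (annulus (Y n) (X n)) (\<lambda>E. 1 / (E\<^sup>2 + 1))" for n
    using integrable_Re[OF int[of n, unfolded set_integrable_def]] by (simp add: set_integrable_def)
  have J: "(LINT E:annulus (Y n) (X n)|\<nu>. 1 / (of_real E - slit_map w\<^sub>i) - 1 / (of_real E - slit_map (cnj w\<^sub>i)))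
      = 2 * \<i> * of_real (J n)" for n
  proof -
    have "1 / (of_real E - slit_map w\<^sub>i) - 1 / (of_real E - slit_map (cnj w\<^sub>i)) = 2 * \<i> * complex_of_real (1 / (E\<^sup>2 + 1))" for E
    proof -
      have "of_real E - \<i> \<noteq> 0" "of_real E + \<i> \<noteq> 0"
        by (auto simp: complex_eq_iff)
      then show ?thesis
        using sq[of E] unfolding slit_map_w\<^sub>i by (simp add: divide_simps) (simp add: algebra_simps power2_eq_square)
    qed
    then have "(LINT E:annulus (Y n) (X n)|\<nu>. 1 / (of_real E - slit_map w\<^sub>i) - 1 / (of_real E - slit_map (cnj w\<^sub>i)))
        = 2 * \<i> * (LINT E:annulus (Y n) (X n)|\<nu>. complex_of_real (1 / (E\<^sup>2 + 1)))"
      by (simp only: set_integral_mult_right)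
    also have "(LINT E:annulus (Y n) (X n)|\<nu>. complex_of_real (1 / (E\<^sup>2 + 1))) = of_real (J n)"
      unfolding J_def by (rule set_integral_complex_of_real)
    finally show ?thesis .
  qed
  have "0 < \<bar>Im w\<^sub>i\<bar>" "\<bar>Im w\<^sub>i\<bar> < pi / 2" "0 < \<bar>Im (cnj w\<^sub>i)\<bar>" "\<bar>Im (cnj w\<^sub>i)\<bar> < pi / 2" "w\<^sub>i \<noteq> cnj w\<^sub>i"
    by (simp_all add: w\<^sub>i_def complex_eq_iff)
  from lim[OF this] have "(\<lambda>n. 2 * \<i> * of_real (J n)) \<longlonglongrightarrow> pi * (m w\<^sub>i - m (cnj w\<^sub>i))"
    unfolding J .
  from tendsto_Im[OF this] have "(\<lambda>n. 2 * J n) \<longlonglongrightarrow> Im (pi * (m w\<^sub>i - m (cnj w\<^sub>i)))"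
    by simp
  from tendsto_mult_left[OF this, of "1/2"]
  obtain J0 where J0: "J \<longlonglongrightarrow> J0" by auto
  have nn: "(\<integral>\<^sup>+E. ennreal (1 / (E\<^sup>2 + 1)) * indicator (annulus (Y n) (X n)) E \<partial>\<nu>) = ennreal (J n)" for n
  proof -
    have "(\<integral>\<^sup>+E. ennreal (1 / (E\<^sup>2 + 1)) * indicator (annulus (Y n) (X n)) E \<partial>\<nu>)
        = (\<integral>\<^sup>+E. ennreal (indicator (annulus (Y n) (X n)) E *\<^sub>R (1 / (E\<^sup>2 + 1))) \<partial>\<nu>)"
      by (intro nn_integral_cong) (auto split: split_indicator)
    also have "\<dots> = ennreal (J n)"
      unfolding J_def set_lebesgue_integral_def using int'[of n]
      by (intro nn_integral_eq_integral) (auto simp: set_integrable_def)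
    finally show ?thesis .
  qed
  have "(\<integral>\<^sup>+E. ennreal (1 / (E\<^sup>2 + 1)) \<partial>\<nu>)
      \<le> (\<integral>\<^sup>+E. liminf (\<lambda>n. ennreal (1 / (E\<^sup>2 + 1)) * indicator (annulus (Y n) (X n)) E) \<partial>\<nu>)"
  \<comment> \<open>No annulus contains 0, so the pointwise limit holds only off 0, which is a null
    set.\<close>
  proof (rule nn_integral_mono_AE, rule eventually_mono[OF AE_not_in[OF emeasure_\<nu>_0]])
    fix E :: real assume "E \<notin> {0}"
    then have "\<forall>\<^sub>F n in sequentially. E \<in> annulus (Y n) (X n)"
      using XY by (intro annulus_eventually) auto
    then have "(\<lambda>n. ennreal (1 / (E\<^sup>2 + 1)) * indicator (annulus (Y n) (X n)) E) \<longlonglongrightarrow> ennreal (1 / (E\<^sup>2 + 1))"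
      by (intro tendsto_eventually) (auto elim: eventually_mono)
    then show "ennreal (1 / (E\<^sup>2 + 1)) \<le> liminf (\<lambda>n. ennreal (1 / (E\<^sup>2 + 1)) * indicator (annulus (Y n) (X n)) E)"
      by (simp add: lim_imp_Liminf)
  qed
  also have "\<dots> \<le> liminf (\<lambda>n. \<integral>\<^sup>+E. ennreal (1 / (E\<^sup>2 + 1)) * indicator (annulus (Y n) (X n)) E \<partial>\<nu>)"
    by (rule nn_integral_liminf) measurable
  also have "\<dots> = ennreal J0"
    unfolding nn using J0 by (intro lim_imp_Liminf tendsto_ennrealI) auto
  finally show "(\<integral>\<^sup>+E. ennreal (1 / (E\<^sup>2 + 1)) \<partial>\<nu>) < \<infinity>"
    by (simp add: le_less_trans[OF _ ennreal_less_top])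
qed auto

text \<open>The atoms may accumulate at 0, so finiteness there is drawn from integrability: on a set
  bounded by r the indicator is at most (r^2 + 1) / (E^2 + 1).\<close>

lemma radon_\<nu>: "radon_measure \<nu>"
  unfolding radon_measure_def
proof (intro conjI allI impI)
  fix K :: "real set"
  assume "compact K"
  then have [measurable]: "K \<in> sets borel"
    by (simp add: borel_compact)
  obtain r where r: "\<And>x. x \<in> K \<Longrightarrow> \<bar>x\<bar> \<le> r"
    using compact_imp_bounded[OF \<open>compact K\<close>] by (auto simp: bounded_iff)
  have "emeasure \<nu> K = (\<integral>\<^sup>+E. indicator K E \<partial>\<nu>)"
    by simp
  also have "\<dots> \<le> (\<integral>\<^sup>+E. ennreal ((r\<^sup>2 + 1) * (1 / (E\<^sup>2 + 1))) \<partial>\<nu>)"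
  proof (rule nn_integral_mono)
    fix E
    have "1 \<le> (r\<^sup>2 + 1) * (1 / (E\<^sup>2 + 1))" if "E \<in> K"
    proof -
      have "E\<^sup>2 \<le> r\<^sup>2"
        using r[OF that] by (simp add: abs_le_square_iff[symmetric])
      then show ?thesis
        by (simp add: pos_le_divide_eq add_nonneg_pos)
    qed
    then show "indicator K E \<le> ennreal ((r\<^sup>2 + 1) * (1 / (E\<^sup>2 + 1)))"
      by (auto split: split_indicator)
  qed
  also have "\<dots> = ennreal (\<integral>E. (r\<^sup>2 + 1) * (1 / (E\<^sup>2 + 1)) \<partial>\<nu>)"
    by (intro nn_integral_eq_integral integrable_mult_right integrable_\<nu>) auto
  finally show "emeasure \<nu> K < \<infinity>"
    by (simp add: le_less_trans[OF _ ennreal_less_top])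
qed simp

text \<open>Once 1 / (E^2 + 1) is integrable, dominated convergence replaces the truncated integrals
  by the full one; the corrections E / (E^2 + 1) cancel in the difference.\<close>

lemma kernel_difference:
  assumes w: "0 < \<bar>Im w0\<bar>" "\<bar>Im w0\<bar> < pi / 2" "0 < \<bar>Im w1\<bar>" "\<bar>Im w1\<bar> < pi / 2"
  shows "(\<integral>E. 1 / (of_real E - slit_map w0) - of_real (E / (E\<^sup>2 + 1)) \<partial>\<nu>)
    - (\<integral>E. 1 / (of_real E - slit_map w1) - of_real (E / (E\<^sup>2 + 1)) \<partial>\<nu>) = pi * (m w0 - m w1)"
proof (cases "w0 = w1")
  case False
  obtain X Y :: "nat \<Rightarrow> real"
  where XY: "\<And>n. real n \<le> X n" "\<And>n. Y n \<le> - real n"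
    and lim: "\<And>w0 w1. 0 < \<bar>Im w0\<bar> \<Longrightarrow> \<bar>Im w0\<bar> < pi / 2 \<Longrightarrow> 0 < \<bar>Im w1\<bar> \<Longrightarrow> \<bar>Im w1\<bar> < pi / 2 \<Longrightarrow> w0 \<noteq> w1 \<Longrightarrow>
      (\<lambda>n. LINT E:annulus (Y n) (X n)|\<nu>. 1 / (of_real E - slit_map w0) - 1 / (of_real E - slit_map w1))
        \<longlonglongrightarrow> pi * (m w0 - m w1)"
    by (rule representation_limit) (rule that)
  have Im: "Im (slit_map w) \<noteq> 0" if "0 < \<bar>Im w\<bar>" "\<bar>Im w\<bar> < pi / 2" for w
    using slit_map_not_real[OF that, of "Re (slit_map w)"] by (auto simp: complex_eq_iff)
  define g where "g E = 1 / (of_real E - slit_map w0) - 1 / (of_real E - slit_map w1)" for E :: real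
  have int: "integrable \<nu> (\<lambda>E. 1 / (of_real E - slit_map w0) - of_real (E / (E\<^sup>2 + 1)))"
    "integrable \<nu> (\<lambda>E. 1 / (of_real E - slit_map w1) - of_real (E / (E\<^sup>2 + 1)))"
    using Im w by (intro integrable_herglotz_kernel integrable_\<nu>; simp)+
  have g_int: "integrable \<nu> g"
    using Bochner_Integration.integrable_diff[OF int] by (simp add: g_def[abs_def])
  have "(\<lambda>n. LINT E:annulus (Y n) (X n)|\<nu>. g E) \<longlonglongrightarrow> (\<integral>E. g E \<partial>\<nu>)"
    unfolding set_lebesgue_integral_def
  proof (rule integral_dominated_convergence[where w = "\<lambda>E. norm (g E)"])
    show "AE E in \<nu>. (\<lambda>n. indicator (annulus (Y n) (X n)) E *\<^sub>R g E) \<longlonglongrightarrow> g E"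
    proof (rule eventually_mono[OF AE_not_in[OF emeasure_\<nu>_0]])
      fix E :: real assume "E \<notin> {0}"
      then have "\<forall>\<^sub>F n in sequentially. E \<in> annulus (Y n) (X n)"
        using XY by (intro annulus_eventually) auto
      then show "(\<lambda>n. indicator (annulus (Y n) (X n)) E *\<^sub>R g E) \<longlonglongrightarrow> g E"
        by (intro tendsto_eventually) (auto elim: eventually_mono)
    qed
    show "AE E in \<nu>. norm (indicator (annulus (Y n) (X n)) E *\<^sub>R g E) \<le> norm (g E)" for n
      by (auto split: split_indicator)
    show "(\<lambda>E. indicator (annulus (Y n) (X n)) E *\<^sub>R g E) \<in> borel_measurable \<nu>" for n
      unfolding g_def[abs_def] by measurable
  qed (use g_int in auto)
  moreover have "(\<lambda>n. LINT E:annulus (Y n) (X n)|\<nu>. g E) \<longlonglongrightarrow> pi * (m w0 - m w1)"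
    unfolding g_def by (rule lim) (use w False in auto)
  ultimately have "(\<integral>E. g E \<partial>\<nu>) = pi * (m w0 - m w1)"
    by (rule LIMSEQ_unique)
  then show ?thesis
    unfolding Bochner_Integration.integral_diff[OF int, symmetric] by (simp add: g_def)
qed simp

text \<open>The base points \<open>w\<^sub>i\<close> and \<open>cnj w\<^sub>i\<close> are mapped to \<open>\<i>\<close> and \<open>- \<i>\<close>, where the kernel
  \<open>1 / (t - z) - t / (t\<^sup>2 + 1)\<close> has opposite values.\<close>

lemma representation:
  assumes "0 < \<bar>Im w\<bar>" "\<bar>Im w\<bar> < pi / 2"
  shows "pi * m w = pi * Re (m w\<^sub>i) + (\<integral>E. 1 / (of_real E - slit_map w) - of_real (E / (E\<^sup>2 + 1)) \<partial>\<nu>)"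
proof -
  define I where "I z = (\<integral>E. 1 / (of_real E - z) - of_real (E / (E\<^sup>2 + 1)) \<partial>\<nu>)" for z :: complex
  have wi: "0 < \<bar>Im w\<^sub>i\<bar>" "\<bar>Im w\<^sub>i\<bar> < pi / 2" "0 < \<bar>Im (cnj w\<^sub>i)\<bar>" "\<bar>Im (cnj w\<^sub>i)\<bar> < pi / 2"
    by (simp_all add: w\<^sub>i_def)
  have "1 / (of_real E - (- \<i>)) - of_real (E / (E\<^sup>2 + 1)) = - (1 / (of_real E - \<i>) - of_real (E / (E\<^sup>2 + 1)))" for E
  proof -
    have "of_real E - \<i> \<noteq> 0" "of_real E + \<i> \<noteq> 0" "(of_real E)\<^sup>2 + 1 = (of_real E - \<i>) * (of_real E + \<i>)"
      by (auto simp: complex_eq_iff algebra_simps power2_eq_square)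
    then show ?thesis
      by (simp add: divide_simps)
  qed
  then have I_cnj: "I (- \<i>) = - I \<i>"
    unfolding I_def by (simp only: Bochner_Integration.integral_minus)
  have I_diff: "I (slit_map w) - I \<i> = pi * (m w - m w\<^sub>i)" "I (slit_map w) - I (- \<i>) = pi * (m w - cnj (m w\<^sub>i))"
    unfolding I_def cnj_m using kernel_difference[OF assms wi(1,2)] kernel_difference[OF assms wi(3,4)]
    by (simp_all only: slit_map_w\<^sub>i)
  \<comment> \<open>Averaging over both base points eliminates the unknown I(i), and conjugate
    values of \<open>m\<close> leave only the real constant.\<close>
  have "2 * I (slit_map w) = (I (slit_map w) - I \<i>) + (I (slit_map w) - I (- \<i>))"
    unfolding I_cnj by simp
  then have "2 * I (slit_map w) = pi * (2 * m w - (m w\<^sub>i + cnj (m w\<^sub>i)))"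
    unfolding I_diff by (simp add: algebra_simps)
  then have "2 * I (slit_map w) = 2 * (pi * m w - pi * Re (m w\<^sub>i))"
    by (simp add: complex_add_cnj algebra_simps)
  then have "I (slit_map w) = pi * m w - pi * Re (m w\<^sub>i)"
    by (simp only: mult_cancel_left) simp
  then show ?thesis
    unfolding I_def[symmetric] by simp
qed

end


section \<open>The function R and the measure V\<close>

lemma is_R_R: "is_R (\<lambda>(\<zeta>, \<theta>, z). R \<zeta> \<theta> z)"
proof -
  have "is_R (THE F. is_R F)"
    by (rule theI'[OF ex1_is_R])
  moreover have "(THE F. is_R F) = (\<lambda>(\<zeta>, \<theta>, z). R \<zeta> \<theta> z)"
    by (auto simp: R_def fun_eq_iff)
  ultimately show ?thesis by simp
qed

text \<open>For \<kappa>^2 = \<zeta> \<noteq> 0 the characterizing formula is exp (\<kappa> w) cos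
  (\<theta> - y) - exp (- \<kappa> w) cos (\<theta> + y), divided by \<kappa>, with y = pi \<kappa>
  / 2; expanding the cosines leaves sinh and cosh of \<kappa> w. Both sides are continuous in
  \<zeta>, which gives \<zeta> = 0.\<close>

lemma R_eq:
  assumes z: "z \<in> slit_plane"
  defines "w \<equiv> (\<i> * of_real pi - slit_ln z) / 2"
  shows "R \<zeta> \<theta> z = 2 * (Ch (- \<zeta>) (of_real pi / 2) * cos \<theta> * Sh \<zeta> w + Sh (- \<zeta>) (of_real pi / 2) * sin \<theta> * Ch \<zeta> w)"
    (is "_ = ?rhs \<zeta>")
proof -
  have nz: "R \<zeta> \<theta> z = ?rhs \<zeta>" if "\<zeta> \<noteq> 0" for \<zeta>
  proof -
    define \<kappa> where "\<kappa> = csqrt \<zeta>"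
    define y where "y = of_real pi * \<kappa> / 2"
    have \<kappa>: "\<kappa> \<noteq> 0" "\<zeta> = \<kappa>\<^sup>2"
      using that by (auto simp: \<kappa>_def)
    have c: "Ch (- \<zeta>) (of_real pi / 2) = cos y"
    proof -
      have "Ch ((\<i> * \<kappa>)\<^sup>2) (of_real pi / 2) = cosh (\<i> * \<kappa> * (of_real pi / 2))"
        by (rule Ch_power2)
      moreover have "\<i> * \<kappa> * (of_real pi / 2) = \<i> * y"
        by (simp add: y_def)
      ultimately show ?thesis
        by (simp add: \<kappa>(2) power_mult_distrib cosh_conv_cos flip: mult.assoc)
    qed
    have s: "\<kappa> * Sh (- \<zeta>) (of_real pi / 2) = sin y"
    proof -
      have "\<i> * \<kappa> * Sh ((\<i> * \<kappa>)\<^sup>2) (of_real pi / 2) = sinh (\<i> * \<kappa> * (of_real pi / 2))"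
        by (rule Sh_power2)
      moreover have "\<i> * \<kappa> * (of_real pi / 2) = \<i> * y"
        by (simp add: y_def)
      ultimately have "\<i> * (\<kappa> * Sh (- \<zeta>) (of_real pi / 2)) = \<i> * sin y"
        by (simp add: \<kappa>(2) power_mult_distrib sinh_conv_sin flip: mult.assoc)
      then show ?thesis by simp
    qed
    have "R \<zeta> \<theta> z = 1 / \<kappa> *
          (slit_powr z (- \<kappa> / 2) * exp (\<i> * complex_of_real pi * \<kappa> / 2)
              * cos (\<theta> - complex_of_real pi * \<kappa> / 2)
           - slit_powr z (\<kappa> / 2) * exp (- \<i> * complex_of_real pi * \<kappa> / 2)
              * cos (\<theta> + complex_of_real pi * \<kappa> / 2))"
      using is_R_R \<kappa> z unfolding is_R_def by simp
    also have "slit_powr z (- \<kappa> / 2) * exp (\<i> * complex_of_real pi * \<kappa> / 2) = exp (\<kappa> * w)"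
      unfolding slit_powr_def exp_add[symmetric] w_def
      by (rule arg_cong[where f = exp]) (simp add: field_simps)
    also have "slit_powr z (\<kappa> / 2) * exp (- \<i> * complex_of_real pi * \<kappa> / 2) = exp (- (\<kappa> * w))"
      unfolding slit_powr_def exp_add[symmetric] w_def
      by (rule arg_cong[where f = exp]) (simp add: field_simps)
    finally have "\<kappa> * R \<zeta> \<theta> z = exp (\<kappa> * w) * cos (\<theta> - y) - exp (- (\<kappa> * w)) * cos (\<theta> + y)"
      using \<kappa>(1) by (simp add: y_def)
    also have "\<dots> = 2 * (cos y * cos \<theta> * sinh (\<kappa> * w) + sin y * sin \<theta> * cosh (\<kappa> * w))"
      by (simp add: cos_add cos_diff sinh_field_def cosh_field_def field_simps)
    also have "\<dots> = \<kappa> * ?rhs \<zeta>"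
      unfolding c s[symmetric] Sh_power2[symmetric] Ch_power2[symmetric] \<kappa>(2)[symmetric] by (simp add: algebra_simps)
    finally show ?thesis
      using \<kappa>(1) by simp
  qed
  have "R 0 \<theta> z = ?rhs 0"
  proof -
    have "isCont (\<lambda>(\<zeta>, \<theta>, z). R \<zeta> \<theta> z) (0, \<theta>, z)"
      using is_R_R z has_derivative_continuous unfolding is_R_def holomorphic3_on_def by blast
    moreover have "((\<lambda>\<zeta>. (\<zeta>, \<theta>, z)) \<longlongrightarrow> (0, \<theta>, z)) (at 0)"
      by (intro tendsto_intros)
    ultimately have "((\<lambda>\<zeta>. (\<lambda>(\<zeta>, \<theta>, z). R \<zeta> \<theta> z) (\<zeta>, \<theta>, z)) \<longlongrightarrow> (\<lambda>(\<zeta>, \<theta>, z). R \<zeta> \<theta> z) (0, \<theta>, z)) (at 0)"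
      by (rule isCont_tendsto_compose)
    then have "((\<lambda>\<zeta>. R \<zeta> \<theta> z) \<longlongrightarrow> R 0 \<theta> z) (at 0)"
      by simp
    moreover have "continuous_on UNIV ?rhs"
      unfolding Ch_def Sh_def
      by (intro continuous_intros continuous_on_compose2[OF holomorphic_on_imp_continuous_on[OF Cos_holomorphic]]
          continuous_on_compose2[OF holomorphic_on_imp_continuous_on[OF Sinc_holomorphic]]) auto
    then have "isCont ?rhs 0"
      using continuous_on_eq_continuous_at[OF open_UNIV] by blast
    then have "(?rhs \<longlongrightarrow> ?rhs 0) (at 0)"
      by (rule isContD)
    then have "((\<lambda>\<zeta>. R \<zeta> \<theta> z) \<longlongrightarrow> ?rhs 0) (at 0)"
      by (rule Lim_transform_eventually) (simp add: eventually_at_filter nz)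
    ultimately show ?thesis
      using tendsto_unique at_neq_bot by blast
  qed
  with nz show ?thesis by (cases "\<zeta> = 0") auto
qed

lemma slit_plane_upper: "Im z > 0 \<Longrightarrow> z \<in> slit_plane"
  and slit_plane_real: "E \<noteq> 0 \<Longrightarrow> of_real E \<in> slit_plane"
  by (auto simp: slit_plane_iff complex_nonpos_Reals_iff)

lemma Im_slit_ln_upper:
  assumes "Im z > 0"
  shows "0 < Im (slit_ln z)" "Im (slit_ln z) < pi"
proof -
  have "\<bar>Im (Ln (- \<i> * z))\<bar> < pi / 2"
    using assms by (subst Re_Ln_pos_lt) auto
  then show "0 < Im (slit_ln z)" "Im (slit_ln z) < pi"
    by (auto simp: slit_ln_def)
qed

lemma slit_ln_pos: "E > 0 \<Longrightarrow> slit_ln (of_real E) = of_real (ln E)"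
  and slit_ln_neg: "E < 0 \<Longrightarrow> slit_ln (of_real E) = of_real (ln (- E)) + \<i> * of_real pi"
proof -
  show "slit_ln (of_real E) = of_real (ln E)" if "E > 0"
  proof -
    have "Ln (- \<i> * of_real E) = Ln (of_real E) + Ln (- \<i>)"
      using Ln_times_of_real[OF that, of "- \<i>"] that by (simp add: mult.commute Ln_of_real)
    then show ?thesis
      using that by (simp add: slit_ln_def Ln_of_real)
  qed
  show "slit_ln (of_real E) = of_real (ln (- E)) + \<i> * of_real pi" if "E < 0"
  proof -
    have "- \<i> * of_real E = of_real (- E) * \<i>"
      by simp
    moreover have "Ln (of_real (- E) * \<i>) = of_real (ln (- E)) + Ln \<i>"
    proof -
      have "0 < - E" using that by simp
      from Ln_times_of_real[OF this, of \<i>] Ln_of_real[OF this] show ?thesis by simp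
    qed
    ultimately have "Ln (- \<i> * of_real E) = of_real (ln (- E)) + Ln \<i>"
      by (simp only:)
    then show ?thesis
      unfolding slit_ln_def by (simp only:) simp
  qed
qed

context strip
begin

section \<open>Translation of \<open>R\<close>, \<open>M\<close> and \<open>V\<close> to the
  strip\<close>

lemma R_eq_D:
  assumes "z \<in> slit_plane"
  shows "R (of_real \<alpha>) (of_real \<theta>) z = 2 * D ((\<i> * of_real pi - slit_ln z) / 2)"
    and "R (of_real \<alpha>) (of_real (\<theta> + pi / 2)) z = 2 * N ((\<i> * of_real pi - slit_ln z) / 2)"
proof -
  have c: "Ch (- of_real \<alpha>) (of_real pi / 2) = complex_of_real c"
    and s: "Sh (- of_real \<alpha>) (of_real pi / 2) = complex_of_real s"
    using Ch_of_real[of "- \<alpha>" "pi / 2", where 'a = complex] Sh_of_real[of "- \<alpha>" "pi / 2", where 'a = complex]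
    by (simp_all add: c_def s_def)
  show "R (of_real \<alpha>) (of_real \<theta>) z = 2 * D ((\<i> * of_real pi - slit_ln z) / 2)"
    unfolding R_eq[OF assms] c s D_def by (simp add: cos_of_real sin_of_real)
  have "cos (complex_of_real (\<theta> + pi / 2)) = - of_real (sin \<theta>)" "sin (complex_of_real (\<theta> + pi / 2)) = of_real (cos \<theta>)"
    by (simp_all add: cos_add sin_add flip: cos_of_real sin_of_real of_real_minus)
  then show "R (of_real \<alpha>) (of_real (\<theta> + pi / 2)) z = 2 * N ((\<i> * of_real pi - slit_ln z) / 2)"
    unfolding R_eq[OF assms] c s N_def by simp
qed

text \<open>The left side is Sh (- \<alpha>) pi, so this is the doubling formula sin 2u = 2 sin u
  cos u.\<close>

lemma Sinc_eq: "pi * Sinc (pi\<^sup>2 * \<alpha>) = 2 * s * c"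
proof -
  have "Sh (- \<alpha>) (pi / 2 + pi / 2) = 2 * s * c"
    unfolding Sh_add_real c_def s_def by simp
  then show ?thesis
    by (simp add: Sh_def mult.commute)
qed

lemma c_eq: "c = Cos (pi\<^sup>2 * \<alpha> / 4)"
  by (simp add: c_def Ch_def power_divide mult.commute)

lemma M_eq:
  assumes "Im z > 0"
  shows "M \<alpha> \<theta> z = m ((\<i> * of_real pi - slit_ln z) / 2)"
proof -
  define w where "w = (\<i> * of_real pi - slit_ln z) / 2"
  have "Sinc (complex_of_real (pi\<^sup>2 * \<alpha>)) = of_real (2 * s * c / pi)"
    unfolding Sinc_of_real Sinc_eq[symmetric] by simp
  then have "2 * of_real pi ^ 2 * (Sinc (complex_of_real (pi\<^sup>2 * \<alpha>)))\<^sup>2 = of_real (8 * c\<^sup>2 * s\<^sup>2)"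
    by (simp add: power_divide power_mult_distrib)
  then show ?thesis
    unfolding M_def R_eq_D[OF slit_plane_upper[OF assms]] m_def w_def[symmetric] by simp
qed

lemma slit_map_inverse:
  assumes "z \<in> slit_plane"
  shows "slit_map ((\<i> * of_real pi - slit_ln z) / 2) = z"
proof -
  have *: "- 2 * ((\<i> * of_real pi - slit_ln z) / 2) = slit_ln z - \<i> * of_real pi"
    by simp
  show ?thesis
    unfolding slit_map_def * exp_diff exp_slit_ln[OF assms] by simp
qed

text \<open>On the upper half-plane the logarithm has imaginary part in (0, pi), so w lies in the
  upper half of the strip. The representation there has a real constant and no linear term.\<close>

lemma herglotz_\<nu>: "herglotz_measure (\<lambda>z. of_real pi * M \<alpha> \<theta> z) \<nu>"
  unfolding herglotz_measure_def
proof (intro conjI radon_\<nu> integrable_\<nu>, rule exI[of _ "pi * Re (m w\<^sub>i)"], rule exI[of _ 0], intro conjI allI impI)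
  fix z :: complex
  assume z: "Im z > 0"
  define w where "w = (\<i> * of_real pi - slit_ln z) / 2"
  have "0 < \<bar>Im w\<bar>" "\<bar>Im w\<bar> < pi / 2"
    using Im_slit_ln_upper[OF z] by (simp_all add: w_def)
  from representation[OF this]
  show "of_real pi * M \<alpha> \<theta> z = of_real (pi * Re (m w\<^sub>i)) + of_real 0 * z
      + (\<integral>t. 1 / (of_real t - z) - of_real (t / (t\<^sup>2 + 1)) \<partial>\<nu>)"
    unfolding M_eq[OF z] w_def slit_map_inverse[OF slit_plane_upper[OF z]] by simp
qed simp

lemma V_eq_\<nu>: "V \<alpha> \<theta> = \<nu>"
  unfolding V_def using herglotz_\<nu> herglotz_measure_unique by (intro the_equality) auto

lemma \<Sigma>_eq_S: "\<Sigma> \<alpha> \<theta> = S"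
proof -
  have "R (of_real \<alpha>) (of_real \<theta>) (of_real E) = 2 * of_real (D (- ln (- E) / 2))" if "E < 0" for E
  proof -
    have "(\<i> * of_real pi - slit_ln (of_real E)) / 2 = of_real (- ln (- E) / 2)"
      unfolding slit_ln_neg[OF that] by simp
    then show ?thesis
      using that by (simp only: R_eq_D slit_plane_real of_real_D)
  qed
  then show ?thesis
    by (auto simp: \<Sigma>_def S_def)
qed

lemma t_density_eq_t: "t_density \<alpha> \<theta> = t"
proof
  fix E
  have "R (of_real \<alpha>) (of_real \<theta>) (of_real E) = 2 * D (Complex (- ln E / 2) (pi / 2))" if "E > 0"
  proof -
    have "(\<i> * of_real pi - slit_ln (of_real E)) / 2 = Complex (- ln E / 2) (pi / 2)"
      unfolding slit_ln_pos[OF that] by (simp add: complex_eq_iff)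
    then show ?thesis
      using that by (simp only: R_eq_D slit_plane_real)
  qed
  then show "t_density \<alpha> \<theta> E = t E"
    by (simp add: t_density_def t_def norm_mult power_mult_distrib)
qed

end

section \<open>The function \<open>\<omega>\<close> and the sign of \<open>q\<close>\<close>

lemma \<omega>_shift: "\<omega> (\<theta> + of_int n * pi) = \<omega> \<theta>"
proof -
  have per: "\<omega> (x + pi) = \<omega> x" for x
    using theI'[OF ex1_is_omega] unfolding \<omega>_def is_omega_def by blast
  show ?thesis
  proof (induction n rule: int_induct[where k = 0])
    case (step1 i)
    then show ?case
      using per[of "\<theta> + of_int i * pi"] by (simp add: algebra_simps)
  next
    case (step2 i)
    then show ?case
      using per[of "\<theta> + of_int (i - 1) * pi"] by (simp add: algebra_simps)
  qed simp
qed

lemma \<omega>_eq: "\<bar>\<theta>\<bar> \<le> pi / 2 \<Longrightarrow> \<omega> \<theta> = (1 - 2 * \<bar>\<theta>\<bar> / pi)\<^sup>2"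
  using theI'[OF ex1_is_omega] unfolding \<omega>_def is_omega_def by blast

lemma reduce_mod_pi:
  obtains n :: int where "\<bar>\<theta> - of_int n * pi\<bar> \<le> pi / 2"
proof
  define n where "n = \<lfloor>\<theta> / pi + 1 / 2\<rfloor>"
  have "of_int n \<le> \<theta> / pi + 1 / 2" "\<theta> / pi + 1 / 2 < of_int n + 1"
    unfolding n_def by linarith+
  then have "of_int n * pi \<le> \<theta> + pi / 2" "\<theta> + pi / 2 < of_int n * pi + pi"
    by (simp_all add: field_simps)
  then show "\<bar>\<theta> - of_int n * pi\<bar> \<le> pi / 2"
    by linarith
qed

text \<open>Modulo pi let \<theta> be \<phi> with |\<phi>| \<le> pi / 2 and v = 1 - 2 |\<phi>| / pi,
  so that \<omega> = v^2. Then v \<le> sqrt \<alpha> < 1, and since cosine decreases, cos (sqrt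
  \<alpha> * pi / 2) \<le> cos (v pi / 2) = sin |\<phi>|. This says q \<le> 0, which excludes real
  zeros of \<open>D\<close>.\<close>

lemma Cos_square_le_sin_square:
  assumes "\<omega> \<theta> \<le> \<alpha>" "\<alpha> < 1"
  shows "(Cos (pi\<^sup>2 * \<alpha> / 4))\<^sup>2 \<le> (sin \<theta>)\<^sup>2"
proof -
  obtain n where n: "\<bar>\<theta> - of_int n * pi\<bar> \<le> pi / 2"
    by (rule reduce_mod_pi)
  define \<phi> where "\<phi> = \<theta> - of_int n * pi"
  define v where "v = 1 - 2 * \<bar>\<phi>\<bar> / pi"
  have v: "0 \<le> v" "v * pi / 2 = pi / 2 - \<bar>\<phi>\<bar>"
    using n by (simp_all add: v_def \<phi>_def field_simps)
  have "v\<^sup>2 \<le> \<alpha>"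
    using assms(1) \<omega>_shift[of \<phi> n] \<omega>_eq[of \<phi>] n by (simp add: \<phi>_def v_def)
  then have \<alpha>: "0 \<le> \<alpha>" "v \<le> sqrt \<alpha>" "sqrt \<alpha> < 1"
    using assms(2) v(1) by (auto intro: real_le_rsqrt order_trans[OF zero_le_power2])
  have "v * pi \<le> sqrt \<alpha> * pi" "sqrt \<alpha> * pi \<le> 1 * pi" "0 \<le> v * pi" "0 \<le> sqrt \<alpha> * pi"
    using \<alpha> v(1) by (auto intro: mult_right_mono)
  then have x: "v * pi / 2 \<le> sqrt \<alpha> * pi / 2" "sqrt \<alpha> * pi / 2 \<le> pi / 2" "0 \<le> v * pi / 2" "0 \<le> sqrt \<alpha> * pi / 2"
    "sqrt \<alpha> * pi / 2 \<le> pi" "- (pi / 2) \<le> sqrt \<alpha> * pi / 2"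
    using pi_gt_zero by linarith+
  have "Cos (pi\<^sup>2 * \<alpha> / 4) = cos (sqrt \<alpha> * pi / 2)"
    using Cos_square[of "sqrt \<alpha> * pi / 2"] \<alpha>(1) by (simp add: power_divide power_mult_distrib mult.commute)
  moreover have "cos (sqrt \<alpha> * pi / 2) \<le> cos (v * pi / 2)"
    by (rule cos_monotone_0_pi_le[OF x(3,1,5)])
  moreover have "0 \<le> cos (sqrt \<alpha> * pi / 2)"
    by (rule cos_ge_zero[OF x(6,2)])
  moreover have "cos (v * pi / 2) = sin \<bar>\<phi>\<bar>"
    unfolding v(2) by (simp add: cos_diff)
  ultimately have "(Cos (pi\<^sup>2 * \<alpha> / 4))\<^sup>2 \<le> (sin \<bar>\<phi>\<bar>)\<^sup>2"
    by (intro power_mono) auto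
  also have "(sin \<bar>\<phi>\<bar>)\<^sup>2 = (sin \<phi>)\<^sup>2"
    by (simp add: abs_if)
  also have "\<dots> = (sin \<theta>)\<^sup>2"
    by (simp add: \<phi>_def sin_diff power_mult_distrib mult.commute[of _ pi] cos_npi_int sin_npi_int)
  finally show ?thesis .
qed

theorem theorem3p2:
  fixes \<alpha> \<theta> :: real
  assumes "\<alpha> < 1"
  shows "atoms (V \<alpha> \<theta>) = \<Sigma> \<alpha> \<theta>
    \<and> continuous_part (V \<alpha> \<theta>) = density lborel (\<lambda>E. ennreal (t_density \<alpha> \<theta> E))
    \<and> ((\<alpha>, \<theta>) \<in> Q0 \<longrightarrow> \<Sigma> \<alpha> \<theta> = {})
    \<and> ((\<alpha>, \<theta>) \<in> Q_ge1 \<longrightarrow> (\<forall>E \<in> \<Sigma> \<alpha> \<theta>.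
         emeasure (V \<alpha> \<theta>) {E} =
           ennreal (\<bar>E\<bar> / (2 * Sinc (pi\<^sup>2 * \<alpha>) * ((Cos (pi\<^sup>2 * \<alpha> / 4))\<^sup>2 - (sin \<theta>)\<^sup>2)))))"
proof -
  interpret strip \<alpha> \<theta>
    by standard fact
  have "\<Sigma> \<alpha> \<theta> = {}" if "(\<alpha>, \<theta>) \<in> Q0"
  proof -
    have "q \<le> 0"
      using Cos_square_le_sin_square[of \<theta> \<alpha>] that by (simp add: q_def c_eq Q0_def)
    then show ?thesis
      using q_pos unfolding \<Sigma>_eq_S S_def by force
  qed
  moreover have "emeasure (V \<alpha> \<theta>) {E}
      = ennreal (\<bar>E\<bar> / (2 * Sinc (pi\<^sup>2 * \<alpha>) * ((Cos (pi\<^sup>2 * \<alpha> / 4))\<^sup>2 - (sin \<theta>)\<^sup>2)))" if "E \<in> \<Sigma> \<alpha> \<theta>" for E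
  proof -
    have h: "4 * c * s * q = pi * (2 * Sinc (pi\<^sup>2 * \<alpha>) * q)"
      using Sinc_eq by (simp add: mult_ac)
    have "wt E = \<bar>E\<bar> / (2 * Sinc (pi\<^sup>2 * \<alpha>) * q)"
      unfolding wt_def h by simp
    then show ?thesis
      using that by (simp add: V_eq_\<nu> \<Sigma>_eq_S emeasure_\<nu>_singleton q_def c_eq)
  qed
  ultimately show ?thesis
    using atoms_\<nu> continuous_part_\<nu> by (simp add: V_eq_\<nu> \<Sigma>_eq_S t_density_eq_t)
qed

end
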